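(* Let $a,b>0$ with $a\ne b$, and let $G=\mathbb R\ltimes\mathbb R^2$ be the solvable Lie group where the $\mathbb R$-action on $\mathbb R^2$ is defined by $z\cdot(x,y)=(e^{az}x,e^{-bz}y)$. Then there is no finitely generated group $\Gamma$ quasi-isometric to $G$.
   Context: A map $f:X\to Y$ between metric spaces is a $(K,C)$-quasi-isometry ($K\ge 1$, $C\ge 0$) if $\frac1K d_X(x_1,x_2)-C\le d_Y(f(x_1),f(x_2))\le K d_X(x_1,x_2)+C$ for all $x_1,x_2\in X$, and the $C$-neighborhood of $f(X)$ is all of $Y$. Two spaces are quasi-isometric if there is a $(K,C)$-quasi-isometry between them for some $K,C$. A finitely generated group carries the word metric of any finite generating set. The Lie group $G$ carries a left-invariant Riemannian metric. *)

theory Defs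
  imports "HOL-Analysis.Analysis" "HOL-Algebra.Generated_Groups"
begin

definition quasi_isometry ::
  "real \<Rightarrow> real \<Rightarrow> 'a set \<Rightarrow> ('a \<Rightarrow> 'a \<Rightarrow> real) \<Rightarrow> 'b set \<Rightarrow> ('b \<Rightarrow> 'b \<Rightarrow> real) \<Rightarrow> ('a \<Rightarrow> 'b) \<Rightarrow> bool"
  where
  "quasi_isometry K C X dX Y dY f \<longleftrightarrow>
     1 \<le> K \<and> 0 \<le> C \<and> f ` X \<subseteq> Y \<and>
     (\<forall>x1\<in>X. \<forall>x2\<in>X. 1 / K * dX x1 x2 - C \<le> dY (f x1) (f x2) \<and>
                    dY (f x1) (f x2) \<le> K * dX x1 x2 + C) \<and>
     (\<forall>y\<in>Y. \<exists>x\<in>X. dY y (f x) \<le> C)"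

definition quasi_isometric ::
  "'a set \<Rightarrow> ('a \<Rightarrow> 'a \<Rightarrow> real) \<Rightarrow> 'b set \<Rightarrow> ('b \<Rightarrow> 'b \<Rightarrow> real) \<Rightarrow> bool"
  where
  "quasi_isometric X dX Y dY \<longleftrightarrow> (\<exists>K C f. quasi_isometry K C X dX Y dY f)"

definition word_length :: "('g, 'm) monoid_scheme \<Rightarrow> 'g set \<Rightarrow> 'g \<Rightarrow> nat"
  where
  "word_length \<Gamma> S g =
     (LEAST n. \<exists>ws. length ws = n \<and> set ws \<subseteq> S \<union> m_inv \<Gamma> ` S \<and> foldr (mult \<Gamma>) ws (one \<Gamma>) = g)"

definition word_dist :: "('g, 'm) monoid_scheme \<Rightarrow> 'g set \<Rightarrow> 'g \<Rightarrow> 'g \<Rightarrow> real"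
  where
  "word_dist \<Gamma> S g h = real (word_length \<Gamma> S (m_inv \<Gamma> g \<otimes>\<^bsub>\<Gamma>\<^esub> h))"

primrec C_k :: "nat \<Rightarrow> ('a::euclidean_space \<Rightarrow> real) \<Rightarrow> bool"
  where
  "C_k 0 f \<longleftrightarrow> continuous_on UNIV f"
| "C_k (Suc k) f \<longleftrightarrow>
     (\<forall>p. f differentiable at p) \<and> (\<forall>v. C_k k (\<lambda>p. frechet_derivative f (at p) v))"

text \<open>The manifold is the whole vector space, so every tangent space is identified with it:
  \<open>m p v w\<close> is the inner product of the tangent vectors \<open>v\<close> and \<open>w\<close> at \<open>p\<close>.\<close>

definition riemannian_metric :: "('a::euclidean_space \<Rightarrow> 'a \<Rightarrow> 'a \<Rightarrow> real) \<Rightarrow> bool"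
  where
  "riemannian_metric m \<longleftrightarrow>
     (\<forall>p. bilinear (m p)) \<and>
     (\<forall>p v w. m p v w = m p w v) \<and>
     (\<forall>p v. v \<noteq> 0 \<longrightarrow> 0 < m p v v) \<and>
     (\<forall>k v w. C_k k (\<lambda>p. m p v w))"

definition speed :: "('a::euclidean_space \<Rightarrow> 'a \<Rightarrow> 'a \<Rightarrow> real) \<Rightarrow> (real \<Rightarrow> 'a) \<Rightarrow> real \<Rightarrow> real"
  where
  "speed m \<gamma> t =
     sqrt (m (\<gamma> t) (vector_derivative \<gamma> (at t)) (vector_derivative \<gamma> (at t)))"

text \<open>\<^const>\<open>valid_path\<close> permits an unbounded derivative near the finitely many break points, so the
  speed need not be integrable; the integral would then be \<open>0\<close> by convention.  Hence the
  integrability condition below, which excludes exactly the paths of infinite length.\<close>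

definition riemannian_dist :: "('a::euclidean_space \<Rightarrow> 'a \<Rightarrow> 'a \<Rightarrow> real) \<Rightarrow> 'a \<Rightarrow> 'a \<Rightarrow> real"
  where
  "riemannian_dist m p q =
     Inf {integral {0..1} (speed m \<gamma>) | \<gamma>.
            valid_path \<gamma> \<and> pathstart \<gamma> = p \<and> pathfinish \<gamma> = q \<and>
            speed m \<gamma> integrable_on {0..1}}"

text \<open>For a group law on the whole space: every left translation is an isometry.\<close>

definition left_invariant ::
  "('a::euclidean_space, 'm) monoid_scheme \<Rightarrow> ('a \<Rightarrow> 'a \<Rightarrow> 'a \<Rightarrow> real) \<Rightarrow> bool"
  where
  "left_invariant G m \<longleftrightarrow>
     (\<forall>g p v w. m (g \<otimes>\<^bsub>G\<^esub> p)
                  (frechet_derivative (\<lambda>q. g \<otimes>\<^bsub>G\<^esub> q) (at p) v)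
                  (frechet_derivative (\<lambda>q. g \<otimes>\<^bsub>G\<^esub> q) (at p) w) = m p v w)"

fun sol_action :: "real \<Rightarrow> real \<Rightarrow> real \<Rightarrow> real \<times> real \<Rightarrow> real \<times> real"
  where
  "sol_action a b z (x, y) = (exp (a * z) * x, exp (- b * z) * y)"

text \<open>The pair \<open>(z, u)\<close> stands for \<open>u \<cdot> z\<close>, with \<open>u\<close> in the normal factor \<open>\<real>\<^sup>2\<close>; the manifold
  structure of the group is that of the vector space \<open>\<real> \<times> (\<real> \<times> \<real>)\<close>.\<close>

definition sol_group :: "real \<Rightarrow> real \<Rightarrow> (real \<times> (real \<times> real)) monoid"
  where
  "sol_group a b =
     \<lparr>carrier = UNIV,
      mult = (\<lambda>(z, u) (z', u'). (z + z', u + sol_action a b z u')),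
      one = (0, 0)\<rparr>"

lemma group_sol_group: "group (sol_group a b)"
proof (rule groupI)
  fix g assume "g \<in> carrier (sol_group a b)"
  obtain z x y where "g = (z, x, y)" by (cases g) auto
  then have "(- z, - (exp (- a * z) * x), - (exp (b * z) * y)) \<otimes>\<^bsub>sol_group a b\<^esub> g = \<one>\<^bsub>sol_group a b\<^esub>"
    by (simp add: sol_group_def zero_prod_def)
  then show "\<exists>h\<in>carrier (sol_group a b). h \<otimes>\<^bsub>sol_group a b\<^esub> g = \<one>\<^bsub>sol_group a b\<^esub>"
    by (rule bexI) (simp add: sol_group_def)
qed (auto simp: sol_group_def zero_prod_def algebra_simps exp_add exp_diff exp_minus field_simps)

end

theory Submission
  imports Defs
begin

text \<open>Two points of \<open>G\<close> that differ by \<open>dx\<close> and \<open>dy\<close> are joined, up to a bounded error, by the path that goes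
  down to the height \<open>N\<close> where \<open>dy\<close> has length one, and then up to the height \<open>M\<close> where \<open>dx\<close> has length
  one. Thus \<open>M - N\<close> is a coarse model of the distance, and \<open>M\<close> and \<open>N\<close> are ultrametric up to a constant.
  Reversing the height if necessary, let \<open>b < a\<close>.

  Given a quasi-isometric embedding of \<open>G\<close> in itself, coarse differentiation finds a scale at which most
  vertical segments of a large box are mapped close to vertical segments. Most of them cannot be turned
  upside down: a \<open>y\<close>-segment at the top of a box of height \<open>n\<close> has length about \<open>exp (b n)\<close>, but
  its image would have to cover an \<open>x\<close>-distance of order \<open>exp (a n)\<close>. Averaging over the box,
  one obtains a finite set of points such that every embedding with the given constants raises at least
  half of them far above the image of the origin.

  The left translations of a group quasi-isometric to \<open>G\<close> are such embeddings. Weight the group element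
  \<open>g\<close> by \<open>exp ((a - b) z)\<close>, where \<open>z\<close> is the height of \<open>g\<close>. Summing the rise over a set \<open>A\<close> of
  group elements yields a right translation, by an element of bounded length, that multiplies the total
  weight of \<open>A\<close> by at least \<open>4\<close>. So the weight of the \<open>k\<close>-th neighbourhood of a box grows like \<open>4^k\<close>;
  but weight is comparable to Lebesgue measure \<open>dz dx dy\<close>, which grows only polynomially.\<close>

subsection \<open>Coarse horocyclic geometry\<close>

text \<open>The hypothesis \<open>a \<noteq> b\<close> says that G is not unimodular, whereas
  counting measure on a group is invariant under translations from both sides; for
  \<open>a = b\<close> the group G has lattices and the statement fails. G is amenable, so a
  contradiction can only come from the discrepancy between its two Haar measures, and for this the
  translations must be known to respect the height in some sense. That every quasi-isometry of G
  coarsely preserves the height would be far more than is needed: an average over one finite set of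
  test points is enough, provided that this set depends only on the constants and not on the
  embedding. This demand for uniformity shapes the statements on boxes. The lines of a box are coded
  by digit words, so that "most lines" is plain counting, and an exceptional set is small once its
  words are shown to have no free choice of one digit.\<close>

definition words :: "nat \<Rightarrow> nat \<Rightarrow> nat list set" where
  "words m n = {y. length y = n \<and> set y \<subseteq> {..<m}}"

lemma finite_words: "finite (words m n)"
  using finite_lists_length_eq[of "{..<m}" n] by (simp add: words_def conj_commute)

lemma card_words: "card (words m n) = m ^ n"
  using card_lists_length_eq[of "{..<m}" n] by (simp add: words_def conj_commute)

text \<open>Overwriting digit \<open>i\<close> loses nothing: the first \<open>i\<close> digits
  survive and determine the digit that was there. So \<open>E\<close> times the set of digits embeds
  in the set of all words. In contrapositive form: a set of lines of density above
  \<open>1 / m\<close> contains two lines that part exactly at digit \<open>i\<close>.\<close>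

lemma card_branch:
  assumes E: "E \<subseteq> words m n" and i: "i < n"
    and det: "\<And>y y'. y \<in> E \<Longrightarrow> y' \<in> E \<Longrightarrow> take i y = take i y' \<Longrightarrow> y ! i = y' ! i"
  shows "card E * m \<le> m ^ n"
proof -
  define F where "F = (\<lambda>(y, d). list_update y i d :: nat list)"
  have "inj_on F (E \<times> {..<m})"
  proof (rule inj_onI, clarify)
    fix y d y' d' assume y: "y \<in> E" "y' \<in> E" and eq: "F (y, d) = F (y', d')"
    have len: "length y = n" "length y' = n" using y E by (auto simp: words_def)
    have "take i (F (y, d)) = take i y" "take i (F (y', d')) = take i y'" by (auto simp: F_def)
    then have t: "take i y = take i y'" using eq by simp
    have d: "d = d'" using eq len i nth_list_update_eq[of i y d] nth_list_update_eq[of i y' d'] by (simp add: F_def)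
    have "y ! k = y' ! k" if "k < n" for k
    proof (cases "k = i")
      case True then show ?thesis using det[OF y t] by simp
    next
      case False
      then show ?thesis using arg_cong[OF eq, of "\<lambda>z. z ! k"] by (simp add: F_def)
    qed
    then have "y = y'" using len by (simp add: list_eq_iff_nth_eq)
    with d show "y = y' \<and> d = d'" by simp
  qed
  moreover have "F ` (E \<times> {..<m}) \<subseteq> words m n"
    using E set_update_subset_insert by (fastforce simp: F_def words_def)
  ultimately have "card (E \<times> {..<m}) \<le> card (words m n)"
    using card_inj_on_le finite_words by blast
  then show ?thesis by (simp add: card_words card_cartesian_product)
qed

text \<open>Only upward steps are bounded; \<open>f\<close> may fall by any amount. The first time
  at which \<open>f\<close> reaches \<open>v\<close> works, because the step that leads there starts
  below \<open>v\<close>.\<close>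

lemma discrete_ivt:
  fixes f :: "nat \<Rightarrow> real"
  assumes step: "\<And>s. i \<le> s \<Longrightarrow> s < n \<Longrightarrow> f (Suc s) \<le> f s + K" and "0 \<le> K"
    and "f i \<le> v" "v \<le> f n" "i \<le> n"
  shows "\<exists>s. i \<le> s \<and> s \<le> n \<and> v \<le> f s \<and> f s \<le> v + K"
proof -
  define s where "s = (LEAST s. i \<le> s \<and> v \<le> f s)"
  have s: "i \<le> s" "v \<le> f s" and sn: "s \<le> n"
    using LeastI[of "\<lambda>s. i \<le> s \<and> v \<le> f s" n] Least_le[of "\<lambda>s. i \<le> s \<and> v \<le> f s" n] assms
    by (auto simp: s_def)
  have "f s \<le> v + K"
  proof (cases "s = i")
    case True then show ?thesis using assms by auto
  next
    case False
    then obtain s' where s': "s = Suc s'" "i \<le> s'" using s by (cases s) auto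
    then have "f s' < v"
      using not_less_Least[of s' "\<lambda>s. i \<le> s \<and> v \<le> f s"] unfolding s_def[symmetric] by auto
    then show ?thesis using step[of s'] s' sn by auto
  qed
  then show ?thesis using s sn by blast
qed

text \<open>\<open>M p q\<close> and \<open>N p q\<close> are the heights at which the vertical lines through \<open>p\<close> and \<open>q\<close> come together
  upwards and downwards; \<open>c\<close> is the error of the ultrametric inequalities.\<close>

locale horo =
  fixes h :: "'a \<Rightarrow> real" and M N :: "'a \<Rightarrow> 'a \<Rightarrow> real" and c :: real
  assumes c_nonneg: "0 \<le> c"
    and M_sym: "M p q = M q p"
    and N_sym: "N p q = N q p"
    and M_ge: "h p \<le> M p q"
    and N_le: "N p q \<le> h p"
    and M_self: "M p p = h p"
    and N_self: "N p p = h p"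
    and M_ultra: "M p r \<le> max (M p q) (M q r) + c"
    and N_ultra: "min (N p q) (N q r) - c \<le> N p r"
begin

definition D :: "'a \<Rightarrow> 'a \<Rightarrow> real" where "D p q = M p q - N p q"

text \<open>For two points of one vertical line, \<open>N\<close> is the height of the lower and
  \<open>M\<close> that of the upper one. This is required up to \<open>e\<close> for all pairs of
  times, in rising order; the speed is left to \<open>qline\<close>.\<close>

definition up :: "real \<Rightarrow> (nat \<Rightarrow> 'a) \<Rightarrow> nat \<Rightarrow> bool" where
  "up e P n \<longleftrightarrow> (\<forall>s t. s \<le> t \<and> t \<le> n \<longrightarrow> h (P s) - e \<le> N (P s) (P t) \<and> M (P s) (P t) \<le> h (P t) + e)"

definition dn :: "real \<Rightarrow> (nat \<Rightarrow> 'a) \<Rightarrow> nat \<Rightarrow> bool" where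
  "dn e P n \<longleftrightarrow> (\<forall>s t. s \<le> t \<and> t \<le> n \<longrightarrow> h (P t) - e \<le> N (P s) (P t) \<and> M (P s) (P t) \<le> h (P s) + e)"

text \<open>A quasi-geodesic without additive constant: times are integers, and the unit of height
  will be so large that the additive constant is absorbed.\<close>

definition qline :: "real \<Rightarrow> (nat \<Rightarrow> 'a) \<Rightarrow> nat \<Rightarrow> bool" where
  "qline K P n \<longleftrightarrow> (\<forall>s t. s \<le> n \<and> t \<le> n \<longrightarrow>
     \<bar>real s - real t\<bar> / K \<le> D (P s) (P t) \<and> D (P s) (P t) \<le> K * \<bar>real s - real t\<bar>)"

lemma M_ge': "h q \<le> M p q" using M_ge[of q p] M_sym by simp
lemma N_le': "N p q \<le> h q" using N_le[of q p] N_sym by simp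
lemma D_sym: "D p q = D q p" by (simp add: D_def M_sym[of p q] N_sym[of p q])
lemma D_nonneg: "0 \<le> D p q" using M_ge[of p q] N_le[of p q] by (simp add: D_def)
lemma D_self: "D p p = 0" by (simp add: D_def M_self N_self)
lemma h_diff: "\<bar>h p - h q\<bar> \<le> D p q"
  using M_ge[of p q] M_ge'[of q p] N_le[of p q] N_le'[of p q] by (auto simp: D_def)
lemma N_ge_D: "h p - D p q \<le> N p q" using M_ge[of p q] by (simp add: D_def)
lemma N_ge_D': "h q - D p q \<le> N p q" using M_ge'[of q p] by (simp add: D_def)
lemma M_le_D: "M p q \<le> h p + D p q" using N_le[of p q] by (simp add: D_def)
lemma M_le_D': "M p q \<le> h q + D p q" using N_le'[of p q] by (simp add: D_def)

text \<open>Both intervals \<open>[N, M]\<close> contain the height of \<open>q\<close>, so their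
  union is an interval; the ultrametric inequalities put \<open>[N p r, M p r]\<close> into it up to
  \<open>c\<close> at each end.\<close>

lemma D_tri: "D p r \<le> D p q + D q r + 2 * c"
  using M_ultra[of p r q] N_ultra[of p q r] M_ge'[of q p] M_ge[of q r] N_le'[of p q] N_le[of q r]
  unfolding D_def by linarith

lemma N_trans: "x \<le> N p q \<Longrightarrow> x \<le> N q r \<Longrightarrow> x - c \<le> N p r"
  using N_ultra[of p q r] by linarith
lemma M_trans: "M p q \<le> x \<Longrightarrow> M q r \<le> x \<Longrightarrow> M p r \<le> x + c"
  using M_ultra[of p r q] by linarith

lemma qlineD:
  assumes "qline K P n" "s \<le> n" "t \<le> n"
  shows "\<bar>real s - real t\<bar> / K \<le> D (P s) (P t)" "D (P s) (P t) \<le> K * \<bar>real s - real t\<bar>"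
  using assms by (auto simp: qline_def)

lemma qline_shift: "qline K P n \<Longrightarrow> i + k \<le> n \<Longrightarrow> qline K (\<lambda>t. P (i + t)) k"
proof -
  assume q: "qline K P n" and "i + k \<le> n"
  then show ?thesis
    unfolding qline_def[of K "\<lambda>t. P (i + t)"] using qlineD[OF q, of "i + _" "i + _"] by simp
qed

text \<open>Reversing the height exchanges \<open>M\<close> and \<open>N\<close>, so every fact on
  rising lines has a twin for descending ones.\<close>

lemma dual: "horo (\<lambda>p. - h p) (\<lambda>p q. - N p q) (\<lambda>p q. - M p q) c"
proof
  fix p q r
  show "- N p r \<le> max (- N p q) (- N q r) + c" using N_ultra[of p q r] by linarith
  show "min (- M p q) (- M q r) - c \<le> - M p r" using M_ultra[of p r q] by linarith
qed (use c_nonneg M_sym N_sym M_ge N_le M_self N_self in auto)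

lemma dual_D: "horo.D (\<lambda>p q. - N p q) (\<lambda>p q. - M p q) = D"
  by (intro ext) (simp add: horo.D_def[OF dual] D_def)

lemma dual_up: "horo.up (\<lambda>p. - h p) (\<lambda>p q. - N p q) (\<lambda>p q. - M p q) e P n \<longleftrightarrow> dn e P n"
  unfolding horo.up_def[OF dual] dn_def by (intro iff_allI imp_cong refl) linarith

lemma dual_qline: "horo.qline (\<lambda>p q. - N p q) (\<lambda>p q. - M p q) = qline"
  by (intro ext) (simp add: horo.qline_def[OF dual] dual_D qline_def)

lemma dn_rev: "dn e P n \<Longrightarrow> up e (\<lambda>t. P (n - t)) n"
  unfolding up_def dn_def
proof (intro allI impI)
  fix s t assume a: "\<forall>s t. s \<le> t \<and> t \<le> n \<longrightarrow> h (P t) - e \<le> N (P s) (P t) \<and> M (P s) (P t) \<le> h (P s) + e"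
    and st: "s \<le> t \<and> t \<le> n"
  from a have "h (P (n - s)) - e \<le> N (P (n - t)) (P (n - s)) \<and> M (P (n - t)) (P (n - s)) \<le> h (P (n - t)) + e"
    using st by (meson diff_le_mono2 diff_le_self)
  then show "h (P (n - s)) - e \<le> N (P (n - s)) (P (n - t)) \<and> M (P (n - s)) (P (n - t)) \<le> h (P (n - t)) + e"
    using M_sym N_sym by metis
qed

section \<open>Almost geodesic chains\<close>

text \<open>The two intervals \<open>[N, M]\<close> of a triple contain the height of the middle
  point, so a small overlap forces one to end there and the other to begin there. A chain that
  arrives at \<open>j\<close> rising must therefore leave \<open>j\<close> upwards. If it came to
  \<open>k\<close> from above, the ultrametric inequality would put \<open>N (Q i) (Q j)\<close>
  near the height of \<open>Q k\<close> or higher, although it is at least \<open>l - e\<close>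
  below the height of \<open>Q j\<close>; this is excluded by \<open>3 * e + c < l\<close>.\<close>

lemma chain_type:
  fixes Q :: "nat \<Rightarrow> 'a"
  assumes l0: "\<forall>i j. i < j \<and> j \<le> B \<longrightarrow> l \<le> D (Q i) (Q j)"
    and tri: "\<forall>i j k. i < j \<and> j < k \<and> k \<le> B \<longrightarrow>
        min (M (Q i) (Q j)) (M (Q j) (Q k)) - max (N (Q i) (Q j)) (N (Q j) (Q k)) \<le> e"
    and e: "0 \<le> e" "3 * e + c < l"
    and plus: "M (Q i) (Q j) \<le> h (Q j) + e" and ijk: "i < j" "j < k" "k \<le> B"
  shows "h (Q j) - e \<le> N (Q j) (Q k)" and "k < m \<Longrightarrow> m \<le> B \<Longrightarrow> M (Q j) (Q k) \<le> h (Q k) + e"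
proof -
  have e2: "2 * e < l" using e c_nonneg by linarith
  have types: "M (Q i) (Q j) \<le> h (Q j) + e \<and> h (Q j) - e \<le> N (Q j) (Q k)
      \<or> M (Q j) (Q k) \<le> h (Q j) + e \<and> h (Q j) - e \<le> N (Q i) (Q j)"
    if "i < j" "j < k" "k \<le> B" for i j k
  proof -
    have "l \<le> M (Q i) (Q j) - N (Q i) (Q j)" "l \<le> M (Q j) (Q k) - N (Q j) (Q k)"
      using l0 that by (auto simp: D_def)
    then show ?thesis
      using tri[rule_format, of i j k] that e2 M_ge'[of "Q j" "Q i"] M_ge[of "Q j" "Q k"] N_le'[of "Q i" "Q j"] N_le[of "Q j" "Q k"]
      by linarith
  qed
  have nn: "\<not> (M (Q i) (Q j) \<le> h (Q j) + e \<and> h (Q j) - e \<le> N (Q i) (Q j))" if "i < j" "j \<le> B" for i j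
    using l0[rule_format, of i j] that e2 by (auto simp: D_def)
  have nn': "\<not> (M (Q i) (Q j) \<le> h (Q i) + e \<and> h (Q i) - e \<le> N (Q i) (Q j))" if "i < j" "j \<le> B" for i j
    using l0[rule_format, of i j] that e2 by (auto simp: D_def)
  show A: "h (Q j) - e \<le> N (Q j) (Q k)"
    using types[OF ijk] nn[of i j] plus ijk by auto
  show "M (Q j) (Q k) \<le> h (Q k) + e" if km: "k < m" "m \<le> B"
  proof (rule ccontr)
    assume "\<not> ?thesis"
    then have mi: "M (Q k) (Q m) \<le> h (Q k) + e" "h (Q k) - e \<le> N (Q j) (Q k)"
      using types[of j k m] ijk km by auto
    have "h (Q k) - e \<le> N (Q i) (Q k)"
      using types[of i k m] nn'[of k m] mi ijk km by auto
    then have "h (Q k) - e - c \<le> N (Q i) (Q j)"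
      using N_ultra[of "Q i" "Q k" "Q j"] mi N_sym[of "Q k" "Q j"] by (auto simp: min_def split: if_splits)
    moreover have "N (Q i) (Q j) \<le> h (Q j) + e - l"
      using l0[rule_format, of i j] ijk plus by (auto simp: D_def)
    moreover have "h (Q j) - e \<le> h (Q k)" using A N_le'[of "Q j" "Q k"] by linarith
    ultimately show False using e by linarith
  qed
qed


text \<open>The direction of the first step propagates. The indices \<open>0\<close> and
  \<open>B\<close> are lost because \<open>chain_type\<close> needs a point before and a point after
  the pair.\<close>

lemma chain_plus:
  fixes Q :: "nat \<Rightarrow> 'a"
  assumes l0: "\<forall>i j. i < j \<and> j \<le> B \<longrightarrow> l \<le> D (Q i) (Q j)"
    and tri: "\<forall>i j k. i < j \<and> j < k \<and> k \<le> B \<longrightarrow>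
        min (M (Q i) (Q j)) (M (Q j) (Q k)) - max (N (Q i) (Q j)) (N (Q j) (Q k)) \<le> e"
    and e: "0 \<le> e" "3 * e + c < l"
    and plus: "M (Q 0) (Q 1) \<le> h (Q 1) + e" and kl: "1 \<le> k" "k < l'" "l' < B"
  shows "h (Q k) - e \<le> N (Q k) (Q l')" and "M (Q k) (Q l') \<le> h (Q l') + e"
proof -
  note ct = chain_type[where Q = Q and B = B and l = l and e = e, OF _ _ e]
  have 1: "M (Q 1) (Q k) \<le> h (Q k) + e" if "1 < k" "k < B" for k
    using ct(2)[OF l0 tri plus, of k B] that by simp
  have "h (Q k) - e \<le> N (Q k) (Q l') \<and> M (Q k) (Q l') \<le> h (Q l') + e"
  proof (cases "k = 1")
    case True
    then show ?thesis using ct(1)[OF l0 tri plus, of l'] 1[of l'] kl by auto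
  next
    case False
    then have "1 < k" using kl by auto
    then show ?thesis using ct(1)[OF l0 tri 1[of k], of l'] ct(2)[OF l0 tri 1[of k], of l' B] kl by auto
  qed
  then show "h (Q k) - e \<le> N (Q k) (Q l')" "M (Q k) (Q l') \<le> h (Q l') + e" by auto
qed

text \<open>Every time is within \<open>r\<close> of a grid point, at cost \<open>K * r\<close> in
  \<open>D\<close>. Rounding \<open>s\<close> up, and \<open>t\<close> down but not beyond
  \<open>B - 1\<close>, avoids the two ends of the grid, about which the chain says nothing. If no
  grid step remains in between, the times are at most \<open>3 * r\<close> apart and the Lipschitz
  bound suffices.\<close>

lemma up_of_chain:
  assumes q: "qline K P (B * r)" and K: "1 \<le> K" and r: "1 \<le> r" and B: "3 \<le> B"
    and ch: "\<And>k l'. 1 \<le> k \<Longrightarrow> k < l' \<Longrightarrow> l' < B \<Longrightarrow>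
        h (P (k * r)) - e \<le> N (P (k * r)) (P (l' * r)) \<and> M (P (k * r)) (P (l' * r)) \<le> h (P (l' * r)) + e"
    and e: "e + 2 * c \<le> 2 * K * real r" "0 \<le> e"
  shows "up (4 * K * real r) P (B * r)"
  unfolding up_def
proof (intro allI impI)
  fix s t assume st: "s \<le> t \<and> t \<le> B * r"
  define k where "k = s div r + 1"
  define l where "l = min (B - 1) (t div r)"
  have r0: "0 < r" using r by auto
  have sk: "s \<le> k * r" "k * r \<le> s + r"
    using div_mult_mod_eq[of s r] mod_less_divisor[OF r0, of s] unfolding k_def add_mult_distrib by linarith+
  have "t div r * r \<le> t" "t < t div r * r + r"
    using div_mult_mod_eq[of t r] mod_less_divisor[OF r0, of t] by linarith+
  then have lt: "l * r \<le> t \<and> t \<le> l * r + r"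
  proof (cases "t div r < B")
    case True then show ?thesis using \<open>t div r * r \<le> t\<close> \<open>t < t div r * r + r\<close> by (auto simp: l_def)
  next
    case False
    then have "l = B - 1" by (simp add: l_def)
    have "B * r \<le> t div r * r" using False by (intro mult_le_mono1) simp
    then have "B * r \<le> t" using \<open>t div r * r \<le> t\<close> by linarith
    then show ?thesis using \<open>l = B - 1\<close> st B by (simp add: diff_mult_distrib)
  qed
  have Kr: "K * real r \<ge> 0" using K by auto
  show "h (P s) - 4 * K * real r \<le> N (P s) (P t) \<and> M (P s) (P t) \<le> h (P t) + 4 * K * real r"
  proof (cases "k < l")
    case True
    have lB: "l < B" using B by (auto simp: l_def)
    have le: "k * r \<le> B * r" "l * r \<le> B * r" using True lB by (auto intro: mult_le_mono1)
    have "D (P s) (P (k * r)) \<le> K * \<bar>real s - real (k * r)\<bar>" using qlineD(2)[OF q, of s "k * r"] st le sk lt by auto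
    also have "\<dots> \<le> K * real r"
    proof (intro mult_left_mono)
      have "real (k * r) \<le> real (s + r)" "real s \<le> real (k * r)" using sk by (simp_all only: of_nat_le_iff)
      then show "\<bar>real s - real (k * r)\<bar> \<le> real r" unfolding of_nat_add by linarith
    qed (use K in auto)
    finally have d1: "D (P s) (P (k * r)) \<le> K * real r" .
    have "D (P (l * r)) (P t) \<le> K * \<bar>real (l * r) - real t\<bar>" using qlineD(2)[OF q, of "l * r" t] st le sk lt by auto
    also have "\<dots> \<le> K * real r"
    proof (intro mult_left_mono)
      have "real t \<le> real (l * r + r)" "real (l * r) \<le> real t" using lt by (simp_all only: of_nat_le_iff)
      then show "\<bar>real (l * r) - real t\<bar> \<le> real r" unfolding of_nat_add by linarith
    qed (use K in auto)
    finally have d2: "D (P (l * r)) (P t) \<le> K * real r" .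
    have "h (P (k * r)) - e \<le> N (P (k * r)) (P (l * r))" "M (P (k * r)) (P (l * r)) \<le> h (P (l * r)) + e"
      using ch[of k l] True lB by (auto simp: k_def)
    moreover define p where "p = P (k * r)"
    moreover define p' where "p' = P (l * r)"
    ultimately have m: "h p - e \<le> N p p'" "M p p' \<le> h p' + e"
      and d: "D (P s) p \<le> K * real r" "D p' (P t) \<le> K * real r"
      using d1 d2 by auto
    define w where "w = K * real r"
    note dw = d[folded w_def]
    have h1: "h (P s) - w \<le> h p" "h p' \<le> h (P t) + w"
      using h_diff[of "P s" p] h_diff[of p' "P t"] dw by linarith+
    have h2: "h p - e \<le> h p'" using m N_le'[of p p'] by linarith
    have n3: "h (P s) - 2 * w - e \<le> N (P s) p" "h (P s) - 2 * w - e \<le> N p p'" "h (P s) - 2 * w - e - c \<le> N p' (P t)"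
      using N_ge_D[of "P s" p] N_ge_D[of p' "P t"] m dw h1 h2 e Kr c_nonneg unfolding w_def[symmetric] by linarith+
    have "h (P s) - 2 * w - e - c - c \<le> N (P s) (P t)"
      by (rule N_trans[OF N_trans[OF n3(1,2)] n3(3)])
    moreover have m3: "M (P s) p \<le> h (P t) + 2 * w + e" "M p p' \<le> h (P t) + 2 * w + e" "M p' (P t) \<le> h (P t) + 2 * w + e + c"
      using M_le_D'[of "P s" p] M_le_D'[of p' "P t"] m dw h1 h2 e Kr c_nonneg unfolding w_def[symmetric] by linarith+
    have "M (P s) (P t) \<le> h (P t) + 2 * w + e + c + c"
      by (rule M_trans[OF M_trans[OF m3(1,2)] m3(3)])
    ultimately show ?thesis using e c_nonneg unfolding w_def by linarith
  next
    case False
    then have "t \<le> s + 3 * r"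
    proof -
      have "l * r \<le> k * r" using False by (intro mult_le_mono1) simp
      then show ?thesis using lt sk by linarith
    qed
    have "D (P s) (P t) \<le> K * \<bar>real s - real t\<bar>" using qlineD(2)[OF q, of s t] st by simp
    also have "\<dots> \<le> K * (3 * real r)" using \<open>t \<le> s + 3 * r\<close> st K by (intro mult_left_mono) auto
    finally show ?thesis using N_ge_D[of "P s" "P t"] M_le_D'[of "P s" "P t"] Kr by linarith
  qed
qed

text \<open>If a chain of points is almost geodesic, then the height intervals \<open>[N, M]\<close> of consecutive steps
  hardly overlap. Hence every triple either ascends or descends, and neighbouring triples agree.\<close>

lemma straight:
  assumes q: "qline K P (B * r)" and K: "1 \<le> K" and r: "1 \<le> r" and B: "3 \<le> B" and c: "100 * K * c \<le> 1"
    and ineff: "(\<Sum>i<B. D (P (i * r)) (P (Suc i * r)) + 2 * c) \<le> D (P 0) (P (B * r)) + 2 * c + real r / (10 * K)"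
  shows "up (4 * K * real r) P (B * r) \<or> dn (4 * K * real r) P (B * r)"
proof -
  define Q where "Q i = P (i * r)" for i
  \<comment> \<open>With \<open>2 * c\<close> added to every step, \<open>D_tri\<close> becomes an
    exact triangle inequality, so partial sums compare with single distances.\<close>
  define S where "S i j = (\<Sum>l\<in>{i..<j}. D (Q l) (Q (Suc l)) + 2 * c)" for i j
  define e where "e = real r / (10 * K)"
  have S_le: "D p (Q j) \<le> D p (Q i) + S i j" if "i \<le> j" for i j p
    using that
  proof (induction j)
    case 0 then show ?case by (simp add: S_def)
  next
    case (Suc j)
    show ?case
    proof (cases "i = Suc j")
      case True then show ?thesis by (simp add: S_def)
    next
      case False
      then have "D p (Q j) \<le> D p (Q i) + S i j" "S i (Suc j) = S i j + (D (Q j) (Q (Suc j)) + 2 * c)"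
        using Suc by (auto simp: S_def)
      then show ?thesis using D_tri[of p "Q (Suc j)" "Q j"] by linarith
    qed
  qed
  have S_ge: "D (Q i) (Q j) + 2 * c \<le> S i j" if "i < j" for i j
  proof -
    have "S i j = D (Q i) (Q (Suc i)) + 2 * c + S (Suc i) j" using that by (simp add: S_def sum.atLeast_Suc_lessThan)
    then show ?thesis using S_le[of "Suc i" j "Q i"] that by simp
  qed
  \<comment> \<open>A triple loses no more than the whole chain. Since \<open>D (Q i) (Q k)\<close>
    is at most the length of the union of the two intervals plus \<open>2 * c\<close>, this loss
    bounds their overlap.\<close>
  have tri: "min (M (Q i) (Q j)) (M (Q j) (Q k)) - max (N (Q i) (Q j)) (N (Q j) (Q k)) \<le> e"
    if ijk: "i < j" "j < k" "k \<le> B" for i j k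
  proof -
    have "S 0 B = S 0 i + (S i j + (S j k + S k B))"
      unfolding S_def using ijk by (simp add: sum.atLeastLessThan_concat)
    moreover have "S 0 B \<le> D (Q 0) (Q B) + 2 * c + e"
      using ineff by (simp add: S_def Q_def e_def lessThan_atLeast0)
    moreover have "D (Q 0) (Q B) \<le> S 0 i + D (Q i) (Q k) + S k B"
    proof -
      have "D (Q 0) (Q B) \<le> D (Q 0) (Q k) + S k B" using S_le[of k B] ijk by auto
      moreover have "D (Q 0) (Q k) \<le> S 0 i + D (Q i) (Q k)"
        using S_ge[of 0 i] D_tri[of "Q 0" "Q k" "Q i"] by (cases "i = 0") (auto simp: S_def)
      ultimately show ?thesis by linarith
    qed
    ultimately have "D (Q i) (Q j) + D (Q j) (Q k) + 2 * c \<le> D (Q i) (Q k) + e"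
      using S_ge[of i j] S_ge[of j k] ijk by linarith
    then show ?thesis
      using M_ultra[of "Q i" "Q k" "Q j"] N_ultra[of "Q i" "Q j" "Q k"] unfolding D_def by linarith
  qed
  then have tri': "\<forall>i j k. i < j \<and> j < k \<and> k \<le> B \<longrightarrow>
        min (M (Q i) (Q j)) (M (Q j) (Q k)) - max (N (Q i) (Q j)) (N (Q j) (Q k)) \<le> e" by blast
  have rK: "real r / K > 0" using r K by auto
  have l0: "real r / K \<le> D (Q i) (Q j)" if "i < j" "j \<le> B" for i j
  proof -
    have "i * r \<le> B * r" "j * r \<le> B * r" using that by auto
    have "real r * 1 \<le> real r * (real j - real i)" using that by (intro mult_left_mono) auto
    also have "\<dots> \<le> \<bar>real (i * r) - real (j * r)\<bar>" by (simp add: algebra_simps)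
    finally have "real r / K \<le> \<bar>real (i * r) - real (j * r)\<bar> / K" using K by (intro divide_right_mono) auto
    then show ?thesis using qlineD(1)[OF q \<open>i * r \<le> B * r\<close> \<open>j * r \<le> B * r\<close>] by (simp add: Q_def)
  qed
  then have l0': "\<forall>i j. i < j \<and> j \<le> B \<longrightarrow> real r / K \<le> D (Q i) (Q j)" by blast
  have c1: "c \<le> real r / K / 100"
  proof -
    have "100 * K * c \<le> real r" using c r by linarith
    then show ?thesis using K by (simp add: field_simps)
  qed
  have e': "e = real r / K / 10" using K by (simp add: e_def)
  obtain u where u: "u = real r / K" by blast
  have e: "0 \<le> e" "3 * e + c < real r / K" using e' c1 rK unfolding u[symmetric] by linarith+
  have "real r / K \<le> K * real r"
  proof -
    have "real r * 1 \<le> real r * (K * K)" using K mult_mono[of 1 K 1 K] by (intro mult_left_mono) auto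
    then show ?thesis using K by (simp add: divide_le_eq mult_ac)
  qed
  then have e2: "e + 2 * c \<le> 2 * K * real r" using e' c1 rK c_nonneg unfolding u[symmetric] by linarith
  \<comment> \<open>In the first triple the height of \<open>Q 1\<close> is an end point of the
    first interval, so the chain begins by rising or by falling.\<close>
  have cases: "M (Q 0) (Q 1) \<le> h (Q 1) + e \<or> h (Q 1) - e \<le> N (Q 0) (Q 1)"
  proof -
    have "real r / K \<le> M (Q 1) (Q 2) - N (Q 1) (Q 2)" using l0[of 1 2] B by (simp add: D_def)
    moreover have "min (M (Q 0) (Q 1)) (M (Q 1) (Q 2)) - max (N (Q 0) (Q 1)) (N (Q 1) (Q 2)) \<le> e"
      using tri[of 0 1 2] B by simp
    ultimately show ?thesis
      using M_ge'[of "Q 1" "Q 0"] M_ge[of "Q 1" "Q 2"] N_le'[of "Q 0" "Q 1"] N_le[of "Q 1" "Q 2"] e c_nonneg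
      unfolding u[symmetric] by linarith
  qed
  show ?thesis
  proof (cases "M (Q 0) (Q 1) \<le> h (Q 1) + e")
    case True
    have "up (4 * K * real r) P (B * r)"
    proof (rule up_of_chain[OF q K r B _ e2 e(1)])
      fix k l assume "1 \<le> k" "k < l" "l < B"
      from chain_plus[OF l0' tri' e True this]
      show "h (P (k * r)) - e \<le> N (P (k * r)) (P (l * r)) \<and> M (P (k * r)) (P (l * r)) \<le> h (P (l * r)) + e"
        by (simp add: Q_def)
    qed
    then show ?thesis ..
  next
    case False
    then have m: "h (Q 1) - e \<le> N (Q 0) (Q 1)" using cases by auto
    interpret d: horo "\<lambda>p. - h p" "\<lambda>p q. - N p q" "\<lambda>p q. - M p q" c by (rule dual)
    have t: "min (- N (Q i) (Q j)) (- N (Q j) (Q k)) - max (- M (Q i) (Q j)) (- M (Q j) (Q k)) \<le> e"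
      if "i < j" "j < k" "k \<le> B" for i j k using tri[OF that] by linarith
    then have t': "\<forall>i j k. i < j \<and> j < k \<and> k \<le> B \<longrightarrow>
        min (- N (Q i) (Q j)) (- N (Q j) (Q k)) - max (- M (Q i) (Q j)) (- M (Q j) (Q k)) \<le> e" by blast
    have "d.up (4 * K * real r) P (B * r)"
    proof (rule d.up_of_chain[OF _ K r B _ e2 e(1)])
      show "d.qline K P (B * r)" using q by (simp add: dual_qline)
      fix k l assume "1 \<le> k" "k < l" "l < B"
      have m': "- N (Q 0) (Q 1) \<le> - h (Q 1) + e" using m by linarith
      have "- h (Q k) - e \<le> - M (Q k) (Q l)" "- N (Q k) (Q l) \<le> - h (Q l) + e"
        using d.chain_plus[of B "real r / K" Q e, unfolded dual_D, OF l0' t' e m' \<open>1 \<le> k\<close> \<open>k < l\<close> \<open>l < B\<close>] by simp_all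
      then show "- h (P (k * r)) - e \<le> - M (P (k * r)) (P (l * r)) \<and> - N (P (k * r)) (P (l * r)) \<le> - h (P (l * r)) + e"
        unfolding Q_def by (rule conjI)
    qed
    then have "dn (4 * K * real r) P (B * r)" unfolding dual_up .
    then show ?thesis ..
  qed
qed


section \<open>Coarse differentiation\<close>

lemma D_chain: "0 < n \<Longrightarrow> D (Q 0) (Q n) + 2 * c \<le> (\<Sum>i<n. D (Q i) (Q (Suc i)) + 2 * c)"
proof (induction n)
  case (Suc n)
  then show ?case using D_tri[of "Q 0" "Q (Suc n)" "Q n"] by (cases "n = 0") auto
qed simp

text \<open>The total length measured at scale \<open>B ^ j\<close> decreases in \<open>j\<close> and is bounded at \<open>j = 0\<close>, so at some scale
  it hardly drops, and there most blocks satisfy the hypothesis of \<open>straight\<close>.\<close>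

lemma coarse_differentiation:
  fixes P :: "'b \<Rightarrow> nat \<Rightarrow> 'a"
  assumes K: "1 \<le> K" and B: "3 \<le> B" and mu: "0 < \<mu>" and k0: "10 * K * (K + 1) * real B \<le> \<mu> * real k0" "k0 \<le> k"
    and c: "100 * K * c \<le> 1" and fin: "finite \<Omega>" and ql: "\<And>\<omega>. \<omega> \<in> \<Omega> \<Longrightarrow> qline K (P \<omega>) (B ^ k)"
  obtains j where "j < k0"
    "real (card {(\<omega>, l). \<omega> \<in> \<Omega> \<and> l < B ^ (k - Suc j) \<and>
        \<not> (up (4 * K * real (B ^ j)) (\<lambda>t. P \<omega> (l * B ^ Suc j + t)) (B ^ Suc j) \<or>
           dn (4 * K * real (B ^ j)) (\<lambda>t. P \<omega> (l * B ^ Suc j + t)) (B ^ Suc j))})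
     \<le> \<mu> * real (card \<Omega>) * real (B ^ (k - Suc j))"
proof -
  define f where "f \<omega> j l = D (P \<omega> (l * B ^ j)) (P \<omega> (Suc l * B ^ j)) + 2 * c" for \<omega> j l
  define T where "T j = (\<Sum>\<omega>\<in>\<Omega>. \<Sum>l<B ^ (k - j). f \<omega> j l)" for j
  have Bp: "0 < B" using B by simp
  have f0: "0 \<le> f \<omega> j l" for \<omega> j l using D_nonneg c_nonneg by (simp add: f_def)
  have T0: "0 \<le> T j" for j unfolding T_def by (intro sum_nonneg f0)
  have "10 * K * (K + 1) * real B > 0" using K Bp by simp
  then have "0 < \<mu> * real k0" using k0 by linarith
  then have k0p: "0 < k0" using mu by (simp add: zero_less_mult_iff)
  have c1: "2 * c \<le> 1"
  proof -
    have "100 * c * 1 \<le> 100 * c * K" using K c_nonneg by (intro mult_left_mono) auto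
    then show ?thesis using c by (simp add: mult_ac)
  qed
  have Tz: "T 0 \<le> real (card \<Omega>) * (real (B ^ k) * (K + 1))"
  proof -
    have "f \<omega> 0 l \<le> K + 1" if "\<omega> \<in> \<Omega>" "l < B ^ k" for \<omega> l
      using qlineD(2)[OF ql[OF that(1)], of l "Suc l"] that c1 by (simp add: f_def)
    then have "(\<Sum>l<B ^ (k - 0). f \<omega> 0 l) \<le> real (B ^ k) * (K + 1)" if "\<omega> \<in> \<Omega>" for \<omega>
      using that sum_bounded_above[of "{..<B ^ k}" "f \<omega> 0" "K + 1"] by simp
    then show ?thesis unfolding T_def by (rule sum_bounded_above)
  qed
  have "\<exists>j<k0. T j - T (Suc j) \<le> T 0 / real k0"
  proof (rule ccontr)
    assume "\<not> ?thesis"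
    then have "(\<Sum>j<k0. T 0 / real k0) < (\<Sum>j<k0. T j - T (Suc j))"
      using k0p by (intro sum_strict_mono) auto
    then show False using T0[of k0] k0p by (simp add: sum_lessThan_telescope')
  qed
  then obtain j where j: "j < k0" "T j - T (Suc j) \<le> T 0 / real k0" by blast
  define n where "n = B ^ (k - Suc j)"
  define r where "r = B ^ j"
  have nB: "B ^ (k - j) = n * B" and rB: "B ^ Suc j = B * r" and Bk: "B ^ k = n * (B * r)"
  proof -
    have "k - j = Suc (k - Suc j)" "k = (k - Suc j) + Suc j" using j k0 by auto
    then show "B ^ (k - j) = n * B" "B ^ Suc j = B * r" "B ^ k = n * (B * r)"
      unfolding n_def r_def by (metis power_Suc2, simp, metis power_add power_Suc)
  qed
  have rp: "1 \<le> r" using Bp by (simp add: r_def)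
  define ie where "ie \<omega> l = (\<Sum>i<B. f \<omega> j (l * B + i)) - f \<omega> (Suc j) l" for \<omega> l
  have ieT: "T j - T (Suc j) = (\<Sum>\<omega>\<in>\<Omega>. \<Sum>l<n. ie \<omega> l)"
  proof -
    have "(\<Sum>l<B ^ (k - j). f \<omega> j l) = (\<Sum>l<n. \<Sum>i<B. f \<omega> j (l * B + i))" for \<omega>
    proof -
      have "(\<Sum>l<n * B. f \<omega> j l) = (\<Sum>l<n. sum (f \<omega> j) {l * B..<l * B + B})" by (rule sum.nat_group[symmetric])
      also have "\<dots> = (\<Sum>l<n. \<Sum>i<B. f \<omega> j (l * B + i))"
      proof (rule sum.cong[OF refl])
        fix l
        show "sum (f \<omega> j) {l * B..<l * B + B} = (\<Sum>i<B. f \<omega> j (l * B + i))"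
          using sum.shift_bounds_nat_ivl[of "f \<omega> j" 0 "l * B" B] by (simp add: lessThan_atLeast0 add.commute)
      qed
      finally show ?thesis by (simp add: nB)
    qed
    then show ?thesis by (simp add: T_def ie_def sum_subtractf n_def)
  qed
  have fj: "f \<omega> j (l * B + i) = D (P \<omega> (l * (B * r) + i * r)) (P \<omega> (l * (B * r) + Suc i * r)) + 2 * c" for \<omega> l i
    by (simp add: f_def r_def algebra_simps)
  have fSj: "f \<omega> (Suc j) l = D (P \<omega> (l * (B * r) + 0)) (P \<omega> (l * (B * r) + B * r)) + 2 * c" for \<omega> l
    by (simp add: f_def r_def algebra_simps)
  have ie0: "0 \<le> ie \<omega> l" for \<omega> l
    using D_chain[of B "\<lambda>i. P \<omega> (l * (B * r) + i * r)"] Bp by (simp add: ie_def fj fSj)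
  define bad where "bad = {(\<omega>, l). \<omega> \<in> \<Omega> \<and> l < n \<and>
        \<not> (up (4 * K * real r) (\<lambda>t. P \<omega> (l * (B * r) + t)) (B * r) \<or>
           dn (4 * K * real r) (\<lambda>t. P \<omega> (l * (B * r) + t)) (B * r))}"
  have badsub: "bad \<subseteq> \<Omega> \<times> {..<n}" by (auto simp: bad_def)
  have "real r / (10 * K) \<le> ie \<omega> l" if "(\<omega>, l) \<in> bad" for \<omega> l
  proof (rule ccontr)
    assume a: "\<not> ?thesis"
    have l: "\<omega> \<in> \<Omega>" "l < n" using that by (auto simp: bad_def)
    have "l * (B * r) + B * r \<le> B ^ k"
    proof -
      have "Suc l * (B * r) \<le> n * (B * r)" using l by (intro mult_le_mono1) auto
      then show ?thesis by (simp add: Bk)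
    qed
    then have "qline K (\<lambda>t. P \<omega> (l * (B * r) + t)) (B * r)" using qline_shift[OF ql[OF l(1)]] by blast
    from straight[OF this K rp B c] a that show False
      by (auto simp: bad_def ie_def fj fSj)
  qed
  \<comment> \<open>By \<open>straight\<close>, a bad block loses at least
    \<open>r / (10 * K)\<close>, while the total loss is at most \<open>T 0 / k0\<close>, with
    \<open>T 0\<close> bounded by the Lipschitz constant. The hypothesis on \<open>k0\<close> is
    what makes the quotient at most \<open>\<mu>\<close>; its factor \<open>B\<close> is the ratio
    of block length to \<open>r\<close>.\<close>
  then have "real (card bad) * (real r / (10 * K)) \<le> (\<Sum>(\<omega>, l)\<in>bad. ie \<omega> l)"
    by (intro sum_bounded_below) auto
  also have "\<dots> \<le> (\<Sum>(\<omega>, l)\<in>\<Omega> \<times> {..<n}. ie \<omega> l)"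
    using badsub fin ie0 by (intro sum_mono2) auto
  also have "\<dots> = T j - T (Suc j)" by (simp add: ieT sum.cartesian_product)
  also have "\<dots> \<le> real (card \<Omega>) * (real (B ^ k) * (K + 1)) / real k0"
    using j(2) Tz k0p by (meson divide_right_mono of_nat_0_le_iff order_trans)
  also have "\<dots> = real (card \<Omega>) * real n * (real r / (10 * K)) * (10 * K * (K + 1) * real B / real k0)"
  proof -
    have "real r / (10 * K) * (10 * K * (K + 1) * real B / real k0) = real r * (K + 1) * real B / real k0"
      using K by simp
    then have "real (card \<Omega>) * real n * (real r / (10 * K)) * (10 * K * (K + 1) * real B / real k0)
        = real (card \<Omega>) * real n * (real r * (K + 1) * real B / real k0)" by (simp only: mult.assoc)
    moreover have "real (card \<Omega>) * (real (B ^ k) * (K + 1)) / real k0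
        = real (card \<Omega>) * real n * (real r * (K + 1) * real B / real k0)" unfolding Bk by (simp add: mult_ac)
    ultimately show ?thesis by (simp only:)
  qed
  also have "\<dots> \<le> real (card \<Omega>) * real n * (real r / (10 * K)) * \<mu>"
    using k0 k0p K by (intro mult_left_mono) (auto simp: divide_le_eq mult_ac)
  finally have "real (card bad) * (real r / (10 * K)) \<le> (\<mu> * real (card \<Omega>) * real n) * (real r / (10 * K))"
    by (simp add: mult_ac)
  then have "real (card bad) \<le> \<mu> * real (card \<Omega>) * real n"
    by (rule mult_right_le_imp_le) (use rp K in simp)
  then show ?thesis
    using j(1) by (intro that[of j]) (simp_all only: bad_def n_def r_def power_Suc)
qed

text \<open>Vertical lines in a hyperbolic plane: those indexed by \<open>y\<close> and \<open>y'\<close> stay together while their digits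
  agree and separate at the first digit in which they differ.\<close>

definition plane :: "real \<Rightarrow> nat \<Rightarrow> nat \<Rightarrow> (nat list \<Rightarrow> nat \<Rightarrow> 'a) \<Rightarrow> bool" where
  "plane K m n g \<longleftrightarrow> (\<forall>y\<in>words m n. qline K (g y) n \<and> (\<forall>y'\<in>words m n.
      (\<forall>t\<le>n. take t y = take t y' \<longrightarrow> D (g y t) (g y' t) \<le> c) \<and>
      (\<forall>i<n. \<forall>s\<le>n. \<forall>t\<le>n. y ! i \<noteq> y' ! i \<longrightarrow> (real (max s t) - real i - 1) / K - c \<le> D (g y s) (g y' t))))"

lemma planeD:
  assumes "plane K m n g" "y \<in> words m n"
  shows "qline K (g y) n"
    and "y' \<in> words m n \<Longrightarrow> t \<le> n \<Longrightarrow> take t y = take t y' \<Longrightarrow> D (g y t) (g y' t) \<le> c"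
    and "y' \<in> words m n \<Longrightarrow> i < n \<Longrightarrow> s \<le> n \<Longrightarrow> t \<le> n \<Longrightarrow> y ! i \<noteq> y' ! i \<Longrightarrow>
      (real (max s t) - real i - 1) / K - c \<le> D (g y s) (g y' t)"
  using assms by (auto simp: plane_def)

lemma upD:
  assumes "up e P n" "s \<le> t" "t \<le> n"
  shows "h (P s) - e \<le> N (P s) (P t)" "M (P s) (P t) \<le> h (P t) + e"
  using assms by (auto simp: up_def)

lemma climb:
  assumes q: "qline K P n" and K: "1 \<le> K" and le: "i \<le> n'" "n' \<le> n" and v: "h (P i) \<le> v" "v \<le> h (P n')"
  obtains s where "i \<le> s" "s \<le> n'" "v \<le> h (P s)" "h (P s) \<le> v + K"
proof -
  have "h (P (Suc s)) \<le> h (P s) + K" if "i \<le> s" "s < n'" for s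
    using qlineD(2)[OF q, of s "Suc s"] h_diff[of "P (Suc s)" "P s"] D_sym[of "P s"] that le by simp
  then show ?thesis using discrete_ivt[of i n' "\<lambda>s. h (P s)" K v] K le v that by auto
qed

text \<open>Both lines would pass the height \<open>v\<close> at points within
  \<open>K + 2 * e + 5 * c\<close> of each other: these points are together downwards because they
  lie below the two ends, and together upwards because both are reached by rising from the common
  point at time \<open>i\<close>. But to climb from there to \<open>v\<close> takes so many steps
  that, by the last clause of \<open>plane\<close>, the lines are farther apart.\<close>

lemma collapse:
  assumes g: "plane K m n g" and y: "y \<in> words m n" "y' \<in> words m n" and K: "1 \<le> K" and c: "100 * c \<le> 1"
    and e: "0 \<le> e" and i: "i < n" "take i y = take i y'" "y ! i \<noteq> y' ! i" and k: "i + k \<le> n"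
    and up: "up e (\<lambda>t. g y (i + t)) k" "up e (\<lambda>t. g y' (i + t)) k"
    and v: "h (g y i) + K * (K * (K + 2 * e + 2) + 2) \<le> v"
    and N: "v \<le> N (g y n) (g y (i + k))" "v \<le> N (g y' n) (g y' (i + k))" "v \<le> N (g y n) (g y' n)"
  shows False
proof -
  define E where "E = K * (K * (K + 2 * e + 2) + 2)"
  have E0: "0 \<le> E" "1 \<le> E"
  proof -
    have "0 \<le> K * (K + 2 * e + 2)" using K e by (intro mult_nonneg_nonneg) auto
    then have "1 * 1 \<le> K * (K * (K + 2 * e + 2) + 2)" using K by (intro mult_mono) auto
    then show "0 \<le> E" "1 \<le> E" by (auto simp: E_def)
  qed
  have hy: "h (g y' i) \<le> h (g y i) + c"
    using planeD(2)[OF g y less_imp_le[OF i(1)] i(2)] h_diff[of "g y i" "g y' i"] by linarith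
  have v1: "h (g y i) \<le> v" "h (g y' i) \<le> v" using v E0 hy c unfolding E_def[symmetric] by linarith+
  have v2: "v \<le> h (g y (i + k))" "v \<le> h (g y' (i + k))"
    using N(1) N_le'[of "g y n" "g y (i + k)"] N(2) N_le'[of "g y' n" "g y' (i + k)"] by linarith+
  obtain s where s: "i \<le> s" "s \<le> i + k" "v \<le> h (g y s)" "h (g y s) \<le> v + K"
    using climb[OF planeD(1)[OF g y(1)] K le_add1 k v1(1) v2(1)] .
  obtain s' where s': "i \<le> s'" "s' \<le> i + k" "v \<le> h (g y' s')" "h (g y' s') \<le> v + K"
    using climb[OF planeD(1)[OF g y(2)] K le_add1 k v1(2) v2(2)] .
  have u: "h (g y s) - e \<le> N (g y s) (g y (i + k))" "M (g y i) (g y s) \<le> h (g y s) + e"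
    using upD(1)[OF up(1), of "s - i" k] upD(2)[OF up(1), of 0 "s - i"] s by auto
  have u': "h (g y' s') - e \<le> N (g y' s') (g y' (i + k))" "M (g y' i) (g y' s') \<le> h (g y' s') + e"
    using upD(1)[OF up(2), of "s' - i" k] upD(2)[OF up(2), of 0 "s' - i"] s' by auto
  have n1: "v - e - c \<le> N (g y s) (g y n)"
    by (rule N_trans[of _ _ "g y (i + k)"]) (use u s N e N_sym[of "g y n" "g y (i + k)"] in linarith)+
  have n2: "v - e - c \<le> N (g y' n) (g y' s')"
    by (rule N_trans[of _ _ "g y' (i + k)"]) (use u' s' N e N_sym[of "g y' s'" "g y' (i + k)"] in linarith)+
  have "v - e - c - c \<le> N (g y s) (g y' n)"
    by (rule N_trans[OF n1]) (use N e c_nonneg in auto)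
  then have n3: "v - e - c - c - c \<le> N (g y s) (g y' s')"
    by (rule N_trans) (use n2 c_nonneg in auto)
  have m1: "M (g y s) (g y i) \<le> v + K + e" using u s by (simp add: M_sym[of "g y s"])
  have m2: "M (g y i) (g y' i) \<le> v + K + e"
    using M_le_D[of "g y i" "g y' i"] planeD(2)[OF g y less_imp_le[OF i(1)] i(2)] v1 c K e by linarith
  have "M (g y s) (g y' i) \<le> v + K + e + c" by (rule M_trans[OF m1 m2])
  then have "M (g y s) (g y' s') \<le> v + K + e + c + c"
    by (rule M_trans) (use u' s' c_nonneg in auto)
  then have D1: "D (g y s) (g y' s') \<le> K + 2 * e + 5 * c" using n3 by (simp add: D_def)
  have "D (g y i) (g y s) \<le> K * \<bar>real i - real s\<bar>"
    using qlineD(2)[OF planeD(1)[OF g y(1)], of i s] s k by auto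
  moreover have "\<bar>real i - real s\<bar> = real s - real i" using s by simp
  ultimately have "E \<le> K * (real s - real i)"
    using h_diff[of "g y s" "g y i"] D_sym[of "g y s" "g y i"] s(3) v unfolding E_def[symmetric] by simp
  then have si: "K * (K + 2 * e + 2) + 2 \<le> real s - real i" using K unfolding E_def by (subst (asm) mult_le_cancel_left_pos) auto
  have "(real (max s s') - real i - 1) / K - c \<le> K + 2 * e + 5 * c"
  proof -
    have "s \<le> n" "s' \<le> n" using s s' k by auto
    from planeD(3)[OF g y i(1) this i(3)] D1 show ?thesis by linarith
  qed
  moreover have "(real s - real i - 1) / K \<le> (real (max s s') - real i - 1) / K"
    using K by (intro divide_right_mono) auto
  ultimately have "(real s - real i - 1) / K \<le> K + 2 * e + 6 * c" by linarith
  then have "real s - real i - 1 \<le> (K + 2 * e + 6 * c) * K" using K by (simp add: divide_le_eq)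
  also have "\<dots> \<le> (K + 2 * e + 2) * K" by (rule mult_right_mono) (use K c in linarith)+
  also have "\<dots> = K * (K + 2 * e + 2)" by (rule mult.commute)
  finally show False using si by linarith
qed

end

section \<open>Comparison of parallel planes\<close>

context horo begin

lemma N_trans3: "x \<le> N p q \<Longrightarrow> x \<le> N q r \<Longrightarrow> x \<le> N r s \<Longrightarrow> x - 2 * c \<le> N p s"
  using N_trans[of x p q r] N_ultra[of p r s] c_nonneg by linarith

lemma N_trans5:
  assumes "x \<le> N p q" "x \<le> N q r" "x \<le> N r s" "x \<le> N s t" "x \<le> N t u"
  shows "x - 4 * c \<le> N p u"
  using N_trans3[OF assms(1-3)] N_trans[OF assms(4,5)] N_ultra[of p s u] c_nonneg by linarith

text \<open>The common point at time \<open>i\<close> lies below both ends on their lines, so the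
  ends are together from its height downwards.\<close>

lemma merge_low:
  assumes g: "plane K m n g" and y: "y \<in> words m n" "y' \<in> words m n"
    and up: "up e (g y) n" "up e (g y') n" and e: "0 \<le> e" and i: "i \<le> n" "take i y = take i y'"
  shows "h (g y i) - e - 4 * c \<le> N (g y n) (g y' n)"
proof -
  have d: "D (g y i) (g y' i) \<le> c" by (rule planeD(2)[OF g y i])
  have "h (g y i) - e - c - 2 * c \<le> N (g y n) (g y' n)"
  proof (rule N_trans3[of _ _ "g y i" "g y' i"])
    show "h (g y i) - e - c \<le> N (g y n) (g y i)"
      using upD(1)[OF up(1) i(1) order_refl] c_nonneg N_sym[of "g y i" "g y n"] by linarith
    show "h (g y i) - e - c \<le> N (g y i) (g y' i)" using N_ge_D[of "g y i" "g y' i"] d e by linarith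
    show "h (g y i) - e - c \<le> N (g y' i) (g y' n)"
      using upD(1)[OF up(2) i(1) order_refl] h_diff[of "g y i" "g y' i"] d by linarith
  qed
  then show ?thesis using c_nonneg by linarith
qed

text \<open>If \<open>N Q\<close> jumps by more than \<open>c\<close> between \<open>P\<close> and
  \<open>U\<close>, the ultrametric inequality leaves only \<open>N P U\<close> as a lower bound for
  \<open>N Q P\<close>. So \<open>P\<close> lies near the vertical line below
  \<open>Q\<close>.\<close>

lemma on_line:
  assumes "h P - e \<le> N P U" and "N Q P + d \<le> N Q U" "c < d"
  shows "h P \<le> N Q P + e + c"
  using N_ultra[of Q U P] N_sym[of U P] assms by linarith

lemma up_height:
  assumes q: "qline K P n" and up: "up e P n" and t: "t \<le> n"
  shows "h (P 0) + real t / K - 2 * e \<le> h (P t)"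
  using qlineD(1)[OF q, of 0 t] upD[OF up le0 t] t unfolding D_def by simp

text \<open>The climb above the branch point that \<open>collapse\<close> asks for: it takes at
  least \<open>K * (K + 2 * e + 2) + 2\<close> steps, after which two lines are more than
  \<open>K + 2 * e + 5 * c\<close> apart.\<close>

definition planeE :: "real \<Rightarrow> real \<Rightarrow> real" where "planeE K e = K * (K * (K + 2 * e + 2) + 2)"

lemma planeE_le:
  assumes "1 \<le> K" "0 \<le> e"
  shows "planeE K e \<le> 2 * K^2 * e + 5 * K^3" "1 \<le> planeE K e"
proof -
  have "K \<le> K^3" "K^2 \<le> K^3" using assms(1) power_increasing[of 1 3 K] power_increasing[of 2 3 K] by auto
  moreover have "planeE K e = K^3 + 2 * K^2 * e + 2 * K^2 + 2 * K"
    by (simp add: planeE_def power2_eq_square power3_eq_cube algebra_simps)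
  ultimately show "planeE K e \<le> 2 * K^2 * e + 5 * K^3" by linarith
  have "0 \<le> K * (K + 2 * e + 2)" using assms by (intro mult_nonneg_nonneg) auto
  then have "1 * 1 \<le> K * (K * (K + 2 * e + 2) + 2)" using assms by (intro mult_mono) auto
  then show "1 \<le> planeE K e" by (simp add: planeE_def)
qed

text \<open>Two planes that agree at the top: if most lines of \<open>g\<close> rise, then \<open>g0\<close> cannot start much higher than
  \<open>g\<close>. Apply coarse differentiation to the lines of \<open>g0\<close>; where such a line merges from above
  with its top end, an upward block that is too high would merge two lines whose digits already differ.\<close>

lemma parallel_plane_height:
  assumes K: "1 \<le> K" and c: "100 * K * c \<le> 1" and B: "3 \<le> B" and d1: "0 < \<delta>" "4 * K * \<delta> \<le> 1"
    and Bd: "200 * K^3 \<le> \<delta> * real B" and mu: "32 * K * \<mu> = \<delta>" and eps: "0 \<le> \<epsilon>" "16 * K^2 * \<epsilon> \<le> \<delta>"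
    and k0: "10 * K * (K + 1) * real B \<le> \<mu> * real k0" "k0 \<le> k"
    and n: "n = B ^ k" and m: "4 * (n + 1) < m"
    and g: "plane K m n g" and g0: "plane K m n g0"
    and top: "\<And>y. y \<in> words m n \<Longrightarrow> D (g y n) (g0 y n) \<le> c"
    and U: "U \<subseteq> words m n" "card (words m n) \<le> 2 * card U" and up: "\<And>y. y \<in> U \<Longrightarrow> up (\<epsilon> * real n) (g y) n"
    and y0: "y0 \<in> words m n"
  shows "h (g0 y0 0) \<le> h (g y0 0) + 6 * K^2 * \<delta> * real n"
proof -
  have finU: "finite U" using U(1) finite_words finite_subset by blast
  have mp: "0 < m" using m by simp
  have cU: "0 < card U" using U(2) zero_less_power[OF mp, of n] unfolding card_words by linarith
  have c1: "100 * c \<le> 1"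
  proof -
    have "100 * c * 1 \<le> 100 * c * K" using K c_nonneg by (intro mult_left_mono) auto
    then show ?thesis using c by (simp add: mult_ac)
  qed
  have mup: "0 < \<mu>" using mu d1 K by (simp add: zero_less_mult_iff flip: mu)
  have Bp: "0 < B" using B by simp
  obtain j where j: "j < k0" and jbad:
    "real (card {(y, l). y \<in> U \<and> l < B ^ (k - Suc j) \<and>
        \<not> (up (4 * K * real (B ^ j)) (\<lambda>t. g0 y (l * B ^ Suc j + t)) (B ^ Suc j) \<or>
           dn (4 * K * real (B ^ j)) (\<lambda>t. g0 y (l * B ^ Suc j + t)) (B ^ Suc j))})
     \<le> \<mu> * real (card U) * real (B ^ (k - Suc j))"
    using coarse_differentiation[OF K B mup k0 c finU, of g0] planeD(1)[OF g0] U(1) unfolding n by blast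
  define r where "r = B ^ j"
  define \<rho> where "\<rho> = B ^ Suc j"
  define nb where "nb = B ^ (k - Suc j)"
  have rho: "\<rho> = B * r" and nnb: "n = nb * \<rho>"
  proof -
    show "\<rho> = B * r" by (simp add: \<rho>_def r_def)
    have "k = (k - Suc j) + Suc j" using j k0 by auto
    then show "n = nb * \<rho>" unfolding n nb_def \<rho>_def by (metis power_add)
  qed
  have pos: "1 \<le> r" "1 \<le> nb" "1 \<le> \<rho>" using Bp by (auto simp: r_def nb_def \<rho>_def Suc_le_eq)
  have nb_le: "nb \<le> n" unfolding nnb using pos by simp
  define e1 where "e1 = 4 * K * real r"
  define e where "e = \<epsilon> * real n"
  \<comment> \<open>With \<open>X = K^3 * r\<close> one gets \<open>e1 \<le> 4 * X\<close> and
    \<open>w1 \<le> 13 * X\<close>, so a gain of \<open>d = 18 * X\<close> covers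
    \<open>e1 + w1\<close> and a few \<open>c\<close>.\<close>
  define d where "d = 18 * K^3 * real r"
  define w1 where "w1 = planeE K e1"
  define w0 where "w0 = planeE K e"
  define str where "str y l \<longleftrightarrow> up e1 (\<lambda>t. g0 y (l * \<rho> + t)) \<rho> \<or> dn e1 (\<lambda>t. g0 y (l * \<rho> + t)) \<rho>" for y l
  have jbad': "real (card {(y, l). y \<in> U \<and> l < nb \<and> \<not> str y l}) \<le> \<mu> * real (card U) * real nb"
    using jbad by (simp add: nb_def e1_def str_def r_def \<rho>_def)
  have K3: "K \<le> K^3" "K^2 \<le> K^3" "1 \<le> K^3" "1 \<le> K^2" "K \<le> K^2"
    using K power_increasing[of 1 3 K] power_increasing[of 2 3 K] power_increasing[of 1 2 K] by auto
  define X where "X = K^3 * real r"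
  have X1: "1 \<le> X" unfolding X_def using K K3 pos mult_mono[of 1 "K^3" 1 "real r"] by simp
  have KX: "K * real r \<le> X" unfolding X_def using K3 by (intro mult_right_mono) auto
  have K3X: "K^3 \<le> X" unfolding X_def using K K3 pos mult_left_mono[of 1 "real r" "K^3"] by simp
  have e1X: "e1 \<le> 4 * X" "0 \<le> e1" "4 \<le> e1"
  proof -
    have "1 * 1 \<le> K * real r" using K pos by (intro mult_mono) auto
    then show "e1 \<le> 4 * X" "0 \<le> e1" "4 \<le> e1" using KX by (auto simp: e1_def)
  qed
  have w1X: "w1 \<le> 13 * X" "1 \<le> w1"
  proof -
    have "2 * K^2 * e1 = 8 * X" by (simp add: e1_def X_def power2_eq_square power3_eq_cube)
    then show "w1 \<le> 13 * X" "1 \<le> w1" using planeE_le[OF K e1X(2)] K3X unfolding w1_def by linarith+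
  qed
  have dX: "d = 18 * X" by (simp add: d_def X_def)
  have e0: "0 \<le> e" using eps by (simp add: e_def)
  define \<eta> where "\<eta> = \<delta> * real n"
  have nbX: "200 * (real nb * X) \<le> \<eta>"
  proof -
    have "200 * K^3 * (real nb * real r) \<le> \<delta> * real B * (real nb * real r)" using Bd by (intro mult_right_mono) auto
    then show ?thesis by (simp add: X_def \<eta>_def nnb rho mult_ac)
  qed
  have X_eta: "200 * X \<le> \<eta>"
  proof -
    have "1 * X \<le> real nb * X" using pos X1 by (intro mult_right_mono) auto
    then show ?thesis using nbX by linarith
  qed
  have eK: "16 * (K^2 * e) \<le> \<eta>"
    using mult_right_mono[OF eps(2), of "real n"] by (simp add: e_def \<eta>_def mult_ac)
  have eta: "16 * e \<le> \<eta>"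
  proof -
    have "1 * e \<le> K^2 * e" using K3 e0 by (intro mult_right_mono) auto
    then show ?thesis using eK by linarith
  qed
  have w0e: "w0 \<le> \<eta> / 8 + 5 * X" "1 \<le> w0"
    using planeE_le[OF K e0] eK K3X unfolding w0_def by linarith+
  have eta1: "200 \<le> \<eta>" using X_eta X1 by linarith
  have "1 \<le> n" using pos nnb by simp
  have upg: "up e (g y) n" if "y \<in> U" for y using up[OF that] by (simp add: e_def)
  have W: "y \<in> words m n" if "y \<in> U" for y using U(1) that by blast
  have blk: "l * \<rho> + \<rho> \<le> n" "l * \<rho> < n" if "l < nb" for l
  proof -
    have "Suc l * \<rho> \<le> nb * \<rho>" using that by (intro mult_le_mono1) auto
    then show "l * \<rho> + \<rho> \<le> n" "l * \<rho> < n" using pos that by (auto simp: nnb)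
  qed
  \<comment> \<open>\<open>F y l\<close> is the height below which the point at time
    \<open>l * \<rho>\<close> and the top end of \<open>g0 y\<close> are together. Three kinds of
    lines are discarded: in \<open>U1\<close> too many blocks are not straight; in \<open>Ea\<close>
    the start already agrees with the top end up to a height far above the start of
    \<open>g\<close>; in \<open>El l\<close> a block gains along the line of the top end while
    \<open>g\<close> is far above \<open>g0\<close>.\<close>
  define F where "F y l = N (g0 y n) (g0 y (l * \<rho>))" for y l
  define U1 where "U1 = {y \<in> U. 2 * \<mu> * real nb < real (card {l. l < nb \<and> \<not> str y l})}"
  define Ea where "Ea = {y \<in> U. h (g y 0) + w0 + 10 * c < F y 0}"
  define El where "El l = {y \<in> U. up e1 (\<lambda>t. g0 y (l * \<rho> + t)) \<rho> \<and> F y l + d \<le> F y (Suc l) \<and>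
      h (g0 y (l * \<rho>)) + w1 + e + 7 * c \<le> h (g y (l * \<rho>))}" for l
  have U1: "2 * card U1 \<le> card U"
  proof -
    have "{(y, l). y \<in> U \<and> l < nb \<and> \<not> str y l} = (SIGMA y:U. {l. l < nb \<and> \<not> str y l})" by auto
    then have "(\<Sum>y\<in>U. real (card {l. l < nb \<and> \<not> str y l})) \<le> \<mu> * real (card U) * real nb"
      using jbad' finU by (simp add: card_SigmaI)
    moreover have "real (card U1) * (2 * \<mu> * real nb) \<le> (\<Sum>y\<in>U1. real (card {l. l < nb \<and> \<not> str y l}))"
      by (intro sum_bounded_below) (auto simp: U1_def)
    moreover have "(\<Sum>y\<in>U1. real (card {l. l < nb \<and> \<not> str y l})) \<le> (\<Sum>y\<in>U. real (card {l. l < nb \<and> \<not> str y l}))"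
      using finU by (intro sum_mono2) (auto simp: U1_def)
    ultimately have "(2 * real (card U1)) * (\<mu> * real nb) \<le> real (card U) * (\<mu> * real nb)" by (simp add: mult_ac)
    then have "2 * real (card U1) \<le> real (card U)"
      by (rule mult_right_le_imp_le) (use mup pos in simp)
    then show ?thesis by linarith
  qed
  have Ea: "card Ea * m \<le> m ^ n"
  proof (rule card_branch[of _ _ _ 0])
    show "Ea \<subseteq> words m n" using U by (auto simp: Ea_def)
    show "0 < n" using \<open>1 \<le> n\<close> by simp
    fix y y' assume y: "y \<in> Ea" "y' \<in> Ea"
    then have yU: "y \<in> U" "y' \<in> U" and F: "h (g y 0) + w0 + 10 * c < F y 0" "h (g y' 0) + w0 + 10 * c < F y' 0"
      by (auto simp: Ea_def)
    show "y ! 0 = y' ! 0"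
    proof (rule ccontr)
      assume ne: "y ! 0 \<noteq> y' ! 0"
      \<comment> \<open>The starts of \<open>g0\<close> are close, and each is together with its own
        end up to a height far above the start of \<open>g\<close>. Hence the ends, which are common
        to both planes, merge there, although the rising lines of \<open>g\<close> part at time
        0.\<close>
      have dg: "D (g y 0) (g y' 0) \<le> c" by (rule planeD(2)[OF g W[OF yU(1)] W[OF yU(2)]]) auto
      have dg0: "D (g0 y 0) (g0 y' 0) \<le> c" by (rule planeD(2)[OF g0 W[OF yU(1)] W[OF yU(2)]]) auto
      define x where "x = h (g y 0) + w0 + 8 * c"
      have F': "x + c \<le> F y 0" "x + c \<le> F y' 0" using F h_diff[of "g y 0" "g y' 0"] dg c_nonneg unfolding x_def by linarith+
      have "x - 4 * c \<le> N (g y n) (g y' n)"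
      proof (rule N_trans5)
        show "x \<le> N (g y n) (g0 y n)"
          using N_ge_D'[of "g0 y n" "g y n"] top[OF W[OF yU(1)]] F'(1) N_le[of "g0 y n" "g0 y 0"] by (simp add: F_def)
        show "x \<le> N (g0 y n) (g0 y 0)" using F' c_nonneg by (simp add: F_def)
        show "x \<le> N (g0 y 0) (g0 y' 0)"
          using N_ge_D[of "g0 y 0" "g0 y' 0"] dg0 F'(1) N_le'[of "g0 y n" "g0 y 0"] by (simp add: F_def)
        show "x \<le> N (g0 y' 0) (g0 y' n)" using F' c_nonneg N_sym[of "g0 y' 0"] by (simp add: F_def)
        show "x \<le> N (g0 y' n) (g y' n)"
          using N_ge_D[of "g0 y' n" "g y' n"] D_sym[of "g y' n" "g0 y' n"] top[OF W[OF yU(2)]] F'(2) N_le[of "g0 y' n" "g0 y' 0"]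
          by (simp add: F_def)
      qed
      then have n0: "h (g y 0) + w0 \<le> N (g y n) (g y' n)" using c_nonneg by (simp add: x_def)
      show False
      proof (rule collapse[OF g W[OF yU(1)] W[OF yU(2)] K c1 e0 _ _ ne, of n])
        show "h (g y 0) + K * (K * (K + 2 * e + 2) + 2) \<le> h (g y 0) + w0" by (simp add: w0_def planeE_def)
        show "h (g y 0) + w0 \<le> N (g y n) (g y (0 + n))" using n0 N_le[of "g y n" "g y' n"] by (simp add: N_self)
        show "h (g y 0) + w0 \<le> N (g y' n) (g y' (0 + n))" using n0 N_le'[of "g y n" "g y' n"] by (simp add: N_self)
      qed (use n0 upg yU \<open>1 \<le> n\<close> in auto)
    qed
  qed
  have El: "card (El l) * m \<le> m ^ n" if l: "l < nb" for l
  proof (rule card_branch[of _ _ _ "l * \<rho>"])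
    show "El l \<subseteq> words m n" using U by (auto simp: El_def)
    show "l * \<rho> < n" using blk[OF l] by simp
    fix y y' assume y: "y \<in> El l" "y' \<in> El l" and tk: "take (l * \<rho>) y = take (l * \<rho>) y'"
    then have yU: "y \<in> U" "y' \<in> U" by (auto simp: El_def)
    show "y ! (l * \<rho>) = y' ! (l * \<rho>)"
    proof (rule ccontr)
      assume ne: "y ! (l * \<rho>) \<noteq> y' ! (l * \<rho>)"
      have cd: "c < d" using X1 c1 dX by linarith
      have ol: "h (g0 z (l * \<rho>)) + (w1 + c) \<le> F z (Suc l)" if "z \<in> El l" for z
      proof -
        have u: "up e1 (\<lambda>t. g0 z (l * \<rho> + t)) \<rho>" and F: "F z l + d \<le> F z (Suc l)" using that by (auto simp: El_def)
        have "h (g0 z (l * \<rho>)) \<le> F z l + e1 + c"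
          unfolding F_def
          by (rule on_line[of _ _ "g0 z (Suc l * \<rho>)" _ d])
            (use upD(1)[OF u le0 order_refl] F cd in \<open>auto simp: F_def add.commute\<close>)
        then show ?thesis using F e1X w1X c1 dX X1 by linarith
      qed
      have dg0: "D (g0 y (l * \<rho>)) (g0 y' (l * \<rho>)) \<le> c"
        by (rule planeD(2)[OF g0 W[OF yU(1)] W[OF yU(2)] less_imp_le[OF blk(2)[OF l]] tk])
      define v where "v = h (g0 y (l * \<rho>)) + w1"
      \<comment> \<open>Now the planes change roles: the lines of \<open>g\<close> agree up to time
        \<open>l * \<rho>\<close>, so the common ends merge at the height of \<open>g\<close>, which
        is far above the point where the lines of \<open>g0\<close> part.\<close>
      have deep: "v + e + 7 * c \<le> h (g y (l * \<rho>))" using y(1) by (simp add: El_def v_def)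
      have ml: "h (g y (l * \<rho>)) - e - 4 * c \<le> N (g y n) (g y' n)"
        by (rule merge_low[OF g W[OF yU(1)] W[OF yU(2)] upg[OF yU(1)] upg[OF yU(2)] e0 less_imp_le[OF blk(2)[OF l]] tk])
      have "v + 2 * c - 2 * c \<le> N (g0 y n) (g0 y' n)"
      proof (rule N_trans3)
        show "v + 2 * c \<le> N (g0 y n) (g y n)"
          using N_ge_D'[of "g y n" "g0 y n"] D_sym[of "g y n"] top[OF W[OF yU(1)]] deep ml N_le[of "g y n" "g y' n"] by simp
        show "v + 2 * c \<le> N (g y n) (g y' n)" using deep ml c_nonneg by linarith
        show "v + 2 * c \<le> N (g y' n) (g0 y' n)"
          using N_ge_D[of "g y' n" "g0 y' n"] top[OF W[OF yU(2)]] deep ml N_le'[of "g y n" "g y' n"] by simp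
      qed
      then have n0: "v \<le> N (g0 y n) (g0 y' n)" by simp
      show False
      proof (rule collapse[OF g0 W[OF yU(1)] W[OF yU(2)] K c1 e1X(2) blk(2)[OF l] tk ne blk(1)[OF l]])
        show "up e1 (\<lambda>t. g0 y (l * \<rho> + t)) \<rho>" "up e1 (\<lambda>t. g0 y' (l * \<rho> + t)) \<rho>" using y by (auto simp: El_def)
        show "h (g0 y (l * \<rho>)) + K * (K * (K + 2 * e1 + 2) + 2) \<le> v" by (simp add: v_def w1_def planeE_def)
        show "v \<le> N (g0 y n) (g0 y (l * \<rho> + \<rho>))" using ol[OF y(1)] c_nonneg by (simp add: v_def F_def add.commute)
        show "v \<le> N (g0 y' n) (g0 y' (l * \<rho> + \<rho>))"
          using ol[OF y(2)] h_diff[of "g0 y (l * \<rho>)" "g0 y' (l * \<rho>)"] dg0 by (simp add: v_def F_def add.commute)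
      qed (rule n0)
    qed
  qed
  \<comment> \<open>\<open>U1\<close> takes at most half of \<open>U\<close>, and each of the other
    \<open>nb + 1\<close> sets has density at most \<open>1 / m\<close> among all words;
    \<open>4 * (n + 1) < m\<close> leaves a line over.\<close>
  have "\<exists>y. y \<in> U \<and> y \<notin> U1 \<and> y \<notin> Ea \<and> (\<forall>l<nb. y \<notin> El l)"
  proof (rule ccontr)
    assume "\<not> ?thesis"
    then have "U \<subseteq> (U1 \<union> Ea) \<union> (\<Union>l<nb. El l)" by blast
    moreover have fin: "finite U1" "finite Ea" "finite (El l)" for l using finU by (auto simp: U1_def Ea_def El_def)
    ultimately have "card U \<le> card ((U1 \<union> Ea) \<union> (\<Union>l<nb. El l))" by (intro card_mono) auto
    also have "\<dots> \<le> card (U1 \<union> Ea) + card (\<Union>l<nb. El l)" by (rule card_Un_le)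
    also have "\<dots> \<le> (card U1 + card Ea) + (\<Sum>l<nb. card (El l))"
      by (intro add_mono card_Un_le card_UN_le) auto
    finally have "card U \<le> 2 * card Ea + 2 * (\<Sum>l<nb. card (El l))" using U1 by linarith
    then have "card U * m \<le> (2 * card Ea + 2 * (\<Sum>l<nb. card (El l))) * m" by (rule mult_le_mono1)
    also have "\<dots> = 2 * (card Ea * m) + 2 * (\<Sum>l<nb. card (El l) * m)" by (simp add: algebra_simps sum_distrib_left)
    also have "\<dots> \<le> 2 * m ^ n + 2 * (\<Sum>l<nb. m ^ n)"
      using Ea El by (intro add_mono mult_le_mono2 sum_mono) auto
    also have "\<dots> = 2 * (nb + 1) * m ^ n" by simp
    also have "\<dots> \<le> 2 * (nb + 1) * (2 * card U)" using U(2) by (intro mult_le_mono2) (simp add: card_words)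
    finally have "card U * m \<le> card U * (4 * (nb + 1))" by (simp add: algebra_simps)
    then have "m \<le> 4 * (nb + 1)" using cU by simp
    moreover have "4 * (nb + 1) \<le> 4 * (n + 1)" using nb_le by simp
    ultimately have "m < m" using m by (meson le_less_trans less_le_trans)
    then show False by simp
  qed
  then obtain y where y: "y \<in> U" "y \<notin> U1" "y \<notin> Ea" "\<And>l. l < nb \<Longrightarrow> y \<notin> El l" by blast
  define L where "L = h (g y 0)"
  have F0: "F y 0 \<le> L + w0 + 10 * c" using y by (auto simp: Ea_def L_def)
  have ns: "real (card {l. l < nb \<and> \<not> str y l}) \<le> 2 * \<mu> * real nb" using y by (auto simp: U1_def)
  have hg: "L + real t / K - 2 * e \<le> h (g y t)" if "t \<le> n" for t
    using up_height[OF planeD(1)[OF g W[OF y(1)]] upg[OF y(1)] that] by (simp add: L_def)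
  have "4 * \<eta> \<le> real n / K"
  proof -
    have "4 * K * \<delta> * real n \<le> 1 * real n" using d1 by (intro mult_right_mono) auto
    then show ?thesis using K by (simp add: \<eta>_def field_simps)
  qed
  then have Fnb: "L + \<eta> < F y nb"
    using hg[of n] top[OF W[OF y(1)]] h_diff[of "g y n" "g0 y n"] eta eta1 c1 by (simp add: F_def nnb[symmetric] N_self)
  \<comment> \<open>Before \<open>F\<close> first exceeds \<open>L + \<eta>\<close> it must gain
    most of \<open>\<eta>\<close>. Descending blocks gain at most \<open>e1 + c\<close>, the blocks
    that are not straight gain at most \<open>\<eta> / 8\<close> in total, and gains of at most
    \<open>d\<close> add up to no more than \<open>18 * nb * X\<close>. So some rising block gains
    at least \<open>d\<close>, and by \<open>on_line\<close> it lies on the line of the top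
    end.\<close>
  define J where "J = (LEAST l. L + \<eta> < F y l)"
  have J: "L + \<eta> < F y J" "J \<le> nb" and Jmin: "l < J \<Longrightarrow> F y l \<le> L + \<eta>" for l
    using LeastI[of "\<lambda>l. L + \<eta> < F y l", OF Fnb] Least_le[of "\<lambda>l. L + \<eta> < F y l", OF Fnb]
      not_less_Least[of l "\<lambda>l. L + \<eta> < F y l"] by (auto simp: J_def)
  have "\<exists>l<J. up e1 (\<lambda>t. g0 y (l * \<rho> + t)) \<rho> \<and> F y l + d \<le> F y (Suc l)"
  proof (rule ccontr)
    assume no: "\<not> ?thesis"
    have step: "F y (Suc l) - F y l \<le> (if str y l then d else 2 * K * real \<rho>)" if l: "l < J" for l
    proof -
      have lnb: "l < nb" using l J by simp
      let ?P = "g0 y (l * \<rho>)" let ?U = "g0 y (Suc l * \<rho>)"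
      have ult: "F y l \<ge> F y (Suc l) - c \<or> F y l \<ge> N ?P ?U - c"
        using N_ultra[of "g0 y n" ?U ?P] N_sym[of ?P ?U] unfolding F_def by linarith
      have FU: "F y (Suc l) \<le> h ?U" unfolding F_def by (rule N_le')
      show ?thesis
      proof (cases "str y l")
        case True
        show ?thesis
        proof (cases "up e1 (\<lambda>t. g0 y (l * \<rho> + t)) \<rho>")
          case True then show ?thesis using no l \<open>str y l\<close> by auto
        next
          case False
          then have "dn e1 (\<lambda>t. g0 y (l * \<rho> + t)) \<rho>" using True by (simp add: str_def)
          then have "h (g0 y (l * \<rho> + \<rho>)) - e1 \<le> N (g0 y (l * \<rho> + 0)) (g0 y (l * \<rho> + \<rho>))" unfolding dn_def by blast
          then have "h ?U - e1 \<le> N ?P ?U" by (simp add: add.commute)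
          then have "F y (Suc l) - F y l \<le> e1 + c" using ult FU e1X by linarith
          then show ?thesis using True dX e1X c1 X1 by simp
        qed
      next
        case False
        have "D ?P ?U \<le> K * \<bar>real (l * \<rho>) - real (Suc l * \<rho>)\<bar>"
          using blk[OF lnb] by (intro qlineD(2)[OF planeD(1)[OF g0 W[OF y(1)]]]) auto
        also have "\<bar>real (l * \<rho>) - real (Suc l * \<rho>)\<bar> = real \<rho>" by (simp add: algebra_simps)
        finally have "D ?P ?U \<le> K * real \<rho>" .
        moreover have "1 * 1 \<le> K * real \<rho>" using K pos by (intro mult_mono) auto
        ultimately have "F y (Suc l) - F y l \<le> 2 * (K * real \<rho>)" using ult FU N_ge_D'[of ?U ?P] c1 by linarith
        then show ?thesis using False by simp
      qed
    qed
    have d0: "0 \<le> d" "0 \<le> 2 * K * real \<rho>" using dX X1 K by auto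
    have "F y J - F y 0 = (\<Sum>l<J. F y (Suc l) - F y l)" by (simp add: sum_lessThan_telescope)
    also have "\<dots> \<le> (\<Sum>l<J. if str y l then d else 2 * K * real \<rho>)" by (intro sum_mono step) simp
    also have "\<dots> \<le> (\<Sum>l<nb. if str y l then d else 2 * K * real \<rho>)" using J d0 by (intro sum_mono2) auto
    also have "\<dots> \<le> (\<Sum>l<nb. d + (if str y l then 0 else 2 * K * real \<rho>))" using d0 by (intro sum_mono) auto
    also have "\<dots> = real nb * d + (\<Sum>l\<in>{l. l < nb \<and> \<not> str y l}. 2 * K * real \<rho>)"
    proof -
      have "(\<Sum>l<nb. (if str y l then 0 else 2 * K * real \<rho>)) = (\<Sum>l\<in>{l\<in>{..<nb}. \<not> str y l}. 2 * K * real \<rho>)"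
        by (subst sum.inter_filter) (auto intro!: sum.cong)
      then show ?thesis by (simp add: sum.distrib)
    qed
    also have "\<dots> = real nb * d + real (card {l. l < nb \<and> \<not> str y l}) * (2 * K * real \<rho>)" by simp
    also have "\<dots> \<le> real nb * d + 2 * \<mu> * real nb * (2 * K * real \<rho>)"
      using ns d0 by (intro add_left_mono mult_right_mono) auto
    also have "2 * \<mu> * real nb * (2 * K * real \<rho>) = \<eta> / 8"
      unfolding \<eta>_def mu[symmetric] nnb by simp
    also have "real nb * d = 18 * (real nb * X)" by (simp add: dX)
    finally show False using J(1) F0 w0e nbX X_eta c1 eta1 by linarith
  qed
  then obtain l where l: "l < J" "up e1 (\<lambda>t. g0 y (l * \<rho> + t)) \<rho>" "F y l + d \<le> F y (Suc l)" by blast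
  define \<tau> where "\<tau> = l * \<rho>"
  have lnb: "l < nb" using l J by simp
  have taun: "\<tau> \<le> n" using blk[OF lnb] by (simp add: \<tau>_def)
  have hP: "h (g0 y \<tau>) \<le> F y l + e1 + c"
    unfolding F_def \<tau>_def
    by (rule on_line[of _ _ "g0 y (Suc l * \<rho>)" _ d])
      (use upD(1)[OF l(2) le0 order_refl] l(3) dX X1 c1 in \<open>auto simp: F_def add.commute\<close>)
  \<comment> \<open>As \<open>y\<close> is not in \<open>El l\<close>, at time \<open>\<tau>\<close>
    the line of \<open>g\<close> is not far above that of \<open>g0\<close>, which is at most
    \<open>L + \<eta>\<close> up to small errors. Since \<open>g\<close> rises at speed at least
    \<open>1 / K\<close>, little time has passed, and \<open>g0\<close> cannot have started much
    higher.\<close>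
  have "\<not> (h (g0 y \<tau>) + w1 + e + 7 * c \<le> h (g y \<tau>))" using y(4)[OF lnb] y(1) l by (simp add: El_def \<tau>_def)
  then have "real \<tau> / K \<le> 2 * \<eta>" using hg[OF taun] hP Jmin[OF l(1)] e1X w1X X_eta eta c1 eta1 by linarith
  then have tau: "K * real \<tau> \<le> 2 * (K^2 * \<eta>)"
  proof -
    assume "real \<tau> / K \<le> 2 * \<eta>"
    then have "K^2 * (real \<tau> / K) \<le> K^2 * (2 * \<eta>)" by (intro mult_left_mono) auto
    then show ?thesis using K by (simp add: power2_eq_square)
  qed
  have "D (g0 y 0) (g0 y \<tau>) \<le> K * real \<tau>"
    using qlineD(2)[OF planeD(1)[OF g0 W[OF y(1)]] le0 taun] by simp
  then have "h (g0 y 0) \<le> L + 2 * \<eta> + 2 * (K^2 * \<eta>)"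
    using h_diff[of "g0 y 0" "g0 y \<tau>"] hP Jmin[OF l(1)] tau e1X X_eta c1 eta1 by linarith
  moreover have "D (g0 y 0) (g0 y0 0) \<le> c" "D (g y 0) (g y0 0) \<le> c"
    using planeD(2)[OF g0 W[OF y(1)] y0 le0] planeD(2)[OF g W[OF y(1)] y0 le0] by auto
  moreover have "1 * \<eta> \<le> K^2 * \<eta>" using K3 eta1 by (intro mult_right_mono) auto
  ultimately have "h (g0 y0 0) \<le> h (g y0 0) + 6 * (K^2 * \<eta>)"
    using h_diff[of "g0 y 0" "g0 y0 0"] h_diff[of "g y 0" "g y0 0"] c1 eta1 unfolding L_def by linarith
  then show ?thesis by (simp add: \<eta>_def mult_ac)
qed

end

subsection \<open>The coarse metric of the solvable group\<close>

type_synonym pt = "real \<times> real \<times> real"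

text \<open>Carries the coarse metric with exponents \<open>a, b\<close> to the one with
  \<open>b, a\<close>; facts on \<open>Nr\<close> are mirror images of facts on
  \<open>Mr\<close>.\<close>

definition flip :: "pt \<Rightarrow> pt" where "flip p = (- fst p, snd (snd p), fst (snd p))"

text \<open>The solved form of the least \<open>m\<close> above both heights at which the
  \<open>x\<close>-difference is at most \<open>exp (a * m)\<close>; \<open>Mr_le_iff\<close> is the
  form in which it is used.\<close>

definition Mr :: "real \<Rightarrow> pt \<Rightarrow> pt \<Rightarrow> real" where
  "Mr a p q = ln (max \<bar>fst (snd p) - fst (snd q)\<bar> (exp (a * max (fst p) (fst q)))) / a"

definition Nr :: "real \<Rightarrow> pt \<Rightarrow> pt \<Rightarrow> real" where
  "Nr b p q = - Mr b (flip p) (flip q)"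

text \<open>It vanishes between points of equal height whose differences have length at most one
  there. Such pairs serve as coinciding points: an embedding moves them at most its additive
  constant apart.\<close>

definition sol_dist :: "real \<Rightarrow> real \<Rightarrow> pt \<Rightarrow> pt \<Rightarrow> real" where
  "sol_dist a b p q = Mr a p q - Nr b p q"

lemma flip_flip [simp]: "flip (flip p) = p" by (simp add: flip_def)

lemma Mr_le_iff:
  assumes "0 < a"
  shows "Mr a p q \<le> m \<longleftrightarrow> fst p \<le> m \<and> fst q \<le> m \<and> \<bar>fst (snd p) - fst (snd q)\<bar> \<le> exp (a * m)"
proof -
  have "Mr a p q \<le> m \<longleftrightarrow> ln (max \<bar>fst (snd p) - fst (snd q)\<bar> (exp (a * max (fst p) (fst q)))) \<le> a * m"
    using assms by (simp add: Mr_def divide_le_eq mult.commute)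
  also have "\<dots> \<longleftrightarrow> max \<bar>fst (snd p) - fst (snd q)\<bar> (exp (a * max (fst p) (fst q))) \<le> exp (a * m)"
    using ln_le_cancel_iff[of "max \<bar>fst (snd p) - fst (snd q)\<bar> (exp (a * max (fst p) (fst q)))" "exp (a * m)"]
    by (simp add: less_max_iff_disj)
  also have "\<dots> \<longleftrightarrow> fst p \<le> m \<and> fst q \<le> m \<and> \<bar>fst (snd p) - fst (snd q)\<bar> \<le> exp (a * m)"
    using assms by auto
  finally show ?thesis .
qed

lemma Nr_ge_iff:
  assumes "0 < b"
  shows "n \<le> Nr b p q \<longleftrightarrow> n \<le> fst p \<and> n \<le> fst q \<and> \<bar>snd (snd p) - snd (snd q)\<bar> \<le> exp (- b * n)"
proof -
  have "n \<le> Nr b p q \<longleftrightarrow> Mr b (flip p) (flip q) \<le> - n" by (auto simp: Nr_def)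
  then show ?thesis unfolding Mr_le_iff[OF assms] by (auto simp: flip_def)
qed

lemma Mr_sym: "Mr a p q = Mr a q p" by (simp add: Mr_def abs_minus_commute max.commute)

lemma Mr_ge: "0 < a \<Longrightarrow> fst p \<le> Mr a p q" using Mr_le_iff[of a p q "Mr a p q"] by simp
lemma Mr_ge': "0 < a \<Longrightarrow> fst q \<le> Mr a p q" using Mr_le_iff[of a p q "Mr a p q"] by simp
lemma Mr_self: "0 < a \<Longrightarrow> Mr a p p = fst p"
  using Mr_le_iff[of a p p "fst p"] Mr_ge[of a p p] by simp

text \<open>The sum of two differences is at most twice the larger, and a factor 2 costs
  \<open>ln 2 / a\<close> in height.\<close>

lemma Mr_ultra:
  assumes a: "0 < a"
  shows "Mr a p r \<le> max (Mr a p q) (Mr a q r) + ln 2 / a"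
  unfolding Mr_le_iff[OF a]
proof (intro conjI)
  define m where "m = max (Mr a p q) (Mr a q r)"
  have l: "0 \<le> ln 2 / a" using a by simp
  have mm: "Mr a p q \<le> m" "Mr a q r \<le> m" by (auto simp: m_def)
  then have m: "fst p \<le> m" "fst r \<le> m" "\<bar>fst (snd p) - fst (snd q)\<bar> \<le> exp (a * m)" "\<bar>fst (snd q) - fst (snd r)\<bar> \<le> exp (a * m)"
    unfolding Mr_le_iff[OF a] by auto
  show "fst p \<le> m + ln 2 / a" "fst r \<le> m + ln 2 / a" using m l by auto
  have "exp (a * (m + ln 2 / a)) = 2 * exp (a * m)" using a by (simp add: distrib_left exp_add)
  then show "\<bar>fst (snd p) - fst (snd r)\<bar> \<le> exp (a * (m + ln 2 / a))" using m by linarith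
qed

lemma Nr_self: "0 < b \<Longrightarrow> Nr b p p = fst p" by (simp add: Nr_def Mr_self) (simp add: flip_def)
lemma Nr_sym: "Nr b p q = Nr b q p" by (simp add: Nr_def Mr_sym)
lemma Nr_le: "0 < b \<Longrightarrow> Nr b p q \<le> fst p" using Mr_ge[of b "flip p" "flip q"] by (simp add: Nr_def flip_def)

lemma Nr_ultra: "0 < b \<Longrightarrow> min (Nr b p q) (Nr b q r) - ln 2 / b \<le> Nr b p r"
  using Mr_ultra[of b "flip p" "flip r" "flip q"] unfolding Nr_def by linarith

lemma sol_dist_flip: "sol_dist b a (flip p) (flip q) = sol_dist a b p q" by (simp add: sol_dist_def Nr_def)

lemma sol_dist_nonneg: "0 < a \<Longrightarrow> 0 < b \<Longrightarrow> 0 \<le> sol_dist a b p q" using Mr_ge[of a p q] Nr_le[of b p q] by (simp add: sol_dist_def)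

text \<open>Left translation by \<open>(z, x, y)\<close> in G.\<close>

definition shift :: "real \<Rightarrow> real \<Rightarrow> real \<Rightarrow> real \<Rightarrow> real \<Rightarrow> pt \<Rightarrow> pt" where
  "shift a b z x y p = (fst p + z, exp (a * z) * fst (snd p) + x, exp (- b * z) * snd (snd p) + y)"

lemma Mr_shift:
  assumes a: "0 < a"
  shows "Mr a (shift a b z x y p) (shift a b z x y q) = Mr a p q + z"
proof -
  have "Mr a (shift a b z x y p) (shift a b z x y q) \<le> m \<longleftrightarrow> Mr a p q + z \<le> m" for m
  proof -
    have "\<bar>exp (a * z) * fst (snd p) - exp (a * z) * fst (snd q)\<bar> = exp (a * z) * \<bar>fst (snd p) - fst (snd q)\<bar>"
      by (simp add: abs_mult flip: right_diff_distrib)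
    moreover have "exp (a * m) = exp (a * z) * exp (a * (m - z))" by (simp add: algebra_simps flip: exp_add)
    moreover have "Mr a p q + z \<le> m \<longleftrightarrow> Mr a p q \<le> m - z" by auto
    ultimately show ?thesis unfolding Mr_le_iff[OF a] by (auto simp: Mr_le_iff[OF a] shift_def)
  qed
  then show ?thesis by (meson order_antisym order_refl)
qed

lemma flip_shift: "flip (shift a b z x y p) = shift b a (- z) y x (flip p)"
  by (simp add: flip_def shift_def)

lemma sol_dist_shift: "0 < a \<Longrightarrow> 0 < b \<Longrightarrow> sol_dist a b (shift a b z x y p) (shift a b z x y q) = sol_dist a b p q"
  by (simp add: sol_dist_def Nr_def Mr_shift flip_shift)

text \<open>Source and target have their own exponents because precomposition with
  \<open>flip\<close> exchanges only those of the source. Coarse surjectivity is not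
  demanded.\<close>

definition coarse_embedding :: "real \<Rightarrow> real \<Rightarrow> real \<Rightarrow> real \<Rightarrow> real \<Rightarrow> real \<Rightarrow> (pt \<Rightarrow> pt) \<Rightarrow> bool" where
  "coarse_embedding a b a' b' K C \<phi> \<longleftrightarrow> (\<forall>p q. sol_dist a b p q / K - C \<le> sol_dist a' b' (\<phi> p) (\<phi> q) \<and> sol_dist a' b' (\<phi> p) (\<phi> q) \<le> K * sol_dist a b p q + C)"

lemma coarse_embeddingD:
  assumes "coarse_embedding a b a' b' K C \<phi>"
  shows "sol_dist a b p q / K - C \<le> sol_dist a' b' (\<phi> p) (\<phi> q)" "sol_dist a' b' (\<phi> p) (\<phi> q) \<le> K * sol_dist a b p q + C"
  using assms unfolding coarse_embedding_def by blast+

lemma coarse_embedding_shift: "coarse_embedding a b a' b' K C \<phi> \<Longrightarrow> 0 < a \<Longrightarrow> 0 < b \<Longrightarrow> coarse_embedding a b a' b' K C (\<lambda>p. \<phi> (shift a b z x y p))"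
  unfolding coarse_embedding_def by (metis sol_dist_shift)

lemma coarse_embedding_flip: "coarse_embedding a b a' b' K C \<phi> \<Longrightarrow> coarse_embedding b a a' b' K C (\<lambda>p. \<phi> (flip p))"
  unfolding coarse_embedding_def by (metis sol_dist_flip)

text \<open>Base \<open>A\<close> expansion with even digits; for \<open>2 * m \<le> A + 1\<close>, words over \<open>m\<close> digits that differ at
  some place stay apart by the corresponding power of \<open>A\<close>.\<close>

primrec enc :: "real \<Rightarrow> nat list \<Rightarrow> real" where
  "enc A [] = 0"
| "enc A (d # w) = 2 * real d * A ^ length w + enc A w"

lemma enc_append: "enc A (u @ v) = enc A u * A ^ length v + enc A v"
  by (induction u) (auto simp: algebra_simps power_add)

lemma words_Cons: "d # w \<in> words m (Suc n) \<longleftrightarrow> d < m \<and> w \<in> words m n" by (auto simp: words_def)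

lemma enc_bounds:
  assumes "2 * real m \<le> A + 1" "1 \<le> A" "w \<in> words m n"
  shows "0 \<le> enc A w" "enc A w \<le> A ^ n - 1"
proof -
  have "0 \<le> enc A w \<and> enc A w \<le> A ^ n - 1"
    using assms(3)
  proof (induction w arbitrary: n)
    case Nil then show ?case by (auto simp: words_def)
  next
    case (Cons d w)
    then obtain k where k: "n = Suc k" by (auto simp: words_def)
    then have d: "d < m" "w \<in> words m k" using Cons by (auto simp: words_Cons)
    then have len: "length w = k" by (auto simp: words_def)
    have "2 * real d \<le> A - 1" using d assms(1) by linarith
    then have "2 * real d * A ^ k \<le> (A - 1) * A ^ k" using assms(2) by (intro mult_right_mono) auto
    then show ?case using Cons.IH[OF d(2)] assms(2) by (auto simp: len k algebra_simps)
  qed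
  then show "0 \<le> enc A w" "enc A w \<le> A ^ n - 1" by auto
qed

lemma enc_agree:
  assumes A: "2 * real m \<le> A + 1" "1 \<le> A" and w: "w \<in> words m n" "w' \<in> words m n" and k: "k \<le> n" "take k w = take k w'"
  shows "\<bar>enc A w - enc A w'\<bar> \<le> A ^ (n - k)"
proof -
  have d: "drop k w \<in> words m (n - k)" "drop k w' \<in> words m (n - k)"
    using w by (auto simp: words_def dest: in_set_dropD)
  then have l: "length (drop k w) = n - k" "length (drop k w') = n - k" by (auto simp: words_def)
  have "enc A w = enc A (take k w) * A ^ (n - k) + enc A (drop k w)"
    using enc_append[of A "take k w" "drop k w", unfolded l] by simp
  moreover have "enc A w' = enc A (take k w') * A ^ (n - k) + enc A (drop k w')"
    using enc_append[of A "take k w'" "drop k w'", unfolded l] by simp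
  ultimately have "enc A w - enc A w' = enc A (drop k w) - enc A (drop k w')" using k by simp
  then show ?thesis using enc_bounds[OF A d(1)] enc_bounds[OF A d(2)] by auto
qed

text \<open>At the first difference the doubled digits put the leading terms at least
  \<open>2 * A ^ k\<close> apart, and the tails can undo less than \<open>A ^ k\<close> of this. A
  difference before place \<open>i\<close> only helps.\<close>

lemma enc_sep:
  assumes A: "2 * real m \<le> A + 1" "1 \<le> A"
  shows "w \<in> words m n \<Longrightarrow> w' \<in> words m n \<Longrightarrow> i < n \<Longrightarrow> w ! i \<noteq> w' ! i \<Longrightarrow> A ^ (n - 1 - i) \<le> \<bar>enc A w - enc A w'\<bar>"
proof (induction n arbitrary: w w' i)
  case (Suc k)
  obtain d v d' v' where w: "w = d # v" "w' = d' # v'" using Suc.prems by (cases w; cases w') (auto simp: words_def)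
  then have v: "v \<in> words m k" "v' \<in> words m k" using Suc.prems by (auto simp: words_Cons)
  then have len: "length v = k" "length v' = k" by (auto simp: words_def)
  show ?case
  proof (cases "d = d'")
    case True
    then obtain i' where i: "i = Suc i'" using Suc.prems w by (cases i) auto
    then have "A ^ (k - 1 - i') \<le> \<bar>enc A v - enc A v'\<bar>" using Suc.prems w v by (intro Suc.IH) auto
    then show ?thesis using True by (simp add: w i len)
  next
    case False
    have "A ^ (Suc k - 1 - i) \<le> A ^ k" using A by (intro power_increasing) auto
    moreover have "1 * (2 * A ^ k) \<le> \<bar>real d - real d'\<bar> * (2 * A ^ k)"
      using False A(2) by (intro mult_right_mono) (linarith, simp)
    moreover have "enc A w - enc A w' = (real d - real d') * (2 * A ^ k) + (enc A v - enc A v')"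
      by (simp add: w len algebra_simps)
    moreover have "\<bar>(real d - real d') * (2 * A ^ k)\<bar> = \<bar>real d - real d'\<bar> * (2 * A ^ k)"
      using A by (simp add: abs_mult)
    ultimately show ?thesis using enc_bounds[OF A v(1)] enc_bounds[OF A v(2)] by linarith
  qed
qed simp

text \<open>Heights are measured in units of \<open>r\<close>: for large \<open>r\<close> the error \<open>c\<close> becomes small.\<close>

locale sol_scaled =
  fixes a b r c :: real
  assumes a: "0 < a" and b: "0 < b" and r: "0 < r" and ac: "ln 2 \<le> a * r * c" and bc: "ln 2 \<le> b * r * c"

sublocale sol_scaled \<subseteq> horo "\<lambda>p. fst p / r" "\<lambda>p q. Mr a p q / r" "\<lambda>p q. Nr b p q / r" c
proof
  have "0 < a * r * c" using ac ln_gt_zero[of "2::real"] by linarith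
  then show c0: "0 \<le> c" using less_imp_le zero_less_mult_pos mult_pos_pos[OF a r] by blast
  fix p q s
  show "Mr a p q / r = Mr a q p / r" "Nr b p q / r = Nr b q p / r" using Mr_sym Nr_sym by auto
  show "fst p / r \<le> Mr a p q / r" "Nr b p q / r \<le> fst p / r"
    using Mr_ge[OF a] Nr_le[OF b] r by (simp_all add: divide_right_mono)
  show "Mr a p p / r = fst p / r" "Nr b p p / r = fst p / r" using Mr_self[OF a] Nr_self[OF b] by auto
  have lc: "ln 2 / a \<le> c * r" "ln 2 / b \<le> c * r" using ac bc a b by (simp_all add: divide_le_eq mult_ac)
  have "Mr a p s \<le> max (Mr a p q) (Mr a q s) + c * r" using Mr_ultra[OF a, of p s q] lc by linarith
  also have "\<dots> = (max (Mr a p q / r) (Mr a q s / r) + c) * r"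
    using r by (simp add: distrib_right max_mult_distrib_right)
  finally show "Mr a p s / r \<le> max (Mr a p q / r) (Mr a q s / r) + c" using r by (simp add: divide_le_eq)
  have "(min (Nr b p q / r) (Nr b q s / r) - c) * r = min (Nr b p q) (Nr b q s) - c * r"
    using r by (simp add: left_diff_distrib min_mult_distrib_right)
  also have "\<dots> \<le> Nr b p s" using Nr_ultra[OF b, of p q s] lc by linarith
  finally show "min (Nr b p q / r) (Nr b q s / r) - c \<le> Nr b p s / r" using r by (simp add: le_divide_eq)
qed

context sol_scaled begin

lemma D_sol_dist: "D p q = sol_dist a b p q / r" by (simp add: D_def sol_dist_def diff_divide_distrib)

text \<open>A word is read as a fraction in base \<open>exp (b1 * r)\<close>. Words with
  \<open>t\<close> common digits differ by at most \<open>exp (- b1 * t * r)\<close>, which has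
  length one at height \<open>t * r\<close>; different digits at place \<open>i\<close> still give
  \<open>exp (- b1 * (i + 1) * r)\<close>, whence the \<open>- 1\<close> in \<open>plane\<close>.
  Different times are at least \<open>r\<close> apart, so by \<open>2 * K0 * C0 \<le> r\<close> the
  factor \<open>2 * K0\<close> absorbs \<open>C0\<close>.\<close>

lemma planeY:
  assumes \<phi>: "coarse_embedding a1 b1 a b K0 C0 \<phi>" and p: "0 < a1" "0 < b1" and K0: "1 \<le> K0" and C0: "C0 \<le> c * r" "2 * K0 * C0 \<le> r" "0 \<le> C0"
    and A: "A = exp (b1 * r)" "2 * real m \<le> A + 1"
  shows "plane (2 * K0) m n (\<lambda>y t. \<phi> (real t * r, X, enc A y / A ^ n))"
proof -
  have A1: "1 \<le> A" using p r by (simp add: A)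
  have Apow: "A ^ k = exp (b1 * (r * real k))" for k by (simp add: A exp_of_nat_mult[symmetric] mult_ac)
  define P where "P y t = (real t * r, X, enc A y / A ^ n)" for y and t :: nat
  have vert: "sol_dist a1 b1 (P y s) (P y t) = r * \<bar>real s - real t\<bar>" for y s t
  proof -
    have "Mr a1 (P y s) (P y t) = max (real s * r) (real t * r)"
      by (rule order_antisym) (use p Mr_ge[OF p(1), of "P y s" "P y t"] Mr_ge'[OF p(1), of "P y t" "P y s"] in
          \<open>auto simp: Mr_le_iff P_def\<close>)
    moreover have "Nr b1 (P y s) (P y t) = min (real s * r) (real t * r)"
      by (rule order_antisym) (use p Nr_le[OF p(2), of "P y s" "P y t"] Nr_le[OF p(2), of "P y t" "P y s"] in
          \<open>auto simp: Nr_ge_iff P_def Nr_sym\<close>)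
    ultimately have "sol_dist a1 b1 (P y s) (P y t) = max (real s * r) (real t * r) - min (real s * r) (real t * r)" by (simp add: sol_dist_def)
    also have "\<dots> = (max (real s) (real t) - min (real s) (real t)) * r"
      using r by (simp add: left_diff_distrib max_mult_distrib_right min_mult_distrib_right)
    also have "max (real s) (real t) - min (real s) (real t) = \<bar>real s - real t\<bar>" by auto
    finally show ?thesis by (simp add: mult.commute)
  qed
  have q: "qline (2 * K0) (\<lambda>t. \<phi> (P y t)) n" for y
    unfolding qline_def
  proof (intro allI impI)
    fix s t
    let ?d = "\<bar>real s - real t\<bar>"
    show "?d / (2 * K0) \<le> D (\<phi> (P y s)) (\<phi> (P y t)) \<and> D (\<phi> (P y s)) (\<phi> (P y t)) \<le> 2 * K0 * ?d"
    proof (cases "s = t")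
      case True then show ?thesis by (simp add: D_self)
    next
      case False
      then have d1: "1 \<le> ?d" by linarith
      have "C0 \<le> r * ?d / (2 * K0)"
      proof -
        have "2 * K0 * C0 \<le> r * ?d" using C0(2) mult_left_mono[OF d1, of r] r by linarith
        then show ?thesis using K0 by (simp add: field_simps)
      qed
      moreover have "r * ?d / (2 * K0) = r * ?d / K0 - r * ?d / (2 * K0)" by simp
      ultimately have lo: "r * ?d / (2 * K0) \<le> sol_dist a b (\<phi> (P y s)) (\<phi> (P y t))"
        using coarse_embeddingD(1)[OF \<phi>, of "P y s" "P y t"] by (simp add: vert)
      have "C0 \<le> K0 * (r * ?d)"
      proof -
        have "C0 * 1 \<le> C0 * (2 * K0)" using K0 C0 by (intro mult_left_mono) auto
        then have "C0 \<le> r * 1" using C0 by (simp add: mult_ac)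
        also have "r * 1 \<le> r * ?d" using d1 r by (intro mult_left_mono) auto
        also have "1 * (r * ?d) \<le> K0 * (r * ?d)" using K0 r by (intro mult_right_mono) auto
        finally show ?thesis by simp
      qed
      then have hi: "sol_dist a b (\<phi> (P y s)) (\<phi> (P y t)) \<le> 2 * K0 * (r * ?d)"
        using coarse_embeddingD(2)[OF \<phi>, of "P y s" "P y t"] by (simp add: vert)
      show ?thesis using lo hi r by (simp add: D_sol_dist le_divide_eq divide_le_eq mult_ac)
    qed
  qed
  have mrg: "D (\<phi> (P y t)) (\<phi> (P y' t)) \<le> c"
    if y: "y \<in> words m n" "y' \<in> words m n" and t: "t \<le> n" "take t y = take t y'" for y y' t
  proof -
    have "\<bar>enc A y - enc A y'\<bar> \<le> A ^ (n - t)" by (rule enc_agree[OF A(2) A1 y t])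
    then have "\<bar>enc A y / A ^ n - enc A y' / A ^ n\<bar> \<le> A ^ (n - t) / A ^ n"
      using A1 by (simp add: divide_right_mono flip: diff_divide_distrib)
    also have "A ^ (n - t) / A ^ n = 1 / A ^ t" using A1 t by (simp add: power_diff field_simps)
    also have "\<dots> = exp (- b1 * (real t * r))" by (simp add: Apow exp_minus field_simps)
    finally have "real t * r \<le> Nr b1 (P y t) (P y' t)" using p by (simp add: Nr_ge_iff P_def)
    moreover have "Mr a1 (P y t) (P y' t) \<le> real t * r" using p by (simp add: Mr_le_iff P_def)
    ultimately have "sol_dist a1 b1 (P y t) (P y' t) \<le> 0" by (simp add: sol_dist_def)
    then have "K0 * sol_dist a1 b1 (P y t) (P y' t) \<le> 0" using K0 by (simp add: mult_nonneg_nonpos)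
    then have "sol_dist a b (\<phi> (P y t)) (\<phi> (P y' t)) \<le> C0" using coarse_embeddingD(2)[OF \<phi>, of "P y t" "P y' t"] by linarith
    then show ?thesis using C0 r by (simp add: D_sol_dist divide_le_eq)
  qed
  have sep: "(real (max s t) - real i - 1) / (2 * K0) - c \<le> D (\<phi> (P y s)) (\<phi> (P y' t))"
    if y: "y \<in> words m n" "y' \<in> words m n" and st: "i < n" "s \<le> n" "t \<le> n" "y ! i \<noteq> y' ! i" for y y' i s t
  proof (cases "real (max s t) - real i - 1 \<le> 0")
    case True
    then have "(real (max s t) - real i - 1) / (2 * K0) \<le> 0" using K0 by (simp add: divide_le_0_iff)
    then show ?thesis using D_nonneg[of "\<phi> (P y s)" "\<phi> (P y' t)"] c_nonneg by linarith
  next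
    case False
    have "A ^ (n - 1 - i) \<le> \<bar>enc A y - enc A y'\<bar>" by (rule enc_sep[OF A(2) A1 y st(1,4)])
    then have "A ^ (n - 1 - i) / A ^ n \<le> \<bar>enc A y / A ^ n - enc A y' / A ^ n\<bar>"
      using A1 by (simp add: divide_right_mono flip: diff_divide_distrib)
    moreover have "A ^ (n - 1 - i) / A ^ n = 1 / A ^ Suc i"
    proof -
      have "A ^ n = A ^ (n - 1 - i) * A ^ Suc i" using st by (simp flip: power_add power_Suc)
      then show ?thesis using A1 by simp
    qed
    ultimately have "exp (- b1 * (r * real (Suc i))) \<le> \<bar>enc A y / A ^ n - enc A y' / A ^ n\<bar>"
    proof -
      assume "A ^ (n - 1 - i) / A ^ n \<le> \<bar>enc A y / A ^ n - enc A y' / A ^ n\<bar>" "A ^ (n - 1 - i) / A ^ n = 1 / A ^ Suc i"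
      moreover have "1 / A ^ Suc i = exp (- b1 * (r * real (Suc i)))" unfolding Apow by (simp add: exp_minus divide_inverse)
      ultimately show ?thesis by linarith
    qed
    moreover have "\<bar>enc A y / A ^ n - enc A y' / A ^ n\<bar> \<le> exp (- b1 * Nr b1 (P y s) (P y' t))"
      using Nr_ge_iff[OF p(2), of "Nr b1 (P y s) (P y' t)" "P y s" "P y' t"] by (simp add: P_def)
    ultimately have "exp (- b1 * (r * real (Suc i))) \<le> exp (- b1 * Nr b1 (P y s) (P y' t))" by linarith
    then have N: "Nr b1 (P y s) (P y' t) \<le> r * real (Suc i)" using p by simp
    have "real (max s t) * r \<le> Mr a1 (P y s) (P y' t)"
      using Mr_ge[OF p(1), of "P y s" "P y' t"] Mr_ge'[OF p(1), of "P y' t" "P y s"] by (auto simp: P_def max_def)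
    then have "r * (real (max s t) - real i - 1) \<le> sol_dist a1 b1 (P y s) (P y' t)" using N by (simp add: sol_dist_def algebra_simps)
    then have "r * (real (max s t) - real i - 1) / K0 - C0 \<le> sol_dist a b (\<phi> (P y s)) (\<phi> (P y' t))"
      using coarse_embeddingD(1)[OF \<phi>, of "P y s" "P y' t"] K0 by (meson diff_right_mono divide_right_mono order_trans zero_le_one)
    then have "(r * (real (max s t) - real i - 1) / K0 - C0) / r \<le> D (\<phi> (P y s)) (\<phi> (P y' t))"
      using r by (simp add: D_sol_dist divide_right_mono)
    moreover have "C0 / r \<le> c" using C0 r by (simp add: divide_le_eq)
    moreover have "(r * (real (max s t) - real i - 1) / K0 - C0) / r = (real (max s t) - real i - 1) / K0 - C0 / r"
      using r by (simp add: diff_divide_distrib)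
    moreover have "(real (max s t) - real i - 1) / (2 * K0) \<le> (real (max s t) - real i - 1) / K0"
      using False K0 by (intro divide_left_mono) auto
    ultimately show ?thesis by linarith
  qed
  show ?thesis unfolding plane_def using q mrg sep unfolding P_def by blast
qed

text \<open>\<open>planeY\<close> for the flipped embedding: the lines run down from height
  \<open>n * r\<close>, and the shift by this height cancels the denominator
  \<open>A ^ n\<close>.\<close>

lemma planeX:
  assumes \<phi>: "coarse_embedding a1 b1 a b K0 C0 \<phi>" and p: "0 < a1" "0 < b1" and K0: "1 \<le> K0" and C0: "C0 \<le> c * r" "2 * K0 * C0 \<le> r" "0 \<le> C0"
    and A: "A = exp (a1 * r)" "2 * real m \<le> A + 1"
  shows "plane (2 * K0) m n (\<lambda>x t. \<phi> ((real n - real t) * r, enc A x, Y))"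
proof -
  have 1: "coarse_embedding b1 a1 a b K0 C0 (\<lambda>p. \<phi> (flip (shift b1 a1 (- (real n * r)) 0 0 p)))"
    by (rule coarse_embedding_shift[OF coarse_embedding_flip[OF \<phi>] p(2,1)])
  have "A ^ n = exp (a1 * (real n * r))" by (simp add: A exp_of_nat_mult[symmetric] mult_ac)
  then have "flip (shift b1 a1 (- (real n * r)) 0 0 (real t * r, exp (b1 * (real n * r)) * Y, enc A x / A ^ n))
      = ((real n - real t) * r, enc A x, Y)" for x t
    by (simp add: flip_def shift_def algebra_simps flip: exp_add)
  then show ?thesis
    using planeY[OF 1 p(2,1) K0 C0 A, of n "exp (b1 * (real n * r)) * Y"] by simp
qed

end

section \<open>Rising against descending planes\<close>

context horo begin

lemma M_trans5:
  assumes "M p q \<le> x" "M q r \<le> x" "M r s \<le> x" "M s t \<le> x" "M t u \<le> x"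
  shows "M p u \<le> x + 4 * c"
proof -
  have "M p s \<le> x + c + c" by (rule M_trans[OF M_trans[OF assms(1,2)]]) (use assms c_nonneg in linarith)
  moreover have "M s u \<le> x + c" by (rule M_trans[OF assms(4,5)])
  ultimately have "M p u \<le> x + c + c + c" using c_nonneg by (intro M_trans[of p s "x + c + c" u]) linarith+
  then show ?thesis using c_nonneg by linarith
qed

lemma dual_plane: "horo.plane (\<lambda>p q. - N p q) (\<lambda>p q. - M p q) c = plane"
  by (intro ext) (simp add: horo.plane_def[OF dual] dual_D dual_qline plane_def)

lemma up_cong: "(\<And>t. t \<le> n \<Longrightarrow> P t = Q t) \<Longrightarrow> up e P n \<longleftrightarrow> up e Q n"
proof -
  assume H: "\<And>t. t \<le> n \<Longrightarrow> P t = Q t"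
  have "(h (P s) - e \<le> N (P s) (P t) \<and> M (P s) (P t) \<le> h (P t) + e)
      = (h (Q s) - e \<le> N (Q s) (Q t) \<and> M (Q s) (Q t) \<le> h (Q t) + e)" if "s \<le> t \<and> t \<le> n" for s t
    using that H[of s] H[of t] by simp
  then show ?thesis unfolding up_def by blast
qed

text \<open>\<open>collapse\<close> for the block that reaches the top. Together with
  \<open>merge_low\<close>: rising lines merge at the height where they part, up to
  \<open>planeE K e\<close>.\<close>

lemma split_up:
  assumes g: "plane K m n g" and y: "y \<in> words m n" "y' \<in> words m n" and K: "1 \<le> K" and c: "100 * c \<le> 1"
    and e: "0 \<le> e" and i: "i < n" "take i y = take i y'" "y ! i \<noteq> y' ! i" and up: "up e (g y) n" "up e (g y') n"
  shows "N (g y n) (g y' n) < h (g y i) + planeE K e"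
proof (rule ccontr)
  assume "\<not> ?thesis"
  then have N: "h (g y i) + planeE K e \<le> N (g y n) (g y' n)" by simp
  have in_: "i + (n - i) = n" using i by simp
  have s: "up e (\<lambda>t. g z (i + t)) (n - i)" if "up e (g z) n" for z
    using that i unfolding up_def by (auto simp: less_diff_conv2)
  show False
    by (rule collapse[OF g y K c e i _ s[OF up(1)] s[OF up(2)], of "h (g y i) + planeE K e"])
      (use N N_le[of "g y n" "g y' n"] N_le'[of "g y n" "g y' n"] in \<open>auto simp: in_ planeE_def N_self\<close>)
qed

lemma split_dn:
  assumes g: "plane K m n g" and y: "y \<in> words m n" "y' \<in> words m n" and K: "1 \<le> K" and c: "100 * c \<le> 1"
    and e: "0 \<le> e" and i: "i < n" "take i y = take i y'" "y ! i \<noteq> y' ! i" and dn: "dn e (g y) n" "dn e (g y') n"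
  shows "h (g y i) - planeE K e < M (g y n) (g y' n)"
proof -
  interpret d: horo "\<lambda>p. - h p" "\<lambda>p q. - N p q" "\<lambda>p q. - M p q" c by (rule dual)
  have "- M (g y n) (g y' n) < - h (g y i) + planeE K e"
    by (rule d.split_up[OF _ y K c e i]) (use g dn in \<open>simp_all add: dual_plane dual_up\<close>)
  then show ?thesis by linarith
qed

lemma dn_height:
  assumes q: "qline K P n" and dn: "dn e P n" and t: "t \<le> n"
  shows "h (P t) + real t / K - 2 * e \<le> h (P 0)"
  using qlineD(1)[OF q, of 0 t] dn[unfolded dn_def, rule_format, of 0 t] t unfolding D_def by simp

text \<open>The ends of \<open>g\<close> merge upwards at about their own height, by way of the
  rising lines and their common start. The ends of \<open>g1\<close> are close to these, but by
  \<open>split_dn\<close> merge upwards only near the start of the descending lines, which is higher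
  by about \<open>n / K\<close>.\<close>

lemma no_mixed:
  assumes g: "plane K m n g" and g1: "plane K m n g1" and y: "y \<in> words m n" "y' \<in> words m n" and K: "1 \<le> K" and c: "100 * c \<le> 1"
    and e: "0 \<le> e" and n: "0 < n" and ne: "y ! 0 \<noteq> y' ! 0"
    and dn: "dn e (g1 y) n" "dn e (g1 y') n" and up: "up e (g y) n" "up e (g y') n"
    and top: "D (g1 y n) (g y n) \<le> c" "D (g1 y' n) (g y' n) \<le> c"
    and big: "planeE K e + 3 * e + 20 * c < real n / K"
  shows False
proof -
  have 1: "h (g1 y 0) - planeE K e < M (g1 y n) (g1 y' n)"
    by (rule split_dn[OF g1 y K c e n _ ne dn]) simp
  define x where "x = max (h (g y n)) (h (g y' n)) + e + 2 * c"
  have u: "M (g y 0) (g y n) \<le> h (g y n) + e" "M (g y' 0) (g y' n) \<le> h (g y' n) + e"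
    using upD(2)[OF up(1), of 0 n] upD(2)[OF up(2), of 0 n] by auto
  have b: "D (g y 0) (g y' 0) \<le> c" by (rule planeD(2)[OF g y]) auto
  have "M (g1 y n) (g1 y' n) \<le> x + 4 * c"
  proof (rule M_trans5)
    show "M (g1 y n) (g y n) \<le> x" using M_le_D'[of "g1 y n" "g y n"] top c_nonneg e by (simp add: x_def)
    show "M (g y n) (g y 0) \<le> x" using u c_nonneg by (simp add: x_def M_sym[of "g y n"])
    show "M (g y 0) (g y' 0) \<le> x" using M_le_D[of "g y 0" "g y' 0"] b u M_ge[of "g y 0" "g y n"] c_nonneg by (simp add: x_def)
    show "M (g y' 0) (g y' n) \<le> x" using u c_nonneg by (simp add: x_def)
    show "M (g y' n) (g1 y' n) \<le> x" using M_le_D'[of "g1 y' n" "g y' n"] top c_nonneg e by (simp add: x_def M_sym[of "g y' n"])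
  qed
  moreover have "h (g y n) \<le> h (g1 y 0) - real n / K + 2 * e + 2 * c"
    using dn_height[OF planeD(1)[OF g1 y(1)] dn(1) order_refl] h_diff[of "g1 y n" "g y n"] top c_nonneg by linarith
  moreover have "h (g y' n) \<le> h (g1 y 0) - real n / K + 2 * e + 2 * c"
    using dn_height[OF planeD(1)[OF g1 y(2)] dn(2) order_refl] h_diff[of "g1 y' n" "g y' n"] top
      h_diff[of "g1 y 0" "g1 y' 0"] planeD(2)[OF g1 y le0] by simp
  ultimately show False using 1 big c_nonneg unfolding x_def by linarith
qed

end

section \<open>Counting pairs of words, cells and unit pieces\<close>

lemma ex_above_average:
  fixes f :: "'a \<Rightarrow> real" and t :: real
  assumes "finite X" "card X * t < (\<Sum>x\<in>X. f x)"
  shows "\<exists>x\<in>X. t < f x"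
  using assms sum_bounded_above[of X f t] by fastforce

text \<open>A row \<open>x1\<close> that descends on a large column set \<open>Y1\<close> makes
  nearly all of \<open>X\<close> times \<open>Y1\<close> descend: by \<open>mix\<close> no other row
  rises often on \<open>Y1\<close>, and the pairs that do neither are few. Averaging this rectangle
  over columns gives \<open>y1\<close>, averaging over rows gives the last claim. In the application
  \<open>\<kappa>\<close> is one over the number of digits, so more than
  \<open>\<kappa> * card Y\<close> common columns cannot all have the same first digit.\<close>

lemma rect_pick:
  fixes Up Dn :: "'a \<Rightarrow> 'b \<Rightarrow> bool"
  assumes X: "finite X" and Y: "finite Y" "Y \<noteq> {}" and t: "0 < \<theta>" "\<kappa> + \<eta> \<le> \<theta> / 10"
    and dn: "\<theta> * (real (card X) * real (card Y)) < real (card {(x, y). x \<in> X \<and> y \<in> Y \<and> Dn x y})"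
    and bad: "real (card {(x, y). x \<in> X \<and> y \<in> Y \<and> \<not> (Up x y \<or> Dn x y)}) \<le> \<eta> * (real (card X) * real (card Y))"
    and mix: "\<And>x1 x. x1 \<in> X \<Longrightarrow> x \<in> X \<Longrightarrow> real (card {y \<in> Y. Dn x1 y \<and> Up x y}) \<le> \<kappa> * real (card Y)"
  obtains x1 y1 where "x1 \<in> X" "y1 \<in> Y" "Dn x1 y1" "9/10 * real (card X) \<le> real (card {x \<in> X. Dn x y1})"
    "8/10 * real (card X) \<le> real (card {x \<in> X. \<kappa> * real (card Y) < real (card {y \<in> Y. Dn x1 y \<and> Dn x y})})"
proof -
  let ?X = "real (card X)" and ?Y = "real (card Y)"
  have Yp: "0 < ?Y" using Y by (simp add: card_gt_0_iff)
  have sig: "real (card {(x, y). x \<in> X \<and> y \<in> Z \<and> R x y}) = (\<Sum>x\<in>X. real (card {y \<in> Z. R x y}))" if "finite Z" for R Z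
  proof -
    have "{(x, y). x \<in> X \<and> y \<in> Z \<and> R x y} = (SIGMA x:X. {y \<in> Z. R x y})" by auto
    then show ?thesis using X that by (simp add: card_SigmaI)
  qed
  obtain x1 where x1: "x1 \<in> X" "\<theta> * ?Y < real (card {y \<in> Y. Dn x1 y})"
    using ex_above_average[OF X, of "\<theta> * ?Y"] dn unfolding sig[OF Y(1)] by (auto simp: mult_ac)
  define Y1 where "Y1 = {y \<in> Y. Dn x1 y}"
  have Y1: "finite Y1" "Y1 \<subseteq> Y" "\<theta> * ?Y < real (card Y1)" using Y x1 by (auto simp: Y1_def)
  have Y1p: "0 < real (card Y1)" using Y1(3) t Yp mult_pos_pos[of \<theta> ?Y] by linarith
  have Xp: "0 < ?X" using x1 X by (auto simp: card_gt_0_iff)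
  have S: "9/10 * (?X * real (card Y1)) \<le> (\<Sum>x\<in>X. real (card {y \<in> Y1. Dn x y}))"
  proof -
    have "real (card Y1) \<le> real (card {y \<in> Y1. Dn x y}) + \<kappa> * ?Y + real (card {y \<in> Y. \<not> (Up x y \<or> Dn x y)})" if x: "x \<in> X" for x
    proof -
      have "Y1 \<subseteq> {y \<in> Y1. Dn x y} \<union> {y \<in> Y. Dn x1 y \<and> Up x y} \<union> {y \<in> Y. \<not> (Up x y \<or> Dn x y)}" by (auto simp: Y1_def)
      then have "card Y1 \<le> card ({y \<in> Y1. Dn x y} \<union> {y \<in> Y. Dn x1 y \<and> Up x y} \<union> {y \<in> Y. \<not> (Up x y \<or> Dn x y)})"
        using Y Y1 by (intro card_mono) auto
      also have "\<dots> \<le> card {y \<in> Y1. Dn x y} + card {y \<in> Y. Dn x1 y \<and> Up x y} + card {y \<in> Y. \<not> (Up x y \<or> Dn x y)}"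
        by (meson add_le_mono1 card_Un_le order_trans)
      finally show ?thesis using mix[OF x1(1) x] by linarith
    qed
    then have "(\<Sum>x\<in>X. real (card Y1)) \<le> (\<Sum>x\<in>X. real (card {y \<in> Y1. Dn x y}) + \<kappa> * ?Y + real (card {y \<in> Y. \<not> (Up x y \<or> Dn x y)}))"
      by (intro sum_mono)
    also have "\<dots> = (\<Sum>x\<in>X. real (card {y \<in> Y1. Dn x y})) + ?X * (\<kappa> * ?Y) + (\<Sum>x\<in>X. real (card {y \<in> Y. \<not> (Up x y \<or> Dn x y)}))"
      by (simp add: sum.distrib)
    also have "\<dots> \<le> (\<Sum>x\<in>X. real (card {y \<in> Y1. Dn x y})) + ?X * (\<kappa> * ?Y) + \<eta> * (?X * ?Y)"
      using bad unfolding sig[OF Y(1)] by linarith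
    finally have "?X * real (card Y1) \<le> (\<Sum>x\<in>X. real (card {y \<in> Y1. Dn x y})) + ?X * ((\<kappa> + \<eta>) * ?Y)"
      by (simp add: algebra_simps)
    moreover have "?X * ((\<kappa> + \<eta>) * ?Y) \<le> ?X * (real (card Y1) / 10)"
    proof (rule mult_left_mono)
      have "(\<kappa> + \<eta>) * ?Y \<le> \<theta> / 10 * ?Y" using t by (intro mult_right_mono) auto
      then show "(\<kappa> + \<eta>) * ?Y \<le> real (card Y1) / 10" using Y1(3) by linarith
    qed simp
    ultimately show ?thesis by linarith
  qed
  have "\<exists>y1\<in>Y1. 9/10 * ?X \<le> real (card {x \<in> X. Dn x y1})"
  proof (rule ccontr)
    assume "\<not> ?thesis"
    then have "(\<Sum>y\<in>Y1. real (card {x \<in> X. Dn x y})) < (\<Sum>y\<in>Y1. 9/10 * ?X)"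
      using Y1 Y1p by (intro sum_strict_mono) (auto simp: card_gt_0_iff)
    moreover have "(\<Sum>y\<in>Y1. real (card {x \<in> X. Dn x y})) = (\<Sum>x\<in>X. real (card {y \<in> Y1. Dn x y}))"
      using sum_multicount_gen[OF X Y1(1), of "\<lambda>x y. Dn x y" "\<lambda>y. card {x \<in> X. Dn x y}"] by (simp flip: of_nat_sum)
    ultimately show False using S by (simp add: mult_ac)
  qed
  then obtain y1 where y1: "y1 \<in> Y1" "9/10 * ?X \<le> real (card {x \<in> X. Dn x y1})" by blast
  define X2 where "X2 = {x \<in> X. \<kappa> * ?Y < real (card {y \<in> Y. Dn x1 y \<and> Dn x y})}"
  have eqY: "{y \<in> Y1. Dn x y} = {y \<in> Y. Dn x1 y \<and> Dn x y}" for x by (auto simp: Y1_def)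
  have ke: "0 \<le> \<eta>"
  proof -
    have "0 \<le> \<eta> * (?X * ?Y)" using bad by linarith
    then show ?thesis using mult_pos_pos[OF Xp Yp] by (metis mult.commute zero_le_mult_iff not_le)
  qed
  have "(\<Sum>x\<in>X. real (card {y \<in> Y1. Dn x y})) \<le> (\<Sum>x\<in>X. (if x \<in> X2 then real (card Y1) else 0) + real (card Y1) / 10)"
  proof (intro sum_mono)
    fix x assume x: "x \<in> X"
    have "card {y \<in> Y1. Dn x y} \<le> card Y1" using Y1 by (intro card_mono) auto
    moreover have "\<kappa> * ?Y \<le> real (card Y1) / 10"
    proof -
      have "\<kappa> * ?Y \<le> \<theta> / 10 * ?Y" using t ke by (intro mult_right_mono) auto
      then show ?thesis using Y1(3) by linarith
    qed
    ultimately show "real (card {y \<in> Y1. Dn x y}) \<le> (if x \<in> X2 then real (card Y1) else 0) + real (card Y1) / 10"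
      using x by (auto simp: X2_def eqY)
  qed
  also have "\<dots> = real (card X2) * real (card Y1) + ?X * (real (card Y1) / 10)"
  proof -
    have "(\<Sum>x\<in>X. if x \<in> X2 then real (card Y1) else 0) = real (card X2) * real (card Y1)"
      using X by (subst sum.inter_restrict[symmetric]) (auto simp: X2_def Int_def)
    then show ?thesis by (simp add: sum.distrib)
  qed
  finally have "(8/10 * ?X) * real (card Y1) \<le> real (card X2) * real (card Y1)" using S by (simp add: algebra_simps)
  then have "8/10 * ?X \<le> real (card X2)" using Y1p by (rule mult_right_le_imp_le)
  then show ?thesis using that[of x1 y1] x1 y1 by (simp add: X2_def Y1_def)
qed

lemma card_floor_interval: "u \<le> v \<Longrightarrow> real (card {\<lfloor>u\<rfloor>..\<lfloor>v\<rfloor>}) \<le> v - u + 2"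
proof -
  assume "u \<le> v"
  then have "\<lfloor>u\<rfloor> \<le> \<lfloor>v\<rfloor>" by (rule floor_mono)
  then have "real (card {\<lfloor>u\<rfloor>..\<lfloor>v\<rfloor>}) = of_int \<lfloor>v\<rfloor> - of_int \<lfloor>u\<rfloor> + 1" by simp
  then show ?thesis by linarith
qed

lemma floor_eq_close:
  fixes u v :: real
  shows "\<lfloor>u\<rfloor> = \<lfloor>v\<rfloor> \<Longrightarrow> \<bar>u - v\<bar> \<le> 1"
  by linarith

text \<open>The points lie in a bounded region around \<open>q\<close>, which is cut into cells that
  have unit size at their height. Two points of one cell are at distance at most one, so their words
  agree except in the last digit; recording this digit too makes the map injective and gives the
  factor \<open>m\<close>.\<close>

lemma packing:
  fixes p :: "nat list \<Rightarrow> pt"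
  assumes ab: "0 < a" "0 < b" and T: "0 \<le> T" and n: "0 < n" and Z: "Z \<subseteq> words m n"
    and near: "\<And>x. x \<in> Z \<Longrightarrow> Mr a (p x) q \<le> fst (p x) + E" "\<And>x. x \<in> Z \<Longrightarrow> L \<le> Nr b (p x) q" "\<And>x. x \<in> Z \<Longrightarrow> fst (p x) \<le> L + T"
    and sep: "\<And>x x'. x \<in> Z \<Longrightarrow> x' \<in> Z \<Longrightarrow> sol_dist a b (p x) (p x') \<le> 1 \<Longrightarrow> take (n - 1) x = take (n - 1) x'"
  shows "real (card Z) \<le> (T + 2) * (2 * exp (a * (E + 1)) + 2) * (2 * exp (b * T) + 2) * real m"
proof -
  define k where "k x = \<lfloor>fst (p x)\<rfloor>" for x
  define i where "i x = \<lfloor>(fst (snd (p x)) - fst (snd q)) * exp (- a * k x)\<rfloor>" for x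
  define j where "j x = \<lfloor>(snd (snd (p x)) - snd (snd q)) * exp (b * k x)\<rfloor>" for x
  define I J where "I = exp (a * (E + 1))" and "J = exp (b * T)"
  define G where "G x = (((k x, i x), j x), x ! (n - 1))" for x
  define C where "C = (({\<lfloor>L\<rfloor>..\<lfloor>L + T\<rfloor>} \<times> {\<lfloor>- I\<rfloor>..\<lfloor>I\<rfloor>}) \<times> {\<lfloor>- J\<rfloor>..\<lfloor>J\<rfloor>}) \<times> {..<m}"
  have kz: "of_int (k x) \<le> fst (p x)" "fst (p x) < of_int (k x) + 1" for x unfolding k_def by linarith+
  have "inj_on G Z"
  proof (rule inj_onI)
    fix x x' assume x: "x \<in> Z" "x' \<in> Z" and G: "G x = G x'"
    then have kk: "k x = k x'" and ii: "i x = i x'" and jj: "j x = j x'" and last: "x ! (n - 1) = x' ! (n - 1)" by (auto simp: G_def)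
    have "\<bar>(fst (snd (p x)) - fst (snd q)) * exp (- a * k x) - (fst (snd (p x')) - fst (snd q)) * exp (- a * k x)\<bar> \<le> 1"
      by (rule floor_eq_close) (use ii kk in \<open>simp add: i_def\<close>)
    then have "\<bar>fst (snd (p x)) - fst (snd (p x'))\<bar> * exp (- a * k x) \<le> 1"
      by (simp add: abs_mult flip: left_diff_distrib)
    then have xx: "\<bar>fst (snd (p x)) - fst (snd (p x'))\<bar> \<le> exp (a * k x)" by (simp add: exp_minus field_simps)
    have "\<bar>(snd (snd (p x)) - snd (snd q)) * exp (b * k x) - (snd (snd (p x')) - snd (snd q)) * exp (b * k x)\<bar> \<le> 1"
      by (rule floor_eq_close) (use jj kk in \<open>simp add: j_def\<close>)
    then have "\<bar>snd (snd (p x)) - snd (snd (p x'))\<bar> * exp (b * k x) \<le> 1"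
      by (simp add: abs_mult flip: left_diff_distrib)
    then have yy: "\<bar>snd (snd (p x)) - snd (snd (p x'))\<bar> \<le> exp (- b * k x)" by (simp add: exp_minus field_simps)
    have "exp (a * k x) \<le> exp (a * (of_int (k x) + 1))" using ab by simp
    with xx have "\<bar>fst (snd (p x)) - fst (snd (p x'))\<bar> \<le> exp (a * (of_int (k x) + 1))" by (rule order_trans)
    then have "Mr a (p x) (p x') \<le> of_int (k x) + 1"
      unfolding Mr_le_iff[OF ab(1)] using kz[of x] kz[of x'] kk by auto
    moreover have "of_int (k x) \<le> Nr b (p x) (p x')"
      unfolding Nr_ge_iff[OF ab(2)] using yy kz[of x] kz[of x'] kk by auto
    ultimately have "take (n - 1) x = take (n - 1) x'" using x by (intro sep) (auto simp: sol_dist_def)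
    moreover have "length x = n" "length x' = n" using x Z by (auto simp: words_def)
    ultimately show "x = x'" using last n
      by (metis Suc_pred' lessI take_Suc_conv_app_nth take_all order_refl)
  qed
  moreover have "G ` Z \<subseteq> C"
  proof
    fix v assume "v \<in> G ` Z"
    then obtain x where x: "x \<in> Z" and v: "v = G x" by auto
    have N: "L \<le> fst (p x)" "\<bar>snd (snd (p x)) - snd (snd q)\<bar> \<le> exp (- b * L)"
      using near(2)[OF x] unfolding Nr_ge_iff[OF ab(2)] by auto
    have M: "\<bar>fst (snd (p x)) - fst (snd q)\<bar> \<le> exp (a * (fst (p x) + E))"
      using near(1)[OF x] unfolding Mr_le_iff[OF ab(1)] by auto
    have kL: "\<lfloor>L\<rfloor> \<le> k x" "k x \<le> \<lfloor>L + T\<rfloor>" using N near(3)[OF x] unfolding k_def by (auto intro: floor_mono)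
    have "\<bar>(fst (snd (p x)) - fst (snd q)) * exp (- a * k x)\<bar> \<le> exp (a * (fst (p x) + E)) * exp (- a * k x)"
      using M by (simp add: abs_mult)
    also have "\<dots> = exp (a * (fst (p x) + E - k x))" by (simp add: algebra_simps flip: exp_add)
    also have "\<dots> \<le> I" using ab kz[of x] by (simp add: I_def)
    finally have i: "\<lfloor>- I\<rfloor> \<le> i x" "i x \<le> \<lfloor>I\<rfloor>" unfolding i_def by (auto intro: floor_mono)
    have "\<bar>(snd (snd (p x)) - snd (snd q)) * exp (b * k x)\<bar> \<le> exp (- b * L) * exp (b * k x)"
      using N by (simp add: abs_mult)
    also have "\<dots> = exp (b * (k x - L))" by (simp add: algebra_simps flip: exp_add)
    also have "\<dots> \<le> J" using ab kz[of x] near(3)[OF x] by (simp add: J_def)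
    finally have j: "\<lfloor>- J\<rfloor> \<le> j x" "j x \<le> \<lfloor>J\<rfloor>" unfolding j_def by (auto intro: floor_mono)
    have xw: "length x = n" "set x \<subseteq> {..<m}" using x Z by (auto simp: words_def)
    then have "x ! (n - 1) \<in> set x" using n by (intro nth_mem) simp
    then have "x ! (n - 1) < m" using xw by auto
    then show "v \<in> C" using kL i j by (simp add: v G_def C_def)
  qed
  ultimately have "card Z \<le> card C" by (intro card_inj_on_le) (auto simp: C_def)
  then have "real (card Z) \<le> real (card C)" by simp
  also have "\<dots> = real (card {\<lfloor>L\<rfloor>..\<lfloor>L + T\<rfloor>}) * real (card {\<lfloor>- I\<rfloor>..\<lfloor>I\<rfloor>}) * real (card {\<lfloor>- J\<rfloor>..\<lfloor>J\<rfloor>}) * real m"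
    unfolding C_def card_cartesian_product of_nat_mult by simp
  also have "\<dots> \<le> (T + 2) * (2 * I + 2) * (2 * J + 2) * real m"
    using card_floor_interval[of L "L + T"] card_floor_interval[of "- I" I] card_floor_interval[of "- J" J] T
    by (intro mult_mono) (auto simp: I_def J_def)
  finally show ?thesis by (simp add: I_def J_def)
qed

text \<open>The \<open>y\<close>-segment is cut into about \<open>exp (b1 * z)\<close> pieces that
  have length at most one at height \<open>z\<close>. Each piece moves the image by at most
  \<open>C\<close>, and since the image stays below \<open>H\<close>, \<open>M\<close> is at most
  \<open>H + C\<close>; so each piece changes \<open>x\<close> by at most
  \<open>exp (a * (H + C))\<close>.\<close>

lemma horizontal_bound:
  assumes \<phi>: "coarse_embedding a1 b1 a b K C \<phi>" and pos: "0 < a1" "0 < b1" "0 < a" "0 < b" and K: "0 \<le> K" and z: "0 \<le> z"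
    and top: "\<And>y. 0 \<le> y \<Longrightarrow> y \<le> 1 \<Longrightarrow> fst (\<phi> (z, x, y)) \<le> H"
    and y: "0 \<le> y1" "y1 \<le> 1" "0 \<le> y2" "y2 \<le> 1"
  shows "\<bar>fst (snd (\<phi> (z, x, y1))) - fst (snd (\<phi> (z, x, y2)))\<bar> \<le> (exp (b1 * z) + 1) * exp (a * (H + C))"
proof -
  define n where "n = nat \<lceil>exp (b1 * z)\<rceil>"
  have n: "exp (b1 * z) \<le> real n" "real n \<le> exp (b1 * z) + 1"
    unfolding n_def using exp_gt_zero[of "b1 * z"] by linarith+
  have "1 \<le> exp (b1 * z)" using pos z by simp
  then have np: "0 < real n" using n by linarith
  define Y where "Y i = y1 + (y2 - y1) * (real i / real n)" for i
  define G where "G i = fst (snd (\<phi> (z, x, Y i)))" for i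
  have Y01: "0 \<le> Y i \<and> Y i \<le> 1" if "i \<le> n" for i
  proof -
    define t where "t = real i / real n"
    have t: "0 \<le> t" "t \<le> 1" using that np by (auto simp: t_def)
    have "Y i = (1 - t) * y1 + t * y2" by (simp add: Y_def t_def[symmetric] algebra_simps)
    moreover have "0 \<le> (1 - t) * y1" "0 \<le> t * y2" "(1 - t) * y1 \<le> (1 - t) * 1" "t * y2 \<le> t * 1"
      using t y mult_left_mono[of y1 1 "1 - t"] mult_left_mono[of y2 1 t] by auto
    ultimately show ?thesis by auto
  qed
  have step: "\<bar>G (Suc i) - G i\<bar> \<le> exp (a * (H + C))" if "i < n" for i
  proof -
    let ?p = "(z, x, Y i)" and ?q = "(z, x, Y (Suc i))"
    have "Y (Suc i) - Y i = (y2 - y1) / real n" by (simp add: Y_def diff_divide_distrib add_divide_distrib algebra_simps)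
    then have "\<bar>Y (Suc i) - Y i\<bar> \<le> 1 / real n" using y np by (simp add: divide_right_mono abs_le_iff)
    also have "\<dots> \<le> 1 / exp (b1 * z)" using n np by (intro divide_left_mono) auto
    also have "\<dots> = exp (- b1 * z)" by (simp add: exp_minus divide_inverse)
    finally have "z \<le> Nr b1 ?p ?q" unfolding Nr_ge_iff[OF pos(2)] by (simp add: abs_minus_commute)
    moreover have "Mr a1 ?p ?q \<le> z" unfolding Mr_le_iff[OF pos(1)] by simp
    ultimately have "sol_dist a1 b1 ?p ?q \<le> 0" by (simp add: sol_dist_def)
    then have "sol_dist a b (\<phi> ?p) (\<phi> ?q) \<le> C"
      using coarse_embeddingD(2)[OF \<phi>, of ?p ?q] K mult_nonneg_nonpos[of K "sol_dist a1 b1 ?p ?q"] by linarith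
    moreover have "Nr b (\<phi> ?p) (\<phi> ?q) \<le> H" using Nr_le[OF pos(4), of "\<phi> ?p" "\<phi> ?q"] top[of "Y i"] Y01[of i] that by auto
    ultimately have "Mr a (\<phi> ?p) (\<phi> ?q) \<le> H + C" by (simp add: sol_dist_def)
    then show ?thesis unfolding Mr_le_iff[OF pos(3)] by (simp add: G_def abs_minus_commute)
  qed
  have "G n - G 0 = (\<Sum>i<n. G (Suc i) - G i)" by (simp add: sum_lessThan_telescope)
  then have "\<bar>G n - G 0\<bar> \<le> (\<Sum>i<n. \<bar>G (Suc i) - G i\<bar>)" by (simp add: sum_abs)
  also have "\<dots> \<le> (\<Sum>i<n. exp (a * (H + C)))" by (intro sum_mono step) auto
  also have "\<dots> \<le> (exp (b1 * z) + 1) * exp (a * (H + C))" using n by simp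
  finally show ?thesis using np by (simp add: G_def Y_def abs_minus_commute)
qed

lemma take_neq_nth:
  assumes "length x = n" "length y = n" "take k x \<noteq> take k y" "k \<le> n"
  shows "\<exists>i<k. x ! i \<noteq> y ! i"
  using assms by (metis length_take min.absorb2 nth_equalityI nth_take)

subsection \<open>Images of boxes\<close>

text \<open>The bounds on \<open>mx\<close> and \<open>my\<close> are those of \<open>enc\<close>.
  \<open>4 * K0 \<le> r\<close> serves \<open>packing\<close>: a distance of at most one must be
  less than the separation \<open>1 / (2 * K0) - c\<close> in units of \<open>r\<close>.\<close>

locale sol_box = sol_scaled +
  fixes K0 C0 :: real and mx my :: nat
  assumes K0: "1 \<le> K0" and C0: "0 \<le> C0" "C0 \<le> c * r" "2 * K0 * C0 \<le> r" "4 * K0 \<le> r"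
    and c_small: "200 * K0 * c \<le> 1"
    and mx: "0 < mx" "2 * real mx \<le> exp (a * r) + 1" and my: "0 < my" "2 * real my \<le> exp (b * r) + 1"
begin

text \<open>The lines branch in both directions: over \<open>y\<close> upwards from the bottom face,
  over \<open>x\<close> downwards from the top face. This is why only the \<open>y\<close>-expansion
  is divided by its top power.\<close>

definition box_line :: "(pt \<Rightarrow> pt) \<Rightarrow> nat \<Rightarrow> nat list \<Rightarrow> nat list \<Rightarrow> nat \<Rightarrow> pt" where
  "box_line \<phi> n x y t = \<phi> (real t * r, enc (exp (a * r)) x, enc (exp (b * r)) y / exp (b * r) ^ n)"

lemma c1: "100 * c \<le> 1"
proof -
  have "200 * c * 1 \<le> 200 * c * K0" using K0 c_nonneg by (intro mult_left_mono) auto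
  then show ?thesis using c_small c_nonneg by (simp add: mult_ac)
qed

lemma A1: "1 \<le> exp (a * r)" "1 \<le> exp (b * r)" using a b r by auto

lemma close:
  assumes "coarse_embedding a1 b1 a b K0 C0 \<phi>" "sol_dist a1 b1 p q \<le> 0"
  shows "D (\<phi> p) (\<phi> q) \<le> c"
proof -
  have "K0 * sol_dist a1 b1 p q \<le> 0" using K0 assms(2) by (simp add: mult_nonneg_nonpos)
  then have "sol_dist a b (\<phi> p) (\<phi> q) \<le> c * r" using coarse_embeddingD(2)[OF assms(1), of p q] C0 by linarith
  then show ?thesis using r by (simp add: D_sol_dist divide_le_eq)
qed

lemma enc_scaled_01: "y \<in> words my n \<Longrightarrow> 0 \<le> enc (exp (b * r)) y / exp (b * r) ^ n \<and> enc (exp (b * r)) y / exp (b * r) ^ n \<le> 1"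
  using enc_bounds[OF my(2) A1(2), of y n] by (simp add: divide_le_eq)

lemma box_line_plane: "coarse_embedding a b a b K0 C0 \<phi> \<Longrightarrow> plane (2 * K0) my n (box_line \<phi> n x)"
  unfolding box_line_def by (rule planeY[OF _ a b K0 C0(2,3,1) refl my(2)])

lemma box_line_planeX: "coarse_embedding a b a b K0 C0 \<phi> \<Longrightarrow> plane (2 * K0) mx n (\<lambda>x t. \<phi> ((real n - real t) * r, enc (exp (a * r)) x, Y))"
  by (rule planeX[OF _ a b K0 C0(2,3,1) refl mx(2)])

lemma exp_pow: "exp (u * r) ^ n = exp (u * (real n * r))" by (simp add: exp_of_nat_mult[symmetric] mult_ac)

lemma sol_dist_top:
  assumes "x \<in> words mx n" "x' \<in> words mx n"
  shows "sol_dist a b (real n * r, enc (exp (a * r)) x, Y) (real n * r, enc (exp (a * r)) x', Y) \<le> 0"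
proof -
  have "\<bar>enc (exp (a * r)) x - enc (exp (a * r)) x'\<bar> \<le> exp (a * (real n * r))"
    using enc_agree[OF mx(2) A1(1) assms le0] by (simp add: exp_pow)
  then have "Mr a (real n * r, enc (exp (a * r)) x, Y) (real n * r, enc (exp (a * r)) x', Y) \<le> real n * r"
    by (simp add: Mr_le_iff[OF a])
  moreover have "real n * r \<le> Nr b (real n * r, enc (exp (a * r)) x, Y) (real n * r, enc (exp (a * r)) x', Y)"
    by (simp add: Nr_ge_iff[OF b])
  ultimately show ?thesis by (simp add: sol_dist_def)
qed

lemma sol_dist_bottom:
  assumes "0 \<le> Y" "Y \<le> 1" "0 \<le> Y'" "Y' \<le> 1"
  shows "sol_dist a b (0, X, Y) (0, X, Y') \<le> 0"
proof -
  have "Mr a (0, X, Y) (0, X, Y') \<le> 0" by (simp add: Mr_le_iff[OF a])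
  moreover have "0 \<le> Nr b (0, X, Y) (0, X, Y')" using assms by (simp add: Nr_ge_iff[OF b])
  ultimately show ?thesis by (simp add: sol_dist_def)
qed

text \<open>Suppose that many lines descend. Then some line descends together with most of its \<open>x\<close>-translates,
  and the mirrored \<open>parallel_plane_height\<close> keeps the image of the top face below a height close to that
  of the end \<open>q\<close> of this line. By \<open>packing\<close>, the images of most translates start more than \<open>n\<close> above
  \<open>q\<close>. Over one such starting point there are two descending lines with different first digits; their ends
  can only merge above it, so they are \<open>exp (a n)\<close> apart relative to the height of \<open>q\<close>. But they are
  joined by the image of a \<open>y\<close>-segment of length \<open>exp (b n)\<close> in the top face, and \<open>b < a\<close>.\<close>

lemma few_down:
  assumes \<phi>: "coarse_embedding a b a b K0 C0 \<phi>"
    and K: "K = 2 * K0" and B: "3 \<le> B" and d1: "0 < \<delta>" "4 * K * \<delta> \<le> 1"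
    and Bd: "200 * K^3 \<le> \<delta> * real B" and mu: "32 * K * \<mu> = \<delta>" and eps: "0 \<le> \<epsilon>" "16 * K^2 * \<epsilon> \<le> \<delta>"
    and k0: "10 * K * (K + 1) * real B \<le> \<mu> * real k0" "k0 \<le> k"
    and n: "n = B ^ k" and m: "4 * (n + 1) < mx" and e: "e = \<epsilon> * real n"
    and big: "planeE K e + 3 * e + 20 * c < real n / K"
    and t: "0 < \<theta>" "1 / real my + \<eta> \<le> \<theta> / 10"
    and ivt: "b * real n + a * (6 * K^2 * \<delta> * real n + planeE K e + 20 * c) < a * real n"
    and pack: "(r * (real n + e + 10 * c) + 2) * (2 * exp (a * (r * (e + 5 * c) + 1)) + 2) * (2 * exp (b * (r * (real n + e + 10 * c))) + 2) * real mx \<le> real mx ^ n / 10"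
    and bad: "real (card {(x, y). x \<in> words mx n \<and> y \<in> words my n \<and> \<not> (up e (box_line \<phi> n x y) n \<or> dn e (box_line \<phi> n x y) n)}) \<le> \<eta> * (real (card (words mx n)) * real (card (words my n)))"
  shows "real (card {(x, y). x \<in> words mx n \<and> y \<in> words my n \<and> dn e (box_line \<phi> n x y) n}) \<le> \<theta> * (real (card (words mx n)) * real (card (words my n)))"
proof (rule ccontr)
  assume many: "\<not> ?thesis"
  have K1: "1 \<le> K" using K0 K by simp
  have Kc: "100 * K * c \<le> 1" using c_small by (simp add: K)
  have e0: "0 \<le> e" using eps by (simp add: e)
  have "0 < B ^ k" using B by simp
  then have np: "0 < n" by (simp add: n)
  note pl = box_line_plane[OF \<phi>, of n, folded K]
  \<comment> \<open>By \<open>no_mixed\<close> the words counted here all have the same first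
    digit.\<close>
  have mix: "real (card {y \<in> words my n. dn e (box_line \<phi> n x1 y) n \<and> up e (box_line \<phi> n x y) n}) \<le> 1 / real my * real (card (words my n))"
    if x: "x1 \<in> words mx n" "x \<in> words mx n" for x1 x
  proof -
    have "card {y \<in> words my n. dn e (box_line \<phi> n x1 y) n \<and> up e (box_line \<phi> n x y) n} * my \<le> my ^ n"
    proof (rule card_branch[of _ _ _ 0, OF _ np])
      fix y y' assume y: "y \<in> {y \<in> words my n. dn e (box_line \<phi> n x1 y) n \<and> up e (box_line \<phi> n x y) n}"
        "y' \<in> {y \<in> words my n. dn e (box_line \<phi> n x1 y) n \<and> up e (box_line \<phi> n x y) n}"
      have top: "D (box_line \<phi> n x1 z n) (box_line \<phi> n x z n) \<le> c" for z
        unfolding box_line_def by (rule close[OF \<phi> sol_dist_top[OF x]])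
      show "y ! 0 = y' ! 0"
        using no_mixed[OF pl[of x] pl[of x1] _ _ K1 c1 e0 np _ _ _ _ _ top top big] y by blast
    qed auto
    then have "real (card {y \<in> words my n. dn e (box_line \<phi> n x1 y) n \<and> up e (box_line \<phi> n x y) n} * my) \<le> real (my ^ n)"
      by (simp only: of_nat_le_iff)
    then show ?thesis using my by (simp add: card_words le_divide_eq)
  qed
  have Wy: "words my n \<noteq> {}" using card_words[of my n] my by (metis card.empty less_numeral_extra(3) zero_less_power)
  obtain x1 y1 where x1: "x1 \<in> words mx n" and y1: "y1 \<in> words my n" "dn e (box_line \<phi> n x1 y1) n"
    and cd: "9/10 * real (card (words mx n)) \<le> real (card {x \<in> words mx n. dn e (box_line \<phi> n x y1) n})"
    and c2: "8/10 * real (card (words mx n)) \<le> real (card {x \<in> words mx n. 1 / real my * real (card (words my n))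
        < real (card {y \<in> words my n. dn e (box_line \<phi> n x1 y) n \<and> dn e (box_line \<phi> n x y) n})})"
    using rect_pick[of "words mx n" "words my n" \<theta> "1 / real my" \<eta> "\<lambda>x y. dn e (box_line \<phi> n x y) n" "\<lambda>x y. up e (box_line \<phi> n x y) n",
        OF finite_words finite_words Wy t _ bad mix] many by (auto simp: not_le)
  define Xd where "Xd = {x \<in> words mx n. dn e (box_line \<phi> n x y1) n}"
  define X2 where "X2 = {x \<in> words mx n. 1 / real my * real (card (words my n))
        < real (card {y \<in> words my n. dn e (box_line \<phi> n x1 y) n \<and> dn e (box_line \<phi> n x y) n})}"
  define Y1 where "Y1 = enc (exp (b * r)) y1 / exp (b * r) ^ n"
  have Y1: "0 \<le> Y1" "Y1 \<le> 1" using enc_scaled_01[OF y1(1)] by (auto simp: Y1_def)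
  define q where "q = box_line \<phi> n x1 y1 n"
  define L where "L = fst q / r"
  have topq: "D (box_line \<phi> n x y1 n) q \<le> c" if "x \<in> words mx n" for x
    unfolding box_line_def q_def by (rule close[OF \<phi> sol_dist_top[OF that x1]])
  have bxg: "box_line \<phi> n x y1 (n - t) = \<phi> ((real n - real t) * r, enc (exp (a * r)) x, Y1)" if "t \<le> n" for x t
    using that by (simp add: box_line_def Y1_def of_nat_diff)
  \<comment> \<open>For fixed \<open>y\<close> the lines form a plane when read from the top face
    down, and descending becomes rising. The planes over \<open>Y1\<close> and \<open>Y\<close> meet
    on the bottom face, since both values lie in the unit interval; the starts that
    \<open>parallel_plane_height\<close> compares are on the top face.\<close>
  have tops: "fst (\<phi> (real n * r, enc (exp (a * r)) x, Y)) \<le> r * (L + 6 * K^2 * \<delta> * real n + 2 * c)"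
    if x: "x \<in> words mx n" and Y: "0 \<le> Y" "Y \<le> 1" for x Y
  proof -
    have "fst (\<phi> ((real n - real 0) * r, enc (exp (a * r)) x, Y)) / r
        \<le> fst (\<phi> ((real n - real 0) * r, enc (exp (a * r)) x, Y1)) / r + 6 * K^2 * \<delta> * real n"
    proof (rule parallel_plane_height[OF K1 Kc B d1 Bd mu eps k0 n m box_line_planeX[OF \<phi>, folded K] box_line_planeX[OF \<phi>, folded K], of Y1 Y Xd])
      show "D (\<phi> ((real n - real n) * r, enc (exp (a * r)) y, Y1)) (\<phi> ((real n - real n) * r, enc (exp (a * r)) y, Y)) \<le> c" for y
        using close[OF \<phi> sol_dist_bottom[OF Y1 Y]] by simp
      show "Xd \<subseteq> words mx n" by (auto simp: Xd_def)
      show "card (words mx n) \<le> 2 * card Xd" using cd unfolding Xd_def[symmetric] by linarith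
      show "up (\<epsilon> * real n) (\<lambda>t. \<phi> ((real n - real t) * r, enc (exp (a * r)) y, Y1)) n" if "y \<in> Xd" for y
      proof -
        have "up e (\<lambda>t. box_line \<phi> n y y1 (n - t)) n" using that dn_rev by (simp add: Xd_def)
        then show ?thesis using up_cong[of n "\<lambda>t. box_line \<phi> n y y1 (n - t)"] bxg by (simp add: e)
      qed
    qed (rule x)
    moreover have "box_line \<phi> n x y1 n = \<phi> ((real n - real 0) * r, enc (exp (a * r)) x, Y1)" using bxg[of 0 x] by simp
    ultimately have "fst (\<phi> (real n * r, enc (exp (a * r)) x, Y)) / r \<le> L + 6 * K^2 * \<delta> * real n + 2 * c"
      using h_diff[of "box_line \<phi> n x y1 n" q] topq[OF x] c_nonneg by (simp add: L_def)
    then show ?thesis using r by (simp add: divide_le_eq mult.commute)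
  qed
  \<comment> \<open>The descending translates that start at most \<open>n\<close> above
    \<open>q\<close>. Up to small errors in the exponent, the region in question has
    \<open>exp (b * n * r)\<close> cells, against \<open>exp (a * n * r)\<close> words.\<close>
  define Z where "Z = {x \<in> Xd. fst (box_line \<phi> n x y1 0) / r \<le> L + real n}"
  have cZ: "real (card Z) \<le> real mx ^ n / 10"
  proof -
    have "real (card Z) \<le> (r * (real n + e + 10 * c) + 2) * (2 * exp (a * (r * (e + 5 * c) + 1)) + 2) * (2 * exp (b * (r * (real n + e + 10 * c))) + 2) * real mx"
    proof (rule packing[OF a b _ np, where p = "\<lambda>x. box_line \<phi> n x y1 0" and q = q and L = "r * (L - e - 5 * c)"])
      show "0 \<le> r * (real n + e + 10 * c)" using r e0 c_nonneg by simp
      show "Z \<subseteq> words mx n" by (auto simp: Z_def Xd_def)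
      fix x assume x: "x \<in> Z"
      then have xw: "x \<in> words mx n" and dn: "dn e (box_line \<phi> n x y1) n" and low: "fst (box_line \<phi> n x y1 0) / r \<le> L + real n"
        by (auto simp: Z_def Xd_def)
      define p p' where "p = box_line \<phi> n x y1 0" and "p' = box_line \<phi> n x y1 n"
      have d: "fst p' / r - e \<le> Nr b p p' / r" "Mr a p p' / r \<le> fst p / r + e"
        using dn np unfolding dn_def p_def p'_def by auto
      have dq: "D p' q \<le> c" using topq[OF xw] by (simp add: p'_def)
      have hp': "fst p' / r \<le> fst p / r + e" using M_ge'[of p' p] d by linarith
      have "Mr a p q / r \<le> (fst p / r + e + c) + c"
        by (rule M_trans[of p p']) (use d M_le_D[of p' q] dq hp' c_nonneg in linarith)+
      also have "\<dots> \<le> fst p / r + (e + 5 * c)" using c_nonneg by simp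
      also have "\<dots> = (fst p + r * (e + 5 * c)) / r" using r by (simp add: field_simps)
      finally show "Mr a (box_line \<phi> n x y1 0) q \<le> fst (box_line \<phi> n x y1 0) + r * (e + 5 * c)"
        using r by (simp add: p_def divide_le_cancel)
      have "(L - e - 2 * c) - c \<le> Nr b p q / r"
        by (rule N_trans[of _ p p']) (use d N_ge_D'[of q p'] dq h_diff[of p' q] e0 c_nonneg in \<open>simp_all add: L_def\<close>)
      then have "L - e - 5 * c \<le> Nr b p q / r" using c_nonneg by simp
      then show "r * (L - e - 5 * c) \<le> Nr b (box_line \<phi> n x y1 0) q" using r by (simp add: p_def le_divide_eq mult.commute)
      have "fst p / r \<le> (L - e - 5 * c) + (real n + e + 10 * c)" using low c_nonneg by (simp add: p_def)
      then show "fst (box_line \<phi> n x y1 0) \<le> r * (L - e - 5 * c) + r * (real n + e + 10 * c)"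
        using r by (simp add: p_def divide_le_eq algebra_simps)
    next
      fix x x' assume x: "x \<in> Z" "x' \<in> Z" and sd: "sol_dist a b (box_line \<phi> n x y1 0) (box_line \<phi> n x' y1 0) \<le> 1"
      have w: "x \<in> words mx n" "x' \<in> words mx n" using x by (auto simp: Z_def Xd_def)
      show "take (n - 1) x = take (n - 1) x'"
      proof (rule ccontr)
        assume "take (n - 1) x \<noteq> take (n - 1) x'"
        then obtain i where i: "i < n - 1" "x ! i \<noteq> x' ! i"
          using take_neq_nth[of x n x' "n - 1"] w by (auto simp: words_def)
        then have in1: "i < n" by simp
        have "(real (max n n) - real i - 1) / K - c \<le> D (\<phi> ((real n - real n) * r, enc (exp (a * r)) x, Y1)) (\<phi> ((real n - real n) * r, enc (exp (a * r)) x', Y1))"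
          using planeD(3)[OF box_line_planeX[OF \<phi>, of n Y1, folded K] w in1 order_refl order_refl i(2)] .
        then have "(real n - real i - 1) / K - c \<le> D (box_line \<phi> n x y1 0) (box_line \<phi> n x' y1 0)"
          using bxg[of n x] bxg[of n x'] by simp
        moreover have "D (box_line \<phi> n x y1 0) (box_line \<phi> n x' y1 0) \<le> 1 / r" using sd r by (simp add: D_sol_dist divide_right_mono)
        moreover have "1 / r \<le> 1 / (4 * K0)" using C0 K0 by (intro divide_left_mono) auto
        moreover have "1 / K \<le> (real n - real i - 1) / K" using i K1 by (intro divide_right_mono) linarith+
        moreover have "c \<le> 1 / (200 * K0)" using c_small K0 by (simp add: field_simps)
        moreover obtain u where u: "u = 1 / K0" by blast
        then have "1 / K = u / 2" "1 / (4 * K0) = u / 4" "1 / (200 * K0) = u / 200" "0 < u"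
          using K0 by (auto simp: K)
        ultimately show False by linarith
      qed
    qed
    then show ?thesis using pack by linarith
  qed
  \<comment> \<open>\<open>Xd\<close> and \<open>X2\<close> share at least
    \<open>9/10 + 8/10 - 1\<close> of all words, more than the \<open>1/10\<close> allowed for
    \<open>Z\<close>.\<close>
  have "\<exists>x. x \<in> Xd \<and> x \<in> X2 \<and> x \<notin> Z"
  proof (rule ccontr)
    assume "\<not> ?thesis"
    then have "Xd \<inter> X2 \<subseteq> Z" by blast
    then have "card (Xd \<inter> X2) \<le> card Z" by (intro card_mono) (auto simp: Z_def Xd_def finite_words)
    moreover have "card (Xd \<union> X2) \<le> card (words mx n)" by (intro card_mono finite_words) (auto simp: Xd_def X2_def)
    moreover have "card Xd + card X2 = card (Xd \<union> X2) + card (Xd \<inter> X2)"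
      by (intro card_Un_Int) (auto simp: Xd_def X2_def finite_words)
    moreover have "0 < real mx ^ n" using mx by simp
    moreover have "real (card (words mx n)) = real mx ^ n" by (simp add: card_words)
    ultimately show False using cZ cd[folded Xd_def] c2[folded X2_def] by linarith
  qed
  then obtain x where x: "x \<in> Xd" "x \<in> X2" "x \<notin> Z" by blast
  then have xw: "x \<in> words mx n" and high: "L + real n < fst (box_line \<phi> n x y1 0) / r" by (auto simp: Xd_def Z_def)
  have "\<exists>y\<in>{y \<in> words my n. dn e (box_line \<phi> n x1 y) n \<and> dn e (box_line \<phi> n x y) n}.
      \<exists>y'\<in>{y \<in> words my n. dn e (box_line \<phi> n x1 y) n \<and> dn e (box_line \<phi> n x y) n}. y ! 0 \<noteq> y' ! 0" (is "\<exists>y\<in>?S. \<exists>y'\<in>?S. _")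
  proof (rule ccontr)
    assume no: "\<not> (\<exists>y\<in>?S. \<exists>y'\<in>?S. y ! 0 \<noteq> y' ! 0)"
    have "card ?S * my \<le> my ^ n" by (rule card_branch[of _ _ _ 0, OF _ np]) (use no in auto)
    then have "real (card ?S * my) \<le> real (my ^ n)" by (simp only: of_nat_le_iff)
    then show False using x(2) my by (simp add: X2_def card_words divide_less_eq)
  qed
  then obtain y y' where y: "y \<in> words my n" "y' \<in> words my n" "dn e (box_line \<phi> n x y) n" "dn e (box_line \<phi> n x y') n" "y ! 0 \<noteq> y' ! 0"
    by auto
  define Q Q' where "Q = box_line \<phi> n x y n" and "Q' = box_line \<phi> n x y' n"
  have "fst (box_line \<phi> n x y 0) / r - planeE K e < Mr a Q Q' / r"
    unfolding Q_def Q'_def by (rule split_dn[OF pl y(1,2) K1 c1 e0 np _ y(5,3,4)]) simp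
  moreover have "D (box_line \<phi> n x y 0) (box_line \<phi> n x y1 0) \<le> c" by (rule planeD(2)[OF pl y(1) y1(1)]) auto
  ultimately have "L + real n - c - planeE K e < Mr a Q Q' / r"
    using high h_diff[of "box_line \<phi> n x y 0" "box_line \<phi> n x y1 0"] by linarith
  then have lower: "r * (L + real n - c - planeE K e) < Mr a Q Q'" using r by (simp add: less_divide_eq mult.commute)
  define H where "H = r * (L + 6 * K^2 * \<delta> * real n + 2 * c)"
  \<comment> \<open>\<open>exp (a * w)\<close> is the value of \<open>horizontal_bound\<close> after
    replacing \<open>exp (b * n * r) + 1\<close> by twice the exponential. Against the lower bound
    for \<open>Mr a Q Q'\<close>, this compares \<open>a * n\<close> with \<open>b * n\<close> plus
    errors, which \<open>ivt\<close> decides.\<close>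
  define w where "w = H + C0 + (b * (real n * r) + ln 2) / a"
  have "a * ((b * (real n * r) + ln 2) / a) = b * (real n * r) + ln 2" using a by simp
  then have aw: "a * w = a * (H + C0) + b * (real n * r) + ln 2" unfolding w_def distrib_left[of a "H + C0"] by linarith
  have "\<bar>fst (snd Q) - fst (snd Q')\<bar> \<le> (exp (b * (real n * r)) + 1) * exp (a * (H + C0))"
    unfolding Q_def Q'_def box_line_def
    by (rule horizontal_bound[OF \<phi> a b a b _ _ tops[OF xw, folded H_def]])
      (use K0 r enc_scaled_01[OF y(1)] enc_scaled_01[OF y(2)] in auto)
  also have "\<dots> \<le> (2 * exp (b * (real n * r))) * exp (a * (H + C0))"
    using b r by (intro mult_right_mono) auto
  also have "\<dots> = exp (a * w)"
    unfolding aw by (simp add: exp_add)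
  finally have "\<bar>fst (snd Q) - fst (snd Q')\<bar> \<le> exp (a * w)" .
  moreover have "H \<le> w" using C0 a b r by (simp add: w_def)
  moreover have "fst Q \<le> H" "fst Q' \<le> H"
    unfolding Q_def Q'_def box_line_def H_def using tops[OF xw] enc_scaled_01[OF y(1)] enc_scaled_01[OF y(2)] by auto
  ultimately have "Mr a Q Q' \<le> w" unfolding Mr_le_iff[OF a] by auto
  then have "a * (r * (L + real n - c - planeE K e)) < a * w" using lower a by simp
  also have "a * w = a * H + a * C0 + b * (real n * r) + ln 2" by (simp add: aw distrib_left)
  also have "\<dots> \<le> a * H + a * (c * r) + b * (real n * r) + a * r * c" using ac mult_left_mono[OF C0(2) less_imp_le[OF a]] by linarith
  also have "\<dots> = r * (a * (L + 6 * K^2 * \<delta> * real n + 4 * c) + b * real n)" by (simp add: H_def algebra_simps)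
  finally have "r * (a * (L + real n - c - planeE K e)) < r * (a * (L + 6 * K^2 * \<delta> * real n + 4 * c) + b * real n)"
    by (simp add: mult.left_commute)
  then have "a * (L + real n - c - planeE K e) < a * (L + 6 * K^2 * \<delta> * real n + 4 * c) + b * real n" using r by simp
  moreover have "0 \<le> a * c" using a c_nonneg by simp
  ultimately show False using ivt by (simp add: algebra_simps)
qed

text \<open>Either the bad pairs are few and \<open>down\<close> applies, or their number divided by
  \<open>\<eta>\<close> exceeds the number of all pairs. The estimate is linear in the number of bad
  pairs, so it can be summed over blocks without knowing which blocks are good.\<close>

lemma few_nonup:
  assumes down: "real (card {(x, y). x \<in> X \<and> y \<in> Y \<and> \<not> (P x y \<or> Q x y)}) \<le> \<eta> * (real (card X) * real (card Y)) \<Longrightarrow>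
      real (card {(x, y). x \<in> X \<and> y \<in> Y \<and> Q x y}) \<le> \<theta> * (real (card X) * real (card Y))"
    and fin: "finite X" "finite Y" and eta: "0 < \<eta>" "\<eta> \<le> 1" and theta: "0 \<le> \<theta>"
  shows "real (card {(x, y). x \<in> X \<and> y \<in> Y \<and> \<not> P x y})
      \<le> \<theta> * (real (card X) * real (card Y)) + real (card {(x, y). x \<in> X \<and> y \<in> Y \<and> \<not> (P x y \<or> Q x y)}) / \<eta>"
proof -
  let ?bad = "{(x, y). x \<in> X \<and> y \<in> Y \<and> \<not> (P x y \<or> Q x y)}" and ?dn = "{(x, y). x \<in> X \<and> y \<in> Y \<and> Q x y}"
  let ?n = "{(x, y). x \<in> X \<and> y \<in> Y \<and> \<not> P x y}"
  have XY: "finite (X \<times> Y)" using fin by simp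
  have V0: "0 \<le> real (card X) * real (card Y)" by simp
  have bn: "real (card ?bad) \<le> real (card ?bad) / \<eta>" using eta by (simp add: le_divide_eq mult_left_le)
  show ?thesis
  proof (cases "real (card ?bad) \<le> \<eta> * (real (card X) * real (card Y))")
    case True
    have "card ?n \<le> card (?bad \<union> ?dn)" by (rule card_mono) (auto intro: finite_subset[OF _ XY])
    also have "\<dots> \<le> card ?bad + card ?dn" by (rule card_Un_le)
    finally show ?thesis using down[OF True] bn by linarith
  next
    case False
    have "card ?n \<le> card (X \<times> Y)" by (rule card_mono[OF XY]) auto
    then have "real (card ?n) \<le> real (card X) * real (card Y)" by (simp add: card_cartesian_product flip: of_nat_mult)
    also have "\<dots> \<le> real (card ?bad) / \<eta>" using False eta by (simp add: le_divide_eq mult.commute)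
    finally show ?thesis using mult_nonneg_nonneg[OF theta V0] by linarith
  qed
qed

end

section \<open>From rising blocks to rising lines\<close>

context horo begin

text \<open>A rising block loses no height and any other block loses at most \<open>K * R\<close>,
  so a stretch loses at most \<open>K * R\<close> times its number of bad blocks. Each concatenation
  costs one \<open>c\<close>; in the end \<open>c\<close> must be small against the number of
  blocks.\<close>

lemma weak_up:
  assumes q: "qline K P (nb * R)" and K: "1 \<le> K" and R: "0 < R" and e1: "0 \<le> e1" "2 * e1 \<le> real R / K"
    and G: "real (card {l. l < nb \<and> \<not> up e1 (\<lambda>t. P (l * R + t)) R}) \<le> s"
  shows "up (K * real R * (s + 2) + e1 + (real nb + 2) * c) P (nb * R)"
proof -
  define bad where "bad l \<longleftrightarrow> \<not> up e1 (\<lambda>t. P (l * R + t)) R" for l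
  define H where "H l = h (P (l * R))" for l
  define cnt where "cnt l l' = real (card {i. l \<le> i \<and> i < l' \<and> bad i})" for l l'
  define W where "W = K * real R"
  have W0: "0 \<le> W" using K by (simp add: W_def)
  have cnt_Suc: "cnt l (Suc l') = cnt l l' + (if bad l' then 1 else 0)" if "l \<le> l'" for l l'
  proof (cases "bad l'")
    case True
    have "{i. l \<le> i \<and> i < Suc l' \<and> bad i} = insert l' {i. l \<le> i \<and> i < l' \<and> bad i}" using that True by (auto simp: less_Suc_eq)
    then show ?thesis using True by (simp add: cnt_def)
  next
    case False
    then have "{i. l \<le> i \<and> i < Suc l' \<and> bad i} = {i. l \<le> i \<and> i < l' \<and> bad i}" by (auto simp: less_Suc_eq)
    then show ?thesis using False by (simp add: cnt_def)
  qed
  have bl: "D (P (l * R)) (P (Suc l * R)) \<le> W \<and> (\<not> bad l \<longrightarrow> H l - e1 \<le> N (P (l * R)) (P (Suc l * R)) \<and>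
      M (P (l * R)) (P (Suc l * R)) \<le> H (Suc l) + e1 \<and> H l \<le> H (Suc l))" if "l < nb" for l
  proof -
    have "Suc l * R \<le> nb * R" using that by (intro mult_le_mono1) auto
    then have le: "l * R \<le> nb * R" "Suc l * R \<le> nb * R" using that by auto
    have ab: "\<bar>real (l * R) - real (Suc l * R)\<bar> = real R" by (simp add: algebra_simps)
    have D: "D (P (l * R)) (P (Suc l * R)) \<le> W" "real R / K \<le> D (P (l * R)) (P (Suc l * R))"
      using qlineD[OF q le] unfolding ab W_def by auto
    have "H l - e1 \<le> N (P (l * R)) (P (Suc l * R)) \<and> M (P (l * R)) (P (Suc l * R)) \<le> H (Suc l) + e1" if "\<not> bad l"
      using that upD[of e1 "\<lambda>t. P (l * R + t)" R 0 R] by (simp add: bad_def H_def add.commute)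
    \<comment> \<open>The ends of a block are at least \<open>R / K\<close> apart, and in a rising
      block this distance is the gain in height up to \<open>2 * e1\<close>; so the gain is not
      negative.\<close>
    moreover have "H l \<le> H (Suc l)" if "\<not> bad l" using calculation[OF that] D(2) e1 unfolding D_def by linarith
    ultimately show ?thesis using D(1) by blast
  qed
  have main: "l' \<le> nb \<longrightarrow> H l - W * cnt l l' \<le> H l' \<and>
     H l - W * cnt l l' - e1 - real (l' - l) * c \<le> N (P (l * R)) (P (l' * R)) \<and>
     M (P (l * R)) (P (l' * R)) \<le> H l' + W * cnt l l' + e1 + real (l' - l) * c" if "l \<le> l'" for l l'
    using that
  proof (induction rule: dec_induct)
    case base
    have "{i. l \<le> i \<and> i < l \<and> bad i} = {}" by auto
    then have "cnt l l = 0" unfolding cnt_def by (simp only: card.empty of_nat_0)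
    then show ?case using e1 by (simp add: H_def N_self M_self)
  next
    case (step l')
    show ?case
    proof
      assume le: "Suc l' \<le> nb"
      then have IH: "H l - W * cnt l l' \<le> H l'" "H l - W * cnt l l' - e1 - real (l' - l) * c \<le> N (P (l * R)) (P (l' * R))"
        "M (P (l * R)) (P (l' * R)) \<le> H l' + W * cnt l l' + e1 + real (l' - l) * c" using step by auto
      have b: "D (P (l' * R)) (P (Suc l' * R)) \<le> W" "\<not> bad l' \<longrightarrow> H l' - e1 \<le> N (P (l' * R)) (P (Suc l' * R)) \<and>
        M (P (l' * R)) (P (Suc l' * R)) \<le> H (Suc l') + e1 \<and> H l' \<le> H (Suc l')" using bl[of l'] le by auto
      define k where "k = real (l' - l) * c"
      have k: "real (Suc l' - l) * c = k + c" "0 \<le> k"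
        using step(1) mult_nonneg_nonneg[OF of_nat_0_le_iff[of "l' - l"] c_nonneg]
        by (simp_all add: k_def Suc_diff_le distrib_right)
      define w where "w = W * cnt l l'"
      have w0: "0 \<le> w" using W0 by (simp add: w_def cnt_def)
      define w' where "w' = W * cnt l (Suc l')"
      have w': "w' = (if bad l' then w + W else w)" using step by (simp add: w'_def w_def cnt_Suc distrib_left)
      note IH' = IH[folded k_def w_def]
      have hd: "\<bar>H l' - H (Suc l')\<bar> \<le> W" using h_diff[of "P (l' * R)" "P (Suc l' * R)"] b(1) by (simp add: H_def)
      have Nl: "H l - w' - e1 - k \<le> N (P (l' * R)) (P (Suc l' * R))"
        using b IH'(1) N_ge_D[of "P (l' * R)" "P (Suc l' * R)"] k(2) e1(1) unfolding w' H_def[symmetric] by (auto split: if_splits)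
      have "H l - w' - e1 - k - c \<le> N (P (l * R)) (P (Suc l' * R))"
        by (rule N_trans[OF _ Nl]) (use IH'(2) W0 in \<open>simp add: w'\<close>)
      moreover have Ml: "M (P (l' * R)) (P (Suc l' * R)) \<le> H (Suc l') + w' + e1 + k"
        using b M_le_D'[of "P (l' * R)" "P (Suc l' * R)"] k(2) w0 e1(1) unfolding w' H_def[symmetric] by (auto split: if_splits)
      have "M (P (l * R)) (P (Suc l' * R)) \<le> H (Suc l') + w' + e1 + k + c"
        by (rule M_trans[OF _ Ml]) (use IH'(3) hd b(2) in \<open>auto simp: w'\<close>)
      moreover have "H l - w' \<le> H (Suc l')" using IH'(1) hd b(2) by (auto simp: w')
      ultimately show "H l - W * cnt l (Suc l') \<le> H (Suc l') \<and>
         H l - W * cnt l (Suc l') - e1 - real (Suc l' - l) * c \<le> N (P (l * R)) (P (Suc l' * R)) \<and>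
         M (P (l * R)) (P (Suc l' * R)) \<le> H (Suc l') + W * cnt l (Suc l') + e1 + real (Suc l' - l) * c"
        unfolding k(1) w'_def by linarith
    qed
  qed
  show ?thesis
    unfolding up_def
  proof (intro allI impI)
    fix u t assume ut: "u \<le> t \<and> t \<le> nb * R"
    define l l' where "l = u div R" and "l' = t div R"
    have ll: "l \<le> l'" using ut by (simp add: l_def l'_def div_le_mono)
    have lnb: "l' \<le> nb" using ut R div_le_mono[of t "nb * R" R] by (simp add: l'_def)
    have near: "D (P (v div R * R)) (P v) \<le> W" if "v \<le> nb * R" for v
    proof -
      have v: "v div R * R \<le> v" "v < v div R * R + R" using div_mult_mod_eq[of v R] mod_less_divisor[OF R, of v] by linarith+
      have "D (P (v div R * R)) (P v) \<le> K * \<bar>real (v div R * R) - real v\<bar>"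
        by (rule qlineD(2)[OF q]) (use v that in linarith)+
      also have "\<dots> \<le> K * real R"
      proof (rule mult_left_mono)
        have "real (v div R * R) \<le> real v" "real v \<le> real (v div R * R + R)" using v unfolding of_nat_le_iff by linarith+
        then show "\<bar>real (v div R * R) - real v\<bar> \<le> real R" unfolding of_nat_add by linarith
      qed (use K in linarith)
      finally show ?thesis by (simp add: W_def)
    qed
    have n1: "D (P (l * R)) (P u) \<le> W" and n2: "D (P (l' * R)) (P t) \<le> W"
      using near[of u] near[of t] ut by (auto simp: l_def l'_def)
    have "cnt l l' \<le> s"
    proof -
      have "card {i. l \<le> i \<and> i < l' \<and> bad i} \<le> card {l. l < nb \<and> bad l}" using lnb by (intro card_mono) auto
      then show ?thesis using G by (simp add: cnt_def bad_def)
    qed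
    then have cs: "W * cnt l l' \<le> W * s" using W0 by (rule mult_left_mono)
    have kc: "real (l' - l) * c \<le> real nb * c" using c_nonneg lnb by (intro mult_right_mono) auto
    define Z where "Z = W * s + e1 + real nb * c"
    have Hl: "H l \<le> H l' + Z" "H l - Z \<le> N (P (l * R)) (P (l' * R))" "M (P (l * R)) (P (l' * R)) \<le> H l' + Z"
      using main[OF ll] lnb cs kc e1 mult_nonneg_nonneg[of "real nb" c] c_nonneg unfolding Z_def by linarith+
    have hu: "\<bar>H l - h (P u)\<bar> \<le> W" "\<bar>H l' - h (P t)\<bar> \<le> W"
      using h_diff[of "P (l * R)" "P u"] h_diff[of "P (l' * R)" "P t"] n1 n2 by (auto simp: H_def)
    have Z0: "0 \<le> Z" using Hl(2) N_le[of "P (l * R)" "P (l' * R)"] by (simp add: H_def)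
    have "h (P u) - 2 * W - Z - 2 * c \<le> N (P u) (P t)"
    proof (rule N_trans3[of _ "P u" "P (l * R)" "P (l' * R)" "P t"])
      show "h (P u) - 2 * W - Z \<le> N (P u) (P (l * R))"
        using N_ge_D'[of "P u" "P (l * R)"] n1 N_sym[of "P u" "P (l * R)"] W0 Z0 by linarith
      show "h (P u) - 2 * W - Z \<le> N (P (l * R)) (P (l' * R))" using Hl hu W0 by linarith
      show "h (P u) - 2 * W - Z \<le> N (P (l' * R)) (P t)"
        using N_ge_D[of "P (l' * R)" "P t"] n2 Hl(2) hu N_le'[of "P (l * R)" "P (l' * R)"] unfolding H_def by linarith
    qed
    moreover have "M (P u) (P t) \<le> h (P t) + 2 * W + Z + c + c"
    proof (rule M_trans[OF M_trans[of "P u" "P (l * R)" _ "P (l' * R)"]])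
      show "M (P u) (P (l * R)) \<le> h (P t) + 2 * W + Z"
        using M_le_D[of "P (l * R)" "P u"] n1 M_sym[of "P u" "P (l * R)"] Hl(3) hu M_ge[of "P (l * R)" "P (l' * R)"] unfolding H_def by linarith
      show "M (P (l * R)) (P (l' * R)) \<le> h (P t) + 2 * W + Z" using Hl hu W0 by linarith
      show "M (P (l' * R)) (P t) \<le> h (P t) + 2 * W + Z + c" using M_le_D'[of "P (l' * R)" "P t"] n2 W0 Z0 c_nonneg by linarith
    qed
    moreover have "K * real R * (s + 2) + e1 + (real nb + 2) * c = 2 * W + Z + 2 * c" by (simp add: W_def Z_def algebra_simps)
    ultimately show "h (P u) - (K * real R * (s + 2) + e1 + (real nb + 2) * c) \<le> N (P u) (P t) \<and>
      M (P u) (P t) \<le> h (P t) + (K * real R * (s + 2) + e1 + (real nb + 2) * c)" by linarith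
  qed
qed

end

lemma sum_words_append:
  "(\<Sum>w\<in>words m (i + j). g w) = (\<Sum>u\<in>words m i. \<Sum>v\<in>words m j. g (u @ v))"
proof -
  have "(\<Sum>w\<in>words m (i + j). g w) = (\<Sum>(u, v)\<in>words m i \<times> words m j. g (u @ v))"
  proof (rule sum.reindex_bij_witness[where j = "\<lambda>w. (take i w, drop i w)" and i = "\<lambda>(u, v). u @ v"])
    fix w assume "w \<in> words m (i + j)"
    then show "(take i w, drop i w) \<in> words m i \<times> words m j"
      by (auto simp: words_def dest: in_set_takeD in_set_dropD)
  qed (auto simp: words_def)
  then show ?thesis by (simp add: sum.cartesian_product)
qed

lemma sum_words3:
  "(\<Sum>w\<in>words m (i + R + k). g w) = (\<Sum>p\<in>words m i. \<Sum>s\<in>words m k. \<Sum>v\<in>words m R. g (p @ v @ s))"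
proof -
  have "(\<Sum>w\<in>words m (i + R + k). g w) = (\<Sum>p\<in>words m i. \<Sum>v\<in>words m R. \<Sum>s\<in>words m k. g (p @ v @ s))"
    unfolding sum_words_append by simp
  also have "\<dots> = (\<Sum>p\<in>words m i. \<Sum>s\<in>words m k. \<Sum>v\<in>words m R. g (p @ v @ s))"
    by (intro sum.cong refl sum.swap)
  finally show ?thesis .
qed

text \<open>Isolates the digits that vary inside one block. As \<open>x\<close> is read from the top
  and \<open>y\<close> from the bottom, the outer lengths \<open>i\<close> and \<open>k\<close>
  appear in opposite order.\<close>

lemma sum_box:
  fixes G :: "nat list \<Rightarrow> nat list \<Rightarrow> real"
  shows "(\<Sum>x\<in>words mx (i + R + k). \<Sum>y\<in>words my (k + R + i). G x y)
   = (\<Sum>px\<in>words mx i. \<Sum>sx\<in>words mx k. \<Sum>py\<in>words my k. \<Sum>sy\<in>words my i.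
        \<Sum>x\<in>words mx R. \<Sum>y\<in>words my R. G (px @ x @ sx) (py @ y @ sy))"
proof -
  have "(\<Sum>x\<in>words mx R. \<Sum>py\<in>words my k. \<Sum>sy\<in>words my i. \<Sum>y\<in>words my R. F x py sy y)
      = (\<Sum>py\<in>words my k. \<Sum>sy\<in>words my i. \<Sum>x\<in>words mx R. \<Sum>y\<in>words my R. F x py sy y)" for F :: "nat list \<Rightarrow> nat list \<Rightarrow> nat list \<Rightarrow> nat list \<Rightarrow> real"
    by (subst sum.swap) (intro sum.cong refl sum.swap)
  then show ?thesis unfolding sum_words3 by simp
qed

context sol_box begin

text \<open>Inside a block, a line of the box is a left translate of a line of a small box; the
  outer digits enter only through the translation, and precomposing with it keeps the constants of
  the embedding.\<close>

lemma block_box_line: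
  assumes len: "length px = n - Suc l * R" "length x = R" "length sx = l * R"
    "length py = l * R" "length y = R" "length sy = n - Suc l * R" and n: "Suc l * R \<le> n"
  shows "box_line \<phi> n (px @ x @ sx) (py @ y @ sy) (l * R + t) =
    box_line (\<lambda>p. \<phi> (shift a b (real (l * R) * r)
       (enc (exp (a * r)) px * exp (a * r) ^ (Suc l * R) + enc (exp (a * r)) sx)
       ((enc (exp (b * r)) py * exp (b * r) ^ (n - l * R) + enc (exp (b * r)) sy) / exp (b * r) ^ n) p)) R x y t"
proof -
  define A B where "A = exp (a * r)" and "B = exp (b * r)"
  have B0: "B \<noteq> 0" by (simp add: B_def)
  have ex: "enc A (px @ x @ sx) = exp (a * (real (l * R) * r)) * enc A x + (enc A px * A ^ (Suc l * R) + enc A sx)"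
    using len exp_pow[of a "l * R"] by (simp add: enc_append A_def algebra_simps power_add)
  have e1: "exp (- b * (real (l * R) * r)) = 1 / B ^ (l * R)"
    using exp_pow[of b "l * R"] by (simp add: B_def exp_minus divide_inverse)
  have Bn: "B ^ n = B ^ (l * R) * B ^ R * B ^ (n - Suc l * R)"
    using n by (simp flip: power_add)
  have nl: "n - l * R = R + (n - Suc l * R)" using n by simp
  have "enc B (py @ y @ sy) = enc B y * B ^ (n - Suc l * R) + (enc B py * B ^ (n - l * R) + enc B sy)"
    using len by (simp add: enc_append nl)
  then have "enc B (py @ y @ sy) / B ^ n = enc B y * B ^ (n - Suc l * R) / B ^ n + (enc B py * B ^ (n - l * R) + enc B sy) / B ^ n"
    by (simp add: add_divide_distrib)
  also have "enc B y * B ^ (n - Suc l * R) / B ^ n = exp (- b * (real (l * R) * r)) * (enc B y / B ^ R)"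
    unfolding e1 Bn using B0 by simp
  finally have ey: "enc B (py @ y @ sy) / B ^ n = exp (- b * (real (l * R) * r)) * (enc B y / B ^ R)
      + (enc B py * B ^ (n - l * R) + enc B sy) / B ^ n" .
  have ez: "real (l * R + t) * r = real t * r + real (l * R) * r" by (simp add: algebra_simps)
  show ?thesis
    unfolding box_line_def shift_def A_def[symmetric] B_def[symmetric] ex ey ez by simp
qed

end

lemma card_pairs:
  assumes "finite X" "finite Y"
  shows "real (card {(x, y). x \<in> X \<and> y \<in> Y \<and> P x y}) = (\<Sum>x\<in>X. \<Sum>y\<in>Y. of_bool (P x y))"
proof -
  have "{(x, y). x \<in> X \<and> y \<in> Y \<and> P x y} = (SIGMA x:X. {y \<in> Y. P x y})" by auto
  then have "real (card {(x, y). x \<in> X \<and> y \<in> Y \<and> P x y}) = (\<Sum>x\<in>X. real (card {y \<in> Y. P x y}))"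
    using assms by (simp add: card_SigmaI)
  also have "\<dots> = (\<Sum>x\<in>X. \<Sum>y\<in>Y. of_bool (P x y))"
    using assms by (intro sum.cong refl) (simp add: of_bool_def sum.If_cases Int_def)
  finally show ?thesis .
qed

context sol_box begin

text \<open>For each choice of the outer digits the block is a small box for a translated embedding.
  There \<open>few_nonup\<close> applies, and the result is summed over the outer digits.\<close>

lemma most_blocks_up:
  assumes \<phi>: "coarse_embedding a b a b K0 C0 \<phi>" and n: "n = nb * R" and eta: "0 < \<eta>" "\<eta> \<le> 1" and theta: "0 \<le> \<theta>"
    and few: "\<And>\<phi>'. coarse_embedding a b a b K0 C0 \<phi>' \<Longrightarrow>
      real (card {(x, y). x \<in> words mx R \<and> y \<in> words my R \<and> \<not> (up e (box_line \<phi>' R x y) R \<or> dn e (box_line \<phi>' R x y) R)}) \<le> \<eta> * (real (card (words mx R)) * real (card (words my R))) \<Longrightarrow>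
      real (card {(x, y). x \<in> words mx R \<and> y \<in> words my R \<and> dn e (box_line \<phi>' R x y) R}) \<le> \<theta> * (real (card (words mx R)) * real (card (words my R)))"
    and l: "l < nb"
  shows "(\<Sum>x\<in>words mx n. \<Sum>y\<in>words my n. of_bool (\<not> up e (\<lambda>t. box_line \<phi> n x y (l * R + t)) R))
    \<le> (\<Sum>x\<in>words mx n. \<Sum>y\<in>words my n. \<theta> + of_bool (\<not> (up e (\<lambda>t. box_line \<phi> n x y (l * R + t)) R \<or> dn e (\<lambda>t. box_line \<phi> n x y (l * R + t)) R)) / \<eta>)"
proof -
  define i k where "i = n - Suc l * R" and "k = l * R"
  have le: "Suc l * R \<le> n" unfolding n using l by (intro mult_le_mono1) simp
  have nn: "words mx n = words mx (i + R + k)" "words my n = words my (k + R + i)"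
    using le by (simp_all add: i_def k_def add.commute)
  show ?thesis
    unfolding nn sum_box
  proof (rule sum_mono, rule sum_mono, rule sum_mono, rule sum_mono)
    fix px sx py sy assume p: "px \<in> words mx i" "sx \<in> words mx k" "py \<in> words my k" "sy \<in> words my i"
    define \<phi>' where "\<phi>' = (\<lambda>p. \<phi> (shift a b (real (l * R) * r)
       (enc (exp (a * r)) px * exp (a * r) ^ (Suc l * R) + enc (exp (a * r)) sx)
       ((enc (exp (b * r)) py * exp (b * r) ^ (n - l * R) + enc (exp (b * r)) sy) / exp (b * r) ^ n) p))"
    have q: "coarse_embedding a b a b K0 C0 \<phi>'" unfolding \<phi>'_def by (rule coarse_embedding_shift[OF \<phi> a b])
    have eq: "(\<lambda>t. box_line \<phi> n (px @ x @ sx) (py @ y @ sy) (l * R + t)) = box_line \<phi>' R x y"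
      if "x \<in> words mx R" "y \<in> words my R" for x y
      unfolding \<phi>'_def by (intro ext block_box_line) (use that p le in \<open>auto simp: words_def i_def k_def\<close>)
    have V: "(\<Sum>x\<in>words mx R. \<Sum>y\<in>words my R. \<theta>) = \<theta> * (real (card (words mx R)) * real (card (words my R)))" by simp
    have "(\<Sum>x\<in>words mx R. \<Sum>y\<in>words my R. of_bool (\<not> up e (\<lambda>t. box_line \<phi> n (px @ x @ sx) (py @ y @ sy) (l * R + t)) R))
      = (\<Sum>x\<in>words mx R. \<Sum>y\<in>words my R. of_bool (\<not> up e (box_line \<phi>' R x y) R) :: real)"
      by (intro sum.cong refl) (simp add: eq)
    also have "\<dots> = real (card {(x, y). x \<in> words mx R \<and> y \<in> words my R \<and> \<not> up e (box_line \<phi>' R x y) R})"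
      by (rule card_pairs[symmetric]) (rule finite_words)+
    also have "\<dots> \<le> \<theta> * (real (card (words mx R)) * real (card (words my R))) +
        real (card {(x, y). x \<in> words mx R \<and> y \<in> words my R \<and> \<not> (up e (box_line \<phi>' R x y) R \<or> dn e (box_line \<phi>' R x y) R)}) / \<eta>"
      by (rule few_nonup[OF few[OF q] finite_words finite_words eta theta])
    also have "\<dots> = (\<Sum>x\<in>words mx R. \<Sum>y\<in>words my R. \<theta> + of_bool (\<not> (up e (box_line \<phi>' R x y) R \<or> dn e (box_line \<phi>' R x y) R)) / \<eta>)"
      unfolding card_pairs[OF finite_words finite_words] sum.distrib V sum_divide_distrib by simp
    also have "\<dots> = (\<Sum>x\<in>words mx R. \<Sum>y\<in>words my R. \<theta> + of_bool (\<not> (up e (\<lambda>t. box_line \<phi> n (px @ x @ sx) (py @ y @ sy) (l * R + t)) R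
         \<or> dn e (\<lambda>t. box_line \<phi> n (px @ x @ sx) (py @ y @ sy) (l * R + t)) R)) / \<eta>)"
      by (intro sum.cong refl) (simp add: eq)
    finally show "(\<Sum>x\<in>words mx R. \<Sum>y\<in>words my R. of_bool (\<not> up e (\<lambda>t. box_line \<phi> n (px @ x @ sx) (py @ y @ sy) (l * R + t)) R))
      \<le> (\<Sum>x\<in>words mx R. \<Sum>y\<in>words my R. \<theta> + of_bool (\<not> (up e (\<lambda>t. box_line \<phi> n (px @ x @ sx) (py @ y @ sy) (l * R + t)) R
         \<or> dn e (\<lambda>t. box_line \<phi> n (px @ x @ sx) (py @ y @ sy) (l * R + t)) R)) / \<eta>)" .
  qed
qed

lemma sol_dist_top0:
  assumes "x \<in> words mx n"
  shows "sol_dist a b (real n * r, enc (exp (a * r)) x, Y) (real n * r, 0, Y) \<le> 0"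
proof -
  have "\<bar>enc (exp (a * r)) x\<bar> \<le> exp (a * (real n * r))"
    using enc_bounds[OF mx(2) A1(1) assms] by (simp add: exp_pow)
  then have "Mr a (real n * r, enc (exp (a * r)) x, Y) (real n * r, 0, Y) \<le> real n * r"
    by (simp add: Mr_le_iff[OF a])
  moreover have "real n * r \<le> Nr b (real n * r, enc (exp (a * r)) x, Y) (real n * r, 0, Y)"
    by (simp add: Nr_ge_iff[OF b])
  ultimately show ?thesis by (simp add: sol_dist_def)
qed

text \<open>At a scale given by coarse differentiation almost all blocks are straight, and by
  \<open>few_down\<close> in the small boxes almost all of them rise. Averaging yields an
  \<open>x\<close> for which most lines consist almost entirely of rising blocks, and
  \<open>weak_up\<close> joins these.\<close>

lemma rising_lines:
  assumes \<phi>: "coarse_embedding a b a b K0 C0 \<phi>" and K: "K = 2 * K0"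
    and Bc: "3 \<le> Bc" and d1: "0 < \<delta>" "4 * K * \<delta> \<le> 1" "48 * K^3 * \<delta> \<le> 1"
    and Bd: "200 * K^3 \<le> \<delta> * real Bc" and mu: "32 * K * \<mu> = \<delta>"
    and k0: "10 * K * (K + 1) * real Bc \<le> \<mu> * real k0" "k0 \<le> p" and Bo: "Bo = Bc ^ p" "4 \<le> Bo"
    and eps: "\<epsilon> = 4 * K / real Bo" "16 * K^2 * \<epsilon> \<le> \<delta>"
    and eta: "0 < \<eta>" "\<eta> \<le> 1" and theta: "0 < \<theta>" "1 / real my + \<eta> \<le> \<theta> / 10"
    and kk: "10 * K * (K + 1) * real Bo \<le> \<eta> * \<theta> * real kk"
    and n: "n = Bo ^ Suc kk" and m: "4 * (n + 1) < mx" "4 * (n + 1) < my"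
    and big: "\<And>j. j < kk \<Longrightarrow> planeE K (\<epsilon> * real (Bo ^ Suc j)) + 3 * (\<epsilon> * real (Bo ^ Suc j)) + 20 * c < real (Bo ^ Suc j) / K"
    and ivt: "\<And>j. j < kk \<Longrightarrow> b * real (Bo ^ Suc j) + a * (6 * K^2 * \<delta> * real (Bo ^ Suc j) + planeE K (\<epsilon> * real (Bo ^ Suc j)) + 20 * c) < a * real (Bo ^ Suc j)"
    and pack: "\<And>j. j < kk \<Longrightarrow> (r * (real (Bo ^ Suc j) + (\<epsilon> * real (Bo ^ Suc j)) + 10 * c) + 2) * (2 * exp (a * (r * ((\<epsilon> * real (Bo ^ Suc j)) + 5 * c) + 1)) + 2) *
         (2 * exp (b * (r * (real (Bo ^ Suc j) + (\<epsilon> * real (Bo ^ Suc j)) + 10 * c))) + 2) * real mx \<le> real mx ^ (Bo ^ Suc j) / 10"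
    and epsS: "0 \<le> \<sigma>" "16 * K^2 * \<sigma> \<le> \<delta>" "16 * K * \<sigma> \<le> 1" "32 * K * \<theta> \<le> \<sigma>" "12 * K \<le> \<sigma> * real Bo" "4 \<le> \<sigma> * real Bo" "(real n + 2) * c \<le> 1"
  shows "\<exists>U. U \<subseteq> words my n \<and> card (words my n) \<le> 2 * card U \<and>
    (\<forall>y\<in>U. fst (\<phi> (0, 0, 0)) + r * real n / (4 * K) \<le> fst (\<phi> (real n * r, 0, enc (exp (b * r)) y / exp (b * r) ^ n)))"
proof -
  have K1: "1 \<le> K" using K0 K by simp
  have Kc: "100 * K * c \<le> 1" using c_small by (simp add: K)
  have Bo3: "3 \<le> Bo" using Bo by simp
  have eps0: "0 \<le> \<epsilon>" using K1 eps by simp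
  let ?X = "words mx n" and ?Y = "words my n"
  let ?\<Omega> = "?X \<times> ?Y"
  have ql: "qline K (case \<omega> of (x, y) \<Rightarrow> box_line \<phi> n x y) (Bo ^ Suc kk)" if "\<omega> \<in> ?\<Omega>" for \<omega>
    using that planeD(1)[OF box_line_plane[OF \<phi>, of n, folded K]] unfolding n by auto
  have mp: "0 < \<eta> * \<theta>" using eta theta by simp
  have fO: "finite ?\<Omega>" by (simp add: finite_words)
  obtain j where j: "j < kk" and jb: "real (card {(\<omega>, l). \<omega> \<in> ?\<Omega> \<and> l < Bo ^ (Suc kk - Suc j) \<and>
        \<not> (up (4 * K * real (Bo ^ j)) (\<lambda>t. (case \<omega> of (x, y) \<Rightarrow> box_line \<phi> n x y) (l * Bo ^ Suc j + t)) (Bo ^ Suc j) \<or>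
           dn (4 * K * real (Bo ^ j)) (\<lambda>t. (case \<omega> of (x, y) \<Rightarrow> box_line \<phi> n x y) (l * Bo ^ Suc j + t)) (Bo ^ Suc j))})
     \<le> \<eta> * \<theta> * real (card ?\<Omega>) * real (Bo ^ (Suc kk - Suc j))"
    by (rule coarse_differentiation[of K Bo "\<eta> * \<theta>" kk "Suc kk" ?\<Omega> "\<lambda>\<omega>. case \<omega> of (x, y) \<Rightarrow> box_line \<phi> n x y", OF K1 Bo3 mp kk _ Kc fO ql]) auto
  define R where "R = Bo ^ Suc j"
  define nb where "nb = Bo ^ (Suc kk - Suc j)"
  define e where "e = \<epsilon> * real R"
  have Bop: "0 < Bo" using Bo3 by simp
  have eR: "4 * K * real (Bo ^ j) = e" unfolding e_def R_def eps using Bop by simp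
  have nR: "n = nb * R"
  proof -
    have "Suc kk = (Suc kk - Suc j) + Suc j" using j by simp
    then show ?thesis unfolding n nb_def R_def by (metis power_add)
  qed
  have Rp: "0 < R" using Bop by (simp add: R_def)
  have nbB: "Bo \<le> nb"
    unfolding nb_def using j Bop power_increasing[of 1 "Suc kk - Suc j" Bo] by simp
  have nbp: "0 < nb" using nbB Bop by simp
  define upb where "upb x y l \<longleftrightarrow> up e (\<lambda>t. box_line \<phi> n x y (l * R + t)) R" for x y l
  define dnb where "dnb x y l \<longleftrightarrow> dn e (\<lambda>t. box_line \<phi> n x y (l * R + t)) R" for x y l
  let ?V = "real (card ?X) * real (card ?Y)"
  have bad: "(\<Sum>l<nb. \<Sum>x\<in>?X. \<Sum>y\<in>?Y. of_bool (\<not> (upb x y l \<or> dnb x y l))) \<le> \<eta> * \<theta> * ?V * real nb"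
  proof -
    have "{(\<omega>, l). \<omega> \<in> ?\<Omega> \<and> l < nb \<and>
        \<not> (up e (\<lambda>t. (case \<omega> of (x, y) \<Rightarrow> box_line \<phi> n x y) (l * R + t)) R \<or>
           dn e (\<lambda>t. (case \<omega> of (x, y) \<Rightarrow> box_line \<phi> n x y) (l * R + t)) R)}
      = {(\<omega>, l). \<omega> \<in> ?\<Omega> \<and> l \<in> {..<nb} \<and> \<not> (upb (fst \<omega>) (snd \<omega>) l \<or> dnb (fst \<omega>) (snd \<omega>) l)}"
      by (auto simp: upb_def dnb_def)
    then have "real (card {(\<omega>, l). \<omega> \<in> ?\<Omega> \<and> l \<in> {..<nb} \<and> \<not> (upb (fst \<omega>) (snd \<omega>) l \<or> dnb (fst \<omega>) (snd \<omega>) l)}) \<le> \<eta> * \<theta> * ?V * real nb"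
      using jb unfolding eR R_def[symmetric] nb_def[symmetric] by (simp add: card_cartesian_product)
    also have "real (card {(\<omega>, l). \<omega> \<in> ?\<Omega> \<and> l \<in> {..<nb} \<and> \<not> (upb (fst \<omega>) (snd \<omega>) l \<or> dnb (fst \<omega>) (snd \<omega>) l)})
      = (\<Sum>\<omega>\<in>?\<Omega>. \<Sum>l<nb. of_bool (\<not> (upb (fst \<omega>) (snd \<omega>) l \<or> dnb (fst \<omega>) (snd \<omega>) l)))"
      by (rule card_pairs) (auto simp: finite_words)
    also have "\<dots> = (\<Sum>l<nb. \<Sum>\<omega>\<in>?\<Omega>. of_bool (\<not> (upb (fst \<omega>) (snd \<omega>) l \<or> dnb (fst \<omega>) (snd \<omega>) l)))" by (rule sum.swap)
    also have "\<dots> = (\<Sum>l<nb. \<Sum>x\<in>?X. \<Sum>y\<in>?Y. of_bool (\<not> (upb x y l \<or> dnb x y l)))"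
      by (simp add: sum.cartesian_product case_prod_beta)
    finally show ?thesis .
  qed
  \<comment> \<open>\<open>Bo\<close> is a power of \<open>Bc\<close>, so the block height is also a
    power of the base at which \<open>few_down\<close> works.\<close>
  have few: "real (card {(x, y). x \<in> words mx R \<and> y \<in> words my R \<and> dn e (box_line \<phi>' R x y) R}) \<le> \<theta> * (real (card (words mx R)) * real (card (words my R)))"
    if "coarse_embedding a b a b K0 C0 \<phi>'"
      "real (card {(x, y). x \<in> words mx R \<and> y \<in> words my R \<and> \<not> (up e (box_line \<phi>' R x y) R \<or> dn e (box_line \<phi>' R x y) R)}) \<le> \<eta> * (real (card (words mx R)) * real (card (words my R)))" for \<phi>'
  proof (rule few_down[OF that(1) K Bc d1(1,2) Bd mu eps0 eps(2) k0(1) _ _ _ e_def _ theta _ _ that(2), of "p * Suc j"])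
    show "k0 \<le> p * Suc j" using k0(2) by simp
    show "R = Bc ^ (p * Suc j)" unfolding R_def Bo(1) by (rule power_mult[symmetric])
    have "R \<le> n" unfolding nR using nbp by simp
    then have "4 * (R + 1) \<le> 4 * (n + 1)" by simp
    then show "4 * (R + 1) < mx" using m(1) by (rule le_less_trans)
  qed (use big[OF j] ivt[OF j] pack[OF j] in \<open>simp_all only: e_def R_def\<close>)
  have tot: "(\<Sum>l<nb. \<Sum>x\<in>?X. \<Sum>y\<in>?Y. of_bool (\<not> upb x y l)) \<le> 2 * \<theta> * ?V * real nb"
  proof -
    have "(\<Sum>l<nb. \<Sum>x\<in>?X. \<Sum>y\<in>?Y. of_bool (\<not> upb x y l)) \<le> (\<Sum>l<nb. \<Sum>x\<in>?X. \<Sum>y\<in>?Y. \<theta> + of_bool (\<not> (upb x y l \<or> dnb x y l)) / \<eta>)"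
      unfolding upb_def dnb_def
      by (intro sum_mono[of "{..<nb}"] most_blocks_up[OF \<phi> nR eta less_imp_le[OF theta(1)] few]) auto
    also have "\<dots> = real nb * (?V * \<theta>) + (\<Sum>l<nb. \<Sum>x\<in>?X. \<Sum>y\<in>?Y. of_bool (\<not> (upb x y l \<or> dnb x y l))) / \<eta>"
      by (simp add: sum.distrib sum_divide_distrib)
    also have "\<dots> \<le> real nb * (?V * \<theta>) + (\<eta> * \<theta> * ?V * real nb) / \<eta>"
      using bad eta by (intro add_left_mono divide_right_mono) auto
    also have "\<dots> = 2 * \<theta> * ?V * real nb" using eta by simp
    finally show ?thesis .
  qed
  have "\<exists>x\<in>?X. (\<Sum>l<nb. \<Sum>y\<in>?Y. of_bool (\<not> upb x y l)) \<le> 2 * \<theta> * real (card ?Y) * real nb"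
  proof (rule ccontr)
    assume no: "\<not> ?thesis"
    have "?X \<noteq> {}" using card_words[of mx n] mx by (metis card.empty less_numeral_extra(3) zero_less_power)
    then have "(\<Sum>x\<in>?X. 2 * \<theta> * real (card ?Y) * real nb) < (\<Sum>x\<in>?X. \<Sum>l<nb. \<Sum>y\<in>?Y. of_bool (\<not> upb x y l))"
      using no by (intro sum_strict_mono finite_words) (auto simp: not_le)
    moreover have "(\<Sum>x\<in>?X. \<Sum>l<nb. \<Sum>y\<in>?Y. of_bool (\<not> upb x y l) :: real) = (\<Sum>l<nb. \<Sum>x\<in>?X. \<Sum>y\<in>?Y. of_bool (\<not> upb x y l))"
      by (rule sum.swap)
    ultimately show False using tot by (simp add: mult_ac)
  qed
  then obtain x where x: "x \<in> ?X" "(\<Sum>l<nb. \<Sum>y\<in>?Y. of_bool (\<not> upb x y l)) \<le> 2 * \<theta> * real (card ?Y) * real nb" by blast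
  define s where "s y = real (card {l. l < nb \<and> \<not> upb x y l})" for y
  have s_sum: "s y = (\<Sum>l<nb. of_bool (\<not> upb x y l))" for y
    by (simp add: s_def of_bool_def sum.If_cases Int_def)
  \<comment> \<open>The mean of \<open>s\<close> is at most \<open>2 * \<theta> * nb\<close>, so at
    most a quarter of the words exceed four times this.\<close>
  define U where "U = {y \<in> ?Y. s y \<le> 8 * \<theta> * real nb}"
  have cU: "card ?Y \<le> 2 * card U"
  proof -
    have "(\<Sum>y\<in>?Y. s y) \<le> 2 * \<theta> * real (card ?Y) * real nb"
      using x(2) sum.swap[of "\<lambda>l y. of_bool (\<not> upb x y l) :: real" ?Y "{..<nb}"] by (simp add: s_sum)
    moreover have "real (card (?Y - U)) * (8 * \<theta> * real nb) \<le> (\<Sum>y\<in>?Y - U. s y)"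
      by (rule sum_bounded_below) (auto simp: U_def)
    moreover have "(\<Sum>y\<in>?Y - U. s y) \<le> (\<Sum>y\<in>?Y. s y)"
      by (intro sum_mono2 finite_words) (auto simp: s_def)
    ultimately have "(4 * real (card (?Y - U))) * (2 * \<theta> * real nb) \<le> real (card ?Y) * (2 * \<theta> * real nb)" by (simp add: mult_ac)
    then have "4 * real (card (?Y - U)) \<le> real (card ?Y)"
      by (rule mult_right_le_imp_le) (use theta nbp in simp)
    moreover have "card (?Y - U) = card ?Y - card U" by (rule card_Diff_subset) (auto simp: U_def finite_words)
    moreover have "card U \<le> card ?Y" by (rule card_mono) (auto simp: U_def finite_words)
    ultimately show ?thesis by linarith
  qed
  have Rn: "real Bo * real R \<le> real n" unfolding nR using nbB by (simp add: mult_right_mono)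
  have upU: "up (\<sigma> * real n) (box_line \<phi> n x y) n" if y: "y \<in> U" for y
  proof -
    have yw: "y \<in> ?Y" using y by (simp add: U_def)
    have e1: "0 \<le> e" using eps0 by (simp add: e_def)
    have e2: "e \<le> K * real R"
    proof -
      have "4 \<le> real Bo" using Bo(2) by linarith
      then have "4 * K / real Bo \<le> K" using K1 mult_left_mono[of 4 "real Bo" K] by (simp add: divide_le_eq)
      then have "\<epsilon> \<le> K" by (simp only: eps)
      then show ?thesis unfolding e_def by (rule mult_right_mono) simp
    qed
    have e3: "2 * e \<le> real R / K"
    proof -
      have "0 \<le> planeE K (\<epsilon> * real (Bo ^ Suc j))" using planeE_le(2)[OF K1 e1] by (simp add: e_def R_def)
      then show ?thesis using big[OF j] e1 c_nonneg unfolding e_def R_def by linarith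
    qed
    have "up (K * real R * (8 * \<theta> * real nb + 2) + e + (real nb + 2) * c) (box_line \<phi> n x y) n"
      using weak_up[of K "box_line \<phi> n x y" nb R e "8 * \<theta> * real nb", folded nR] planeD(1)[OF box_line_plane[OF \<phi>, of n x, folded K] yw] y K1 Rp e1 e3
      by (simp add: U_def s_def upb_def)
    moreover have "K * real R * (8 * \<theta> * real nb + 2) + e + (real nb + 2) * c \<le> \<sigma> * real n"
    proof -
      have "32 * K * \<theta> * real n \<le> \<sigma> * real n" using epsS by (intro mult_right_mono) auto
      then have 1: "K * real R * (8 * \<theta> * real nb) \<le> \<sigma> * real n / 4" by (simp add: nR mult_ac)
      have "12 * K * real R \<le> \<sigma> * real Bo * real R" using epsS by (intro mult_right_mono) auto
      also have "\<dots> \<le> \<sigma> * real n" using mult_left_mono[OF Rn epsS(1)] by (simp add: mult_ac)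
      finally have 2: "K * real R * 2 + e \<le> \<sigma> * real n / 4" using e2 by linarith
      have "\<sigma> * real Bo * 1 \<le> \<sigma> * real Bo * real R" using epsS(1) Rp by (intro mult_left_mono) auto
      then have 3: "4 \<le> \<sigma> * real n" using mult_left_mono[OF Rn epsS(1)] epsS(6) by (simp add: mult_ac)
      have "nb \<le> n" unfolding nR using Rp by simp
      then have "(real nb + 2) * c \<le> (real n + 2) * c" using c_nonneg by (intro mult_right_mono) auto
      then have "(real nb + 2) * c \<le> \<sigma> * real n / 4" using epsS(7) 3 by linarith
      moreover have "K * real R * (8 * \<theta> * real nb + 2) = K * real R * (8 * \<theta> * real nb) + K * real R * 2" by (simp add: distrib_left)
      ultimately show ?thesis using 1 2 3 by linarith
    qed
    ultimately show ?thesis unfolding up_def by (meson add_left_mono diff_left_mono order_trans)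
  qed
  \<comment> \<open>The word \<open>x\<close> depends on \<open>\<phi>\<close>, the plane over the
    \<open>x\<close>-coordinate 0 does not. The two planes meet at the top, and
    \<open>parallel_plane_height\<close> keeps the start of the second from being much
    higher.\<close>
  define g0 where "g0 y t = \<phi> (real t * r, 0, enc (exp (b * r)) y / exp (b * r) ^ n)" for y and t :: nat
  have g0: "plane K my n g0" unfolding g0_def K by (rule planeY[OF \<phi> a b K0 C0(2,3,1) refl my(2)])
  have top: "D (box_line \<phi> n x y n) (g0 y n) \<le> c" for y
    unfolding box_line_def g0_def by (rule close[OF \<phi> sol_dist_top0[OF x(1)]])
  have nBc: "n = Bc ^ (p * Suc kk)" unfolding n Bo(1) by (rule power_mult[symmetric])
  have k0p: "k0 \<le> p * Suc kk" using k0(2) by simp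
  have low: "fst (g0 y 0) / r \<le> fst (box_line \<phi> n x y 0) / r + 6 * K^2 * \<delta> * real n" if "y \<in> ?Y" for y
    by (rule parallel_plane_height[OF K1 Kc Bc d1(1,2) Bd mu epsS(1,2) k0(1) k0p nBc m(2) box_line_plane[OF \<phi>, of n x, folded K] g0 top _ cU upU that])
      (auto simp: U_def)
  have "fst (\<phi> (0, 0, 0)) + r * real n / (4 * K) \<le> fst (\<phi> (real n * r, 0, enc (exp (b * r)) y / exp (b * r) ^ n))" if y: "y \<in> U" for y
  proof -
    have yw: "y \<in> ?Y" using y by (simp add: U_def)
    have "D (\<phi> (0, 0, 0)) (g0 y 0) \<le> c"
      unfolding g0_def using close[OF \<phi> sol_dist_bottom[of 0 "enc (exp (b * r)) y / exp (b * r) ^ n" 0]] enc_scaled_01[OF yw] by simp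
    then have 0: "fst (\<phi> (0, 0, 0)) / r \<le> fst (g0 y 0) / r + c" using h_diff[of "\<phi> (0, 0, 0)" "g0 y 0"] by linarith
    have 1: "fst (box_line \<phi> n x y 0) / r + real n / K - 2 * (\<sigma> * real n) \<le> fst (box_line \<phi> n x y n) / r"
      by (rule up_height[OF planeD(1)[OF box_line_plane[OF \<phi>, of n x, folded K] yw] upU[OF y] order_refl])
    have 2: "fst (box_line \<phi> n x y n) / r \<le> fst (g0 y n) / r + c" using h_diff[of "box_line \<phi> n x y n" "g0 y n"] top[of y] by linarith
    define u where "u = real n / K"
    have nu: "real n = K * u" using K1 by (simp add: u_def)
    have u0: "0 \<le> u" using K1 by (simp add: u_def)
    have "48 * K^3 * \<delta> * u \<le> 1 * u" using d1(3) u0 by (rule mult_right_mono)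
    then have 3: "6 * K^2 * \<delta> * real n \<le> u / 8" by (simp add: nu power2_eq_square power3_eq_cube mult_ac)
    have "16 * K * \<sigma> * u \<le> 1 * u" using epsS(3) u0 by (rule mult_right_mono)
    then have 4: "2 * (\<sigma> * real n) \<le> u / 8" by (simp add: nu mult_ac)
    have "4 \<le> \<sigma> * real n"
    proof -
      have "\<sigma> * real Bo * 1 \<le> \<sigma> * real Bo * real R" using epsS(1) Rp by (intro mult_left_mono) auto
      then show ?thesis using mult_left_mono[OF Rn epsS(1)] epsS(6) by (simp add: mult_ac)
    qed
    then have 5: "2 * c \<le> u / 8" using 4 c1 by linarith
    have "fst (\<phi> (0, 0, 0)) / r + u / 4 \<le> fst (g0 y n) / r" using 0 1 2 3 4 5 low[OF yw] u0 unfolding u_def[symmetric] by linarith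
    moreover have "fst (\<phi> (0, 0, 0)) / r + u / 4 = (fst (\<phi> (0, 0, 0)) + r * real n / (4 * K)) / r"
      using r K1 by (simp add: u_def field_simps)
    ultimately show ?thesis using r by (simp add: g0_def divide_le_cancel)
  qed
  then show ?thesis using cU by (intro exI[of _ U]) (auto simp: U_def)
qed

end

section \<open>Choice of the constants\<close>

lemma eventually_linear_le_exp:
  fixes C \<alpha> \<beta> \<gamma> :: real
  assumes "0 < \<gamma>" "0 \<le> C" "0 \<le> \<alpha>" "0 \<le> \<beta>"
  shows "\<forall>\<^sub>F r in at_top. C * (\<alpha> * r + \<beta>) \<le> exp (\<gamma> * r)"
  using eventually_ge_at_top[of "1::real"] eventually_ge_at_top[of "2 * C * (\<alpha> + \<beta>) / \<gamma>^2"]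
proof eventually_elim
  case (elim r)
  have "\<beta> * 1 \<le> \<beta> * r" using elim assms by (intro mult_left_mono) auto
  then have "C * (\<alpha> * r + \<beta>) \<le> C * ((\<alpha> + \<beta>) * r)" using assms by (intro mult_left_mono) (auto simp: distrib_right)
  also have "\<dots> = (2 * C * (\<alpha> + \<beta>)) * r / 2" by simp
  also have "\<dots> \<le> (r * \<gamma>^2) * r / 2"
    using elim assms by (intro divide_right_mono mult_right_mono) (auto simp: divide_le_eq)
  also have "\<dots> = (\<gamma> * r)^2 / 2" by (simp add: power2_eq_square)
  also have "\<dots> \<le> exp (\<gamma> * r)"
  proof -
    have "0 \<le> \<gamma> * r" using elim assms by simp
    then show ?thesis using exp_lower_Taylor_quadratic[of "\<gamma> * r"] by linarith
  qed
  finally show ?case .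
qed

text \<open>On the left stand about \<open>exp ((a * e + b * R + b * e) * r)\<close> cells, up to
  constants and a linear factor; on the right \<open>(exp (a * r) / 4) ^ (R - 1)\<close>, one digit
  being used up by the factor \<open>mx\<close>. Since \<open>r * c = \<kappa>\<close> is fixed,
  \<open>c\<close> contributes constants only.\<close>

lemma pack_bound:
  fixes a b r c e \<kappa> :: real and mx R :: nat
  assumes pos: "0 < a" "0 < b" "0 < r" "0 \<le> \<kappa>" and c: "c = \<kappa> / r" and e: "0 \<le> e" "e \<le> real R" and R: "1 \<le> R"
    and mx: "exp (a * r) / 4 \<le> real mx"
    and le: "160 * 4 ^ (R - 1) * exp (5 * a * \<kappa> + a + 10 * b * \<kappa>) * (2 * real R * r + (10 * \<kappa> + 2)) \<le> exp ((a * (real R - 1) - a * e - b * real R - b * e) * r)"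
  shows "(r * (real R + e + 10 * c) + 2) * (2 * exp (a * (r * (e + 5 * c) + 1)) + 2) * (2 * exp (b * (r * (real R + e + 10 * c))) + 2) * real mx
    \<le> real mx ^ R / 10"
proof -
  have rc: "r * c = \<kappa>" using pos c by simp
  have c0: "0 \<le> c" using pos c by simp
  have E: "2 * exp u + 2 \<le> 4 * exp u" if "0 \<le> u" for u :: real using that one_le_exp_iff[of u] by linarith
  have A: "r * (real R + e + 10 * c) + 2 \<le> 2 * real R * r + (10 * \<kappa> + 2)"
  proof -
    have "r * (real R + e + 10 * c) = real R * r + r * e + 10 * (r * c)" by (simp add: algebra_simps)
    moreover have "r * e \<le> real R * r" using mult_left_mono[OF e(2), of r] pos by (simp add: mult.commute)
    ultimately show ?thesis unfolding rc by linarith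
  qed
  have B: "2 * exp (a * (r * (e + 5 * c) + 1)) + 2 \<le> 4 * exp (a * e * r + (5 * a * \<kappa> + a))"
  proof -
    have "a * (r * (e + 5 * c) + 1) = a * e * r + (5 * a * (r * c) + a)" by (simp add: algebra_simps)
    then have eq: "a * (r * (e + 5 * c) + 1) = a * e * r + (5 * a * \<kappa> + a)" unfolding rc .
    show ?thesis unfolding eq by (rule E) (use pos e in simp)
  qed
  have C: "2 * exp (b * (r * (real R + e + 10 * c))) + 2 \<le> 4 * exp ((b * real R + b * e) * r + 10 * b * \<kappa>)"
  proof -
    have "b * (r * (real R + e + 10 * c)) = (b * real R + b * e) * r + 10 * b * (r * c)" by (simp add: algebra_simps)
    then have eq: "b * (r * (real R + e + 10 * c)) = (b * real R + b * e) * r + 10 * b * \<kappa>" unfolding rc .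
    show ?thesis unfolding eq by (rule E) (use pos e in simp)
  qed
  have "(r * (real R + e + 10 * c) + 2) * (2 * exp (a * (r * (e + 5 * c) + 1)) + 2) * (2 * exp (b * (r * (real R + e + 10 * c))) + 2)
    \<le> (2 * real R * r + (10 * \<kappa> + 2)) * (4 * exp (a * e * r + (5 * a * \<kappa> + a))) * (4 * exp ((b * real R + b * e) * r + 10 * b * \<kappa>))"
    using A B C pos e c0 by (intro mult_mono) auto
  also have "\<dots> = (160 * 4 ^ (R - 1) * exp (5 * a * \<kappa> + a + 10 * b * \<kappa>) * (2 * real R * r + (10 * \<kappa> + 2))) * exp ((a * e + b * real R + b * e) * r) / (10 * 4 ^ (R - 1))"
  proof -
    have eq: "(a * e + b * real R + b * e) * r = a * e * r + (b * real R + b * e) * r" by (simp add: algebra_simps)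
    show ?thesis unfolding eq exp_add by simp
  qed
  also have "\<dots> \<le> exp ((a * (real R - 1) - a * e - b * real R - b * e) * r) * exp ((a * e + b * real R + b * e) * r) / (10 * 4 ^ (R - 1))"
    using le by (intro divide_right_mono mult_right_mono) auto
  also have "\<dots> = exp (a * r) ^ (R - 1) / (10 * 4 ^ (R - 1))"
  proof -
    have "exp (a * r) ^ (R - 1) = exp (a * (real R - 1) * r)" using R by (simp add: exp_of_nat_mult[symmetric] of_nat_diff mult_ac)
    moreover have "(a * (real R - 1) - a * e - b * real R - b * e) * r + (a * e + b * real R + b * e) * r = a * (real R - 1) * r"
      by (simp add: algebra_simps)
    ultimately show ?thesis by (simp flip: exp_add)
  qed
  also have "\<dots> = (exp (a * r) / 4) ^ (R - 1) / 10" by (simp add: power_divide)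
  also have "\<dots> \<le> real mx ^ (R - 1) / 10" using mx by (intro divide_right_mono power_mono) auto
  finally have "(r * (real R + e + 10 * c) + 2) * (2 * exp (a * (r * (e + 5 * c) + 1)) + 2) * (2 * exp (b * (r * (real R + e + 10 * c))) + 2) * real mx
    \<le> real mx ^ (R - 1) / 10 * real mx" by (rule mult_right_mono) simp
  also have "\<dots> = real mx ^ R / 10" using R by (cases R) auto
  finally show ?thesis .
qed

lemma branching:
  fixes u :: real
  assumes "2 \<le> u"
  obtains m :: nat where "0 < m" "2 * real m \<le> exp u + 1" "exp u / 4 \<le> real m"
proof -
  have eu: "2 \<le> exp u" using exp_ge_add_one_self[of u] assms by linarith
  define m where "m = nat \<lfloor>(exp u + 1) / 2\<rfloor>"
  have "real m = of_int \<lfloor>(exp u + 1) / 2\<rfloor>" using eu by (simp add: m_def)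
  then have "real m \<le> (exp u + 1) / 2" "(exp u + 1) / 2 < real m + 1" by linarith+
  then have *: "1 / 2 < real m" "2 * real m \<le> exp u + 1" "exp u / 4 \<le> real m" using eu by (simp_all add: field_simps)
  then have "0 < m" by (cases m) auto
  then show ?thesis using * that by blast
qed

lemma ex_nat_ge: "\<exists>N::nat. x \<le> real N" by (rule real_arch_simple)

lemma ex_nat_mult_ge:
  fixes x y :: real
  assumes "0 < y" shows "\<exists>N::nat. x \<le> y * real N"
  using real_arch_simple[of "x / y"] assms by (simp add: divide_le_eq mult.commute)

text \<open>The constants are chosen in the order \<open>\<delta>\<close>, \<open>Bc\<close>, \<open>\<sigma>\<close>, \<open>\<theta>\<close>, \<open>\<eta>\<close>, \<open>Bo\<close>, \<open>n\<close>, and last the unit of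
  height \<open>r\<close>, so that \<open>c\<close> is small and the numbers of digits are large compared with \<open>n\<close>.\<close>

theorem mostly_rising:
  fixes a b K0 C0 s0 :: real
  assumes b: "0 < b" and ba: "b < a" and K0: "1 \<le> K0" and C0: "0 \<le> C0"
  shows "\<exists>(I :: nat list set) q. finite I \<and> I \<noteq> {} \<and>
    (\<forall>\<phi>. coarse_embedding a b a b K0 C0 \<phi> \<longrightarrow> card I \<le> 2 * card {i \<in> I. fst (\<phi> (0, 0, 0)) + s0 \<le> fst (\<phi> (q i))})"
proof -
  have a: "0 < a" using b ba by simp
  define K where "K = 2 * K0"
  have K: "2 \<le> K" "1 \<le> K" "0 < K" using K0 by (auto simp: K_def)
  \<comment> \<open>The first bound keeps the error \<open>6 * K^2 * \<delta> * n\<close> of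
    \<open>parallel_plane_height\<close> below the climb \<open>n / K\<close>; the second keeps its
    multiple by \<open>a\<close> below the margin \<open>(a - b) * n\<close> of
    \<open>few_down\<close>.\<close>
  define \<delta> where "\<delta> = min (1 / (100 * K^3)) ((a - b) / (100 * K^2 * a))"
  have dp: "0 < \<delta>" using K a ba by (simp add: \<delta>_def)
  have d1: "100 * K^3 * \<delta> \<le> 1"
  proof -
    have "100 * K^3 * \<delta> \<le> 100 * K^3 * (1 / (100 * K^3))" unfolding \<delta>_def using K by (intro mult_left_mono) auto
    then show ?thesis using K by simp
  qed
  have d2: "100 * K^2 * a * \<delta> \<le> a - b"
  proof -
    have "100 * K^2 * a * \<delta> \<le> 100 * K^2 * a * ((a - b) / (100 * K^2 * a))" unfolding \<delta>_def using K a by (intro mult_left_mono) auto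
    then show ?thesis using K a by simp
  qed
  have Kp: "1 \<le> K^2" "1 \<le> K^3" "K \<le> K^3" "K^2 \<le> K^3" "K \<le> K^2"
    using K(2) power_increasing[of 1 3 K] power_increasing[of 2 3 K] power_increasing[of 1 2 K] by auto
  have d4: "4 * K * \<delta> \<le> 1"
  proof -
    have "K * \<delta> \<le> K^3 * \<delta>" using Kp dp by (intro mult_right_mono) auto
    then show ?thesis using d1 dp Kp by linarith
  qed
  have d5: "\<delta> \<le> 1"
  proof -
    have "1 * \<delta> \<le> K^3 * \<delta>" using Kp dp by (intro mult_right_mono) auto
    then show ?thesis using d1 dp by linarith
  qed
  obtain Bc0 :: nat where "200 * K^3 \<le> \<delta> * real Bc0" using ex_nat_mult_ge[OF dp] by blast
  define Bc where "Bc = max 3 Bc0"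
  have Bc: "3 \<le> Bc" "200 * K^3 \<le> \<delta> * real Bc"
  proof -
    show "3 \<le> Bc" by (simp add: Bc_def)
    have "\<delta> * real Bc0 \<le> \<delta> * real Bc" using dp by (intro mult_left_mono) (auto simp: Bc_def)
    then show "200 * K^3 \<le> \<delta> * real Bc" using \<open>200 * K^3 \<le> \<delta> * real Bc0\<close> by linarith
  qed
  define \<mu> where "\<mu> = \<delta> / (32 * K)"
  have mu: "32 * K * \<mu> = \<delta>" "0 < \<mu>" using K dp by (auto simp: \<mu>_def)
  obtain k0 :: nat where k0: "10 * K * (K + 1) * real Bc \<le> \<mu> * real k0" using ex_nat_mult_ge[OF mu(2)] by blast
  define \<sigma> where "\<sigma> = \<delta> / (16 * K^2)"
  have sp: "0 < \<sigma>" "16 * K^2 * \<sigma> = \<delta>" using K dp by (auto simp: \<sigma>_def)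
  have s1: "16 * K * \<sigma> \<le> 1"
  proof -
    have "16 * K * \<sigma> \<le> 16 * K^2 * \<sigma>" using Kp sp by (intro mult_right_mono) auto
    then show ?thesis using sp d5 by linarith
  qed
  define \<theta> where "\<theta> = \<sigma> / (32 * K)"
  have tp: "0 < \<theta>" "32 * K * \<theta> = \<sigma>" using K sp by (auto simp: \<theta>_def)
  have t1: "\<theta> \<le> 1"
  proof -
    have "1 * \<theta> \<le> 32 * K * \<theta>" using K tp by (intro mult_right_mono) auto
    moreover have "1 * \<sigma> \<le> 16 * K * \<sigma>" using K sp by (intro mult_right_mono) auto
    ultimately show ?thesis using tp s1 by linarith
  qed
  define \<eta> where "\<eta> = \<theta> / 20"
  have ep: "0 < \<eta>" "\<eta> \<le> 1" using tp t1 by (auto simp: \<eta>_def)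
  \<comment> \<open>All lower bounds on \<open>Bo\<close> at once. Each summand is solved from a
    condition that holds for large \<open>Bo\<close>; the first, for example, from
    \<open>16 * K^2 * \<epsilon> \<le> \<delta>\<close>.\<close>
  define Q where "Q = 64 * K^3 / \<delta> + 100 * K^4 + 100 * K^3 * a / (a - b) + 12 * K / \<sigma> + 4 / \<sigma> + 16 * K * (a + b) / (a - b) + 4"
  obtain N1 :: nat where N1: "Q \<le> real N1" using ex_nat_ge by blast
  define p where "p = max k0 N1"
  define Bo where "Bo = Bc ^ p"
  have "real N1 \<le> real Bo"
  proof -
    have "N1 \<le> p" by (simp add: p_def)
    also have "p < 2 ^ p" by (rule less_exp)
    also have "(2::nat) ^ p \<le> Bc ^ p" using Bc by (intro power_mono) auto
    finally show ?thesis by (simp add: Bo_def)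
  qed
  then have QB: "Q \<le> real Bo" using N1 by linarith
  have nonneg: "0 \<le> 64 * K^3 / \<delta>" "0 \<le> 100 * K^4" "0 \<le> 100 * K^3 * a / (a - b)" "0 \<le> 12 * K / \<sigma>" "0 \<le> 4 / \<sigma>" "0 \<le> 16 * K * (a + b) / (a - b)"
    using K dp sp a b ba by auto
  have Bo1: "64 * K^3 / \<delta> \<le> real Bo" "100 * K^4 \<le> real Bo" "100 * K^3 * a / (a - b) \<le> real Bo" "12 * K / \<sigma> \<le> real Bo" "4 / \<sigma> \<le> real Bo"
      "16 * K * (a + b) / (a - b) \<le> real Bo" "4 \<le> real Bo"
    using QB nonneg unfolding Q_def by linarith+
  have Bo4: "4 \<le> Bo" using Bo1(7) by linarith
  have Bop: "0 < real Bo" using Bo1(7) by linarith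
  define \<epsilon> where "\<epsilon> = 4 * K / real Bo"
  have eps0: "0 < \<epsilon>" using K Bop by (simp add: \<epsilon>_def)
  have epsd: "16 * K^2 * \<epsilon> \<le> \<delta>"
  proof -
    have "64 * K^3 \<le> \<delta> * real Bo" using Bo1(1) dp by (simp add: divide_le_eq mult.commute)
    moreover have "16 * K^2 * \<epsilon> = 64 * K^3 / real Bo" by (simp add: \<epsilon>_def power2_eq_square power3_eq_cube)
    ultimately show ?thesis using Bop by (simp add: divide_le_eq)
  qed
  have eps1: "\<epsilon> \<le> 1"
  proof -
    have "K \<le> K^4" using K(2) power_increasing[of 1 4 K] by simp
    then have "4 * K \<le> real Bo" using Bo1(2) K by linarith
    then show ?thesis using Bop by (simp add: \<epsilon>_def divide_le_eq)
  qed
  have eab: "(a + b) * \<epsilon> \<le> (a - b) / 4"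
  proof -
    have "16 * K * (a + b) \<le> (a - b) * real Bo" using Bo1(6) ba by (simp add: divide_le_eq mult.commute)
    then show ?thesis using Bop by (simp add: \<epsilon>_def field_simps)
  qed
  have aB: "100 * K^3 * a \<le> (a - b) * real Bo" using Bo1(3) ba by (simp add: divide_le_eq mult.commute)
  have "0 < \<eta> * \<theta>" using ep tp by simp
  then obtain kk :: nat where kk: "10 * K * (K + 1) * real Bo \<le> \<eta> * \<theta> * real kk" using ex_nat_mult_ge by blast
  define n where "n = Bo ^ Suc kk"
  \<comment> \<open>The value of \<open>c * r\<close>: it covers the ultrametric errors and
    \<open>C0\<close>, while \<open>c = \<kappa> / r\<close> tends to 0 as \<open>r\<close>
    grows.\<close>
  define \<kappa> where "\<kappa> = ln 2 / a + ln 2 / b + C0"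
  have kap: "0 \<le> \<kappa>" "C0 \<le> \<kappa>" "ln 2 \<le> a * \<kappa>" "ln 2 \<le> b * \<kappa>"
  proof -
    have l: "0 \<le> ln 2 / a" "0 \<le> ln 2 / b" using a b by auto
    then show "0 \<le> \<kappa>" "C0 \<le> \<kappa>" using C0 by (auto simp: \<kappa>_def)
    have "a * (ln 2 / a) \<le> a * \<kappa>" "b * (ln 2 / b) \<le> b * \<kappa>" using l C0 a b by (intro mult_left_mono; simp add: \<kappa>_def)+
    then show "ln 2 \<le> a * \<kappa>" "ln 2 \<le> b * \<kappa>" using a b by auto
  qed
  define R where "R j = Bo ^ Suc j" for j
  have RB: "real Bo \<le> real (R j)" for j
    unfolding R_def using Bo4 power_increasing[of 1 "Suc j" Bo] by (simp only: of_nat_le_iff) simp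
  \<comment> \<open>The exponent in \<open>pack_bound\<close>. It is positive because, for
    \<open>R j \<ge> Bo\<close>, both the lost digit \<open>a\<close> and the
    \<open>\<epsilon>\<close>-terms are small against \<open>(a - b) * R j\<close>.\<close>
  have gam: "0 < a * (real (R j) - 1) - a * (\<epsilon> * real (R j)) - b * real (R j) - b * (\<epsilon> * real (R j))" for j
  proof -
    have "(a + b) * \<epsilon> * real (R j) \<le> (a - b) / 4 * real (R j)" using eab by (rule mult_right_mono) simp
    moreover have "(a - b) * real Bo \<le> (a - b) * real (R j)" using RB ba by (intro mult_left_mono) auto
    moreover have "1 * a \<le> K^3 * a" using Kp a by (intro mult_right_mono) auto
    moreover define g where "g = (a - b) * real (R j)"
    moreover have "a * (real (R j) - 1) - a * (\<epsilon> * real (R j)) - b * real (R j) - b * (\<epsilon> * real (R j)) = g - a - (a + b) * \<epsilon> * real (R j)"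
      by (simp add: g_def algebra_simps)
    moreover have "(a - b) / 4 * real (R j) = g / 4" by (simp add: g_def)
    ultimately show ?thesis using aB a by linarith
  qed
  have ev: "\<forall>\<^sub>F r in at_top. \<forall>j\<in>{..<kk}. 160 * 4 ^ (R j - 1) * exp (5 * a * \<kappa> + a + 10 * b * \<kappa>) * (2 * real (R j) * r + (10 * \<kappa> + 2))
      \<le> exp ((a * (real (R j) - 1) - a * (\<epsilon> * real (R j)) - b * real (R j) - b * (\<epsilon> * real (R j))) * r)"
    using kap by (intro eventually_ball_finite ballI eventually_linear_le_exp gam) auto
  \<comment> \<open>Sum of the explicit lower bounds on \<open>r\<close>; the last one makes the
    final climb exceed \<open>s0\<close>. The remaining condition \<open>ev\<close> concerns
    finitely many \<open>j\<close>, so one \<open>r\<close> serves all.\<close>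
  define r0 where "r0 = 1 + 2 * K0 * C0 + 4 * K0 + 200 * K0 * \<kappa> + (real n + 2) * \<kappa> + 20 * \<kappa> + 20 * (real n + 1) / a + 20 * (real n + 1) / b + 80 / (\<theta> * b) + 4 * K * \<bar>s0\<bar>"
  obtain r where r: "r0 \<le> r" and rpack: "\<And>j. j < kk \<Longrightarrow> 160 * 4 ^ (R j - 1) * exp (5 * a * \<kappa> + a + 10 * b * \<kappa>) * (2 * real (R j) * r + (10 * \<kappa> + 2))
      \<le> exp ((a * (real (R j) - 1) - a * (\<epsilon> * real (R j)) - b * real (R j) - b * (\<epsilon> * real (R j))) * r)"
    using eventually_happens'[OF _ eventually_conj[OF eventually_ge_at_top[of r0] ev]] by auto
  have nn: "0 \<le> 2 * K0 * C0" "0 \<le> 4 * K0" "0 \<le> 200 * K0 * \<kappa>" "0 \<le> (real n + 2) * \<kappa>" "0 \<le> 20 * \<kappa>" "0 \<le> 20 * (real n + 1) / a" "0 \<le> 20 * (real n + 1) / b" "0 \<le> 80 / (\<theta> * b)" "0 \<le> 4 * K * \<bar>s0\<bar>"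
    using K0 C0 kap a b tp K by auto
  have r1: "1 \<le> r" "2 * K0 * C0 \<le> r" "4 * K0 \<le> r" "200 * K0 * \<kappa> \<le> r" "(real n + 2) * \<kappa> \<le> r" "20 * \<kappa> \<le> r" "20 * (real n + 1) / a \<le> r" "20 * (real n + 1) / b \<le> r" "80 / (\<theta> * b) \<le> r" "4 * K * \<bar>s0\<bar> \<le> r"
    using r nn unfolding r0_def by linarith+
  have rp: "0 < r" using r1(1) by linarith
  define c where "c = \<kappa> / r"
  have cr: "c * r = \<kappa>" using rp by (simp add: c_def)
  have c20: "20 * c \<le> 1" "200 * K0 * c \<le> 1" "(real n + 2) * c \<le> 1" using r1 rp by (simp_all add: c_def divide_le_eq)
  have ar: "20 * (real n + 1) \<le> a * r" "20 * (real n + 1) \<le> b * r" "80 / \<theta> \<le> b * r"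
    using r1(7,8,9) a b tp by (simp_all add: divide_le_eq mult.commute mult.left_commute)
  have n0: "0 \<le> real n" by simp
  have ar2: "2 \<le> a * r" "2 \<le> b * r" using ar n0 unfolding distrib_left by - (linarith+)
  obtain mx :: nat where mxx: "0 < mx" "2 * real mx \<le> exp (a * r) + 1" "exp (a * r) / 4 \<le> real mx" by (rule branching[OF ar2(1)])
  obtain my :: nat where myy: "0 < my" "2 * real my \<le> exp (b * r) + 1" "exp (b * r) / 4 \<le> real my" by (rule branching[OF ar2(2)])
  have mm: "4 * (n + 1) < mx" "4 * (n + 1) < my"
  proof -
    have "4 * (real n + 1) < real mx" "4 * (real n + 1) < real my"
      using mxx(3) myy(3) exp_ge_add_one_self[of "a * r"] exp_ge_add_one_self[of "b * r"] ar n0 unfolding distrib_left by - (linarith+)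
    then have "real (4 * (n + 1)) < real mx" "real (4 * (n + 1)) < real my" by simp_all
    then show "4 * (n + 1) < mx" "4 * (n + 1) < my" by (simp_all only: of_nat_less_iff)
  qed
  interpret sol_box a b r c K0 C0 mx my
  proof
    show "0 < a" "0 < b" "0 < r" "1 \<le> K0" "0 \<le> C0" by fact+
    show "ln 2 \<le> a * r * c" "ln 2 \<le> b * r * c" using kap cr by (simp_all add: mult_ac)
    show "C0 \<le> c * r" using kap cr by simp
  qed (use r1 c20 mxx myy in auto)
  have my20: "1 / real my + \<eta> \<le> \<theta> / 10"
  proof -
    have "80 / \<theta> \<le> 4 * real my" using myy(3) exp_ge_add_one_self[of "b * r"] ar(3) by linarith
    then have "20 \<le> \<theta> * real my" using tp by (simp add: divide_le_eq mult.commute)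
    then have "1 / real my \<le> \<theta> / 20" using myy by (simp add: field_simps)
    then show ?thesis by (simp add: \<eta>_def)
  qed
  define I where "I = words my n"
  \<comment> \<open>Points of the top face over \<open>x = 0\<close>. \<open>\<phi>\<close> is fixed
    only after \<open>I\<close> and \<open>q\<close>.\<close>
  define q where "q y = (real n * r, 0::real, enc (exp (b * r)) y / exp (b * r) ^ n)" for y
  have "card I \<le> 2 * card {i \<in> I. fst (\<phi> (0, 0, 0)) + s0 \<le> fst (\<phi> (q i))}" if \<phi>: "coarse_embedding a b a b K0 C0 \<phi>" for \<phi>
  proof -
    have Rp: "1 \<le> R j" "0 < real (R j)" for j using RB[of j] Bo4 by linarith+
    have eR: "planeE K (\<epsilon> * real (R j)) \<le> 8 * K^3 * (real (R j) / real Bo) + 5 * K^3" for j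
    proof -
      have "0 \<le> \<epsilon> * real (R j)" using eps0 by simp
      moreover have "2 * K^2 * (\<epsilon> * real (R j)) = 8 * K^3 * (real (R j) / real Bo)"
        by (simp add: \<epsilon>_def power2_eq_square power3_eq_cube)
      ultimately show ?thesis using planeE_le(1)[OF K(2), of "\<epsilon> * real (R j)"] by linarith
    qed
    have RK: "100 * K^4 * (real (R j) / real Bo) \<le> real (R j)" for j
      using mult_right_mono[OF Bo1(2), of "real (R j) / real Bo"] Bop by simp
    have big: "planeE K (\<epsilon> * real (R j)) + 3 * (\<epsilon> * real (R j)) + 20 * c < real (R j) / K" for j
    proof -
      define u where "u = real (R j) / real Bo"
      have u1: "1 \<le> u" using RB[of j] Bop by (simp add: u_def)
      have "3 * (\<epsilon> * real (R j)) = 12 * K * u" by (simp add: \<epsilon>_def u_def)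
      moreover have "K * u \<le> K^3 * u" using Kp u1 by (intro mult_right_mono) auto
      moreover have "K^3 * 1 \<le> K^3 * u" using K u1 by (intro mult_left_mono) auto
      ultimately have "planeE K (\<epsilon> * real (R j)) + 3 * (\<epsilon> * real (R j)) + 20 * c \<le> 30 * (K^3 * u)"
        using eR[of j] c20 Kp unfolding u_def[symmetric] by linarith
      moreover have "100 * (K^3 * u) * K \<le> real (R j)"
        using RK[of j] unfolding u_def[symmetric] by (simp add: power3_eq_cube power4_eq_xxxx mult_ac)
      then have "100 * (K^3 * u) \<le> real (R j) / K" using K by (simp add: le_divide_eq)
      moreover have "0 < K^3 * u" using K u1 by simp
      ultimately show ?thesis by linarith
    qed
    have ivt: "b * real (R j) + a * (6 * K^2 * \<delta> * real (R j) + planeE K (\<epsilon> * real (R j)) + 20 * c) < a * real (R j)" for j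
    proof -
      define u where "u = real (R j) / real Bo"
      have u1: "1 \<le> u" using RB[of j] Bop by (simp add: u_def)
      have Ru: "real (R j) = real Bo * u" using Bop by (simp add: u_def)
      have "K^3 * 1 \<le> K^3 * u" using K u1 by (intro mult_left_mono) auto
      then have "planeE K (\<epsilon> * real (R j)) + 20 * c \<le> 14 * (K^3 * u)"
        using eR[of j] c20 Kp unfolding u_def[symmetric] by linarith
      then have 1: "a * (planeE K (\<epsilon> * real (R j)) + 20 * c) \<le> a * (14 * (K^3 * u))" using a by (intro mult_left_mono) auto
      have "100 * K^3 * a * u \<le> (a - b) * real Bo * u" using aB u1 by (intro mult_right_mono) auto
      then have 2: "100 * (a * (K^3 * u)) \<le> (a - b) * real (R j)" unfolding Ru by (simp add: mult_ac)
      have 3: "100 * (a * (K^2 * \<delta> * real (R j))) \<le> (a - b) * real (R j)"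
        using mult_right_mono[OF d2, of "real (R j)"] by (simp add: mult_ac)
      have "0 < (a - b) * real (R j)" using ba Rp by simp
      moreover have "a * (6 * K^2 * \<delta> * real (R j) + planeE K (\<epsilon> * real (R j)) + 20 * c)
          = 6 * (a * (K^2 * \<delta> * real (R j))) + a * (planeE K (\<epsilon> * real (R j)) + 20 * c)" by (simp add: algebra_simps)
      moreover have "a * real (R j) = b * real (R j) + (a - b) * real (R j)" by (simp add: algebra_simps)
      moreover have "a * (14 * (K^3 * u)) = 14 * (a * (K^3 * u))" by simp
      ultimately show ?thesis using 1 2 3 by linarith
    qed
    have pack: "(r * (real (R j) + (\<epsilon> * real (R j)) + 10 * c) + 2) * (2 * exp (a * (r * ((\<epsilon> * real (R j)) + 5 * c) + 1)) + 2) *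
         (2 * exp (b * (r * (real (R j) + (\<epsilon> * real (R j)) + 10 * c))) + 2) * real mx \<le> real mx ^ (R j) / 10" if "j < kk" for j
      by (rule pack_bound[OF a b rp kap(1) c_def _ _ Rp(1) mxx(3) rpack[OF that]])
        (use eps0 eps1 Rp in \<open>simp_all add: mult_le_cancel_right1\<close>)
    have d48: "48 * K^3 * \<delta> \<le> 1"
    proof -
      have "0 \<le> K^3 * \<delta>" using K dp by simp
      then show ?thesis using d1 by linarith
    qed
    have sB: "12 * K \<le> \<sigma> * real Bo" "4 \<le> \<sigma> * real Bo" using Bo1(4,5) sp by (simp_all add: divide_le_eq mult.commute)
    obtain U where U: "U \<subseteq> words my n" "card (words my n) \<le> 2 * card U"
      "\<And>y. y \<in> U \<Longrightarrow> fst (\<phi> (0, 0, 0)) + r * real n / (4 * K) \<le> fst (\<phi> (q y))"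
      using rising_lines[OF \<phi> K_def Bc(1) dp d4 d48 Bc(2) mu(1) k0 _ Bo_def Bo4 \<epsilon>_def epsd ep tp(1) my20 kk n_def mm, of \<sigma>]
        big[unfolded R_def] ivt[unfolded R_def] pack[unfolded R_def] sp s1 tp(2) sB c20(3)
      unfolding q_def by (auto simp: p_def)
    have "s0 \<le> r * real n / (4 * K)"
    proof -
      have "1 \<le> n" using Bo4 by (simp add: n_def)
      then have "r * 1 \<le> r * real n" using rp by (intro mult_left_mono) auto
      moreover have "4 * K * s0 \<le> 4 * K * \<bar>s0\<bar>" using K by (intro mult_left_mono) auto
      then have "4 * K * s0 \<le> r" using r1(10) by linarith
      then have "s0 \<le> r / (4 * K)" using K by (simp add: le_divide_eq mult_ac)
      moreover have "r / (4 * K) \<le> r * real n / (4 * K)" using calculation(1) K by (intro divide_right_mono) auto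
      ultimately show ?thesis by linarith
    qed
    then have "U \<subseteq> {i \<in> I. fst (\<phi> (0, 0, 0)) + s0 \<le> fst (\<phi> (q i))}" using U by (force simp: I_def)
    then have "card U \<le> card {i \<in> I. fst (\<phi> (0, 0, 0)) + s0 \<le> fst (\<phi> (q i))}"
      by (intro card_mono) (auto simp: I_def finite_words)
    then show ?thesis using U(2) by (simp add: I_def)
  qed
  moreover have "I \<noteq> {}" using card_words[of my n] myy(1) unfolding I_def by (metis card.empty less_numeral_extra(3) zero_less_power)
  ultimately show ?thesis by (intro exI[of _ I] exI[of _ q]) (auto simp: I_def finite_words)
qed

subsection \<open>Groups quasi-isometric to the solvable group\<close>

lemma sol_dist_sym: "sol_dist a b p q = sol_dist a b q p" by (simp add: sol_dist_def Mr_sym Nr_sym)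

lemma Nr_le': "0 < b \<Longrightarrow> Nr b p q \<le> fst q" using Nr_le[of b q p] by (simp add: Nr_sym)

lemma sol_dist_tri:
  assumes "0 < a" "0 < b"
  shows "sol_dist a b p r \<le> sol_dist a b p q + sol_dist a b q r + (ln 2 / a + ln 2 / b)"
  using Mr_ultra[OF assms(1), of p r q] Nr_ultra[OF assms(2), of p q r] Mr_ge'[OF assms(1), of q p] Mr_ge[OF assms(1), of q r]
    Nr_le[OF assms(2), of q r] Nr_le'[OF assms(2), of p q]
  unfolding sol_dist_def by linarith

section \<open>Words and balls in a group\<close>

context group begin

lemma foldr_append_one:
  assumes "set u \<subseteq> carrier G" "set v \<subseteq> carrier G"
  shows "foldr (\<otimes>) (u @ v) \<one> = foldr (\<otimes>) u \<one> \<otimes> foldr (\<otimes>) v \<one>" "foldr (\<otimes>) u \<one> \<in> carrier G"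
proof -
  have cl: "foldr (\<otimes>) w \<one> \<in> carrier G" if "set w \<subseteq> carrier G" for w using that by (induction w) auto
  show "foldr (\<otimes>) u \<one> \<in> carrier G" by (rule cl[OF assms(1)])
  show "foldr (\<otimes>) (u @ v) \<one> = foldr (\<otimes>) u \<one> \<otimes> foldr (\<otimes>) v \<one>"
    using assms(1) by (induction u) (auto simp: cl[OF assms(2)] cl m_assoc)
qed

lemma generate_word:
  assumes S: "S \<subseteq> carrier G" and g: "g \<in> generate G S"
  shows "\<exists>ws. set ws \<subseteq> S \<union> m_inv G ` S \<and> foldr (\<otimes>) ws \<one> = g"
  using g
proof induction
  case one then show ?case by (intro exI[of _ "[]"]) auto
next
  case (incl h) then show ?case using S by (intro exI[of _ "[h]"]) auto
next
  case (inv h) then show ?case using S by (intro exI[of _ "[inv h]"]) auto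
next
  case (eng g h)
  then obtain u v where u: "set u \<subseteq> S \<union> m_inv G ` S" "foldr (\<otimes>) u \<one> = g" and v: "set v \<subseteq> S \<union> m_inv G ` S" "foldr (\<otimes>) v \<one> = h"
    by blast
  have "S \<union> m_inv G ` S \<subseteq> carrier G" using S by auto
  then have c: "set u \<subseteq> carrier G" "set v \<subseteq> carrier G" using u(1) v(1) by auto
  show ?case
    by (intro exI[of _ "u @ v"]) (use foldr_append_one[OF c] u v in simp)
qed

text \<open>By generation the set under \<open>LEAST\<close> is nonempty, so
  \<open>word_length\<close> is the length of an actual word and not a default value, and short
  words are finite in number.\<close>

lemma finite_word_ball:
  assumes S: "finite S" "S \<subseteq> carrier G" "generate G S = carrier G"
  shows "finite {g \<in> carrier G. word_length G S g \<le> n}"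
proof (rule finite_subset)
  show "finite ((\<lambda>ws. foldr (\<otimes>) ws \<one>) ` (\<Union>k\<le>n. {ws. set ws \<subseteq> S \<union> m_inv G ` S \<and> length ws = k}))"
    using S by (intro finite_imageI finite_UN_I finite_lists_length_eq) auto
  show "{g \<in> carrier G. word_length G S g \<le> n} \<subseteq> (\<lambda>ws. foldr (\<otimes>) ws \<one>) ` (\<Union>k\<le>n. {ws. set ws \<subseteq> S \<union> m_inv G ` S \<and> length ws = k})"
  proof
    fix g assume g: "g \<in> {g \<in> carrier G. word_length G S g \<le> n}"
    then obtain ws where "set ws \<subseteq> S \<union> m_inv G ` S" "foldr (\<otimes>) ws \<one> = g"
      using generate_word[OF S(2)] S(3) by blast
    then have "\<exists>k ws. length ws = k \<and> set ws \<subseteq> S \<union> m_inv G ` S \<and> foldr (\<otimes>) ws \<one> = g" by blast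
    from LeastI_ex[OF this] obtain ws where "length ws = word_length G S g" "set ws \<subseteq> S \<union> m_inv G ` S" "foldr (\<otimes>) ws \<one> = g"
      unfolding word_length_def by blast
    then show "g \<in> (\<lambda>ws. foldr (\<otimes>) ws \<one>) ` (\<Union>k\<le>n. {ws. set ws \<subseteq> S \<union> m_inv G ` S \<and> length ws = k})"
      using g by (intro image_eqI[of _ _ ws]) auto
  qed
qed

lemma word_dist_left:
  assumes "k \<in> carrier G" "g \<in> carrier G" "h \<in> carrier G"
  shows "word_dist G S (k \<otimes> g) (k \<otimes> h) = word_dist G S g h"
proof -
  have "inv (k \<otimes> g) \<otimes> (k \<otimes> h) = inv g \<otimes> (inv k \<otimes> (k \<otimes> h))"
    using assms by (simp add: inv_mult_group m_assoc)
  also have "\<dots> = inv g \<otimes> h" using assms by (simp add: m_assoc[symmetric])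
  finally show ?thesis by (simp add: word_dist_def)
qed

end

section \<open>Weights of boxes\<close>

definition sbox :: "real \<Rightarrow> real \<Rightarrow> real \<Rightarrow> pt set" where
  "sbox L X Y = {p. \<bar>fst p\<bar> \<le> L \<and> \<bar>fst (snd p)\<bar> \<le> X \<and> \<bar>snd (snd p)\<bar> \<le> Y}"

text \<open>\<open>N\<close> is at most the height of \<open>p\<close> and \<open>M\<close> at
  least, so \<open>M \<le> L + \<rho>\<close> and \<open>N \<ge> - (L + \<rho>)\<close>, which
  bounds both differences.\<close>

lemma sbox_near:
  assumes ab: "0 < a" "0 < b" and p: "p \<in> sbox L X Y" and d: "sol_dist a b p q \<le> \<rho>"
  shows "q \<in> sbox (L + \<rho>) (X + exp (a * (L + \<rho>))) (Y + exp (b * (L + \<rho>)))"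
proof -
  have pL: "\<bar>fst p\<bar> \<le> L" "\<bar>fst (snd p)\<bar> \<le> X" "\<bar>snd (snd p)\<bar> \<le> Y" using p by (auto simp: sbox_def)
  have M: "Mr a p q \<le> L + \<rho>" using d Nr_le[OF ab(2), of p q] pL by (simp add: sol_dist_def)
  have N: "- (L + \<rho>) \<le> Nr b p q" using d Mr_ge[OF ab(1), of p q] pL by (simp add: sol_dist_def)
  have "fst q \<le> L + \<rho>" "\<bar>fst (snd p) - fst (snd q)\<bar> \<le> exp (a * (L + \<rho>))" using M unfolding Mr_le_iff[OF ab(1)] by auto
  moreover have "- (L + \<rho>) \<le> fst q" "\<bar>snd (snd p) - snd (snd q)\<bar> \<le> exp (b * (L + \<rho>))" using N unfolding Nr_ge_iff[OF ab(2)] by (auto simp: algebra_simps)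
  ultimately show ?thesis using pL by (auto simp: sbox_def)
qed

text \<open>Counting measure on the group is coarsely the left Haar measure of \<open>G\<close>; the weight \<open>W\<close> turns it into
  the right Haar measure, for which large boxes are almost invariant.\<close>

locale sol_orbit =
  fixes a b C Nb :: real and \<Gamma> :: "'g set" and F :: "'g \<Rightarrow> pt"
  assumes a: "0 < a" and b: "0 < b" and ba: "b < a" and C: "0 \<le> C"
    and fiber: "\<And>A. A \<subseteq> \<Gamma> \<Longrightarrow> (\<And>g h. g \<in> A \<Longrightarrow> h \<in> A \<Longrightarrow> sol_dist a b (F g) (F h) \<le> 1) \<Longrightarrow> finite A \<and> real (card A) \<le> Nb"
    and onto: "\<And>p. \<exists>g\<in>\<Gamma>. sol_dist a b p (F g) \<le> C"
begin

definition W :: "'g \<Rightarrow> real" where "W g = exp ((a - b) * fst (F g))"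

definition orb :: "real \<Rightarrow> real \<Rightarrow> real \<Rightarrow> 'g set" where "orb L X Y = {g \<in> \<Gamma>. F g \<in> sbox L X Y}"

lemma Nb0: "0 \<le> Nb" using fiber[of "{}"] by simp

text \<open>The cells have sides \<open>exp (a * k)\<close> and \<open>exp (- b * k)\<close>, of
  unit length at height \<open>k\<close>, and each holds at most \<open>Nb\<close> elements. The
  assumptions make the box at least as large as a cell, so rounding costs only a constant
  factor.\<close>

lemma level_count:
  fixes k :: int and L X Y :: real
  assumes X: "exp (a * k) \<le> X" and Y: "exp (- b * k) \<le> Y"
  defines "A \<equiv> {g \<in> orb L X Y. \<lfloor>fst (F g)\<rfloor> = k}"
  shows "finite A" "real (card A) \<le> Nb * (16 * (X * Y) * exp ((b - a) * k))"
proof -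
  define i where "i g = \<lfloor>fst (snd (F g)) * exp (- a * k)\<rfloor>" for g
  define j where "j g = \<lfloor>snd (snd (F g)) * exp (b * k)\<rfloor>" for g
  define I where "I = X * exp (- a * k)"
  define J where "J = Y * exp (b * k)"
  define cells where "cells = {\<lfloor>- I\<rfloor>..\<lfloor>I\<rfloor>} \<times> {\<lfloor>- J\<rfloor>..\<lfloor>J\<rfloor>}"
  define fib where "fib v = {g \<in> A. (i g, j g) = v}" for v
  have IJ: "1 \<le> I" "1 \<le> J"
  proof -
    have "exp (a * k) * exp (- a * k) \<le> I" unfolding I_def using X by (intro mult_right_mono) auto
    then show "1 \<le> I" by (simp flip: exp_add)
    have "exp (- b * k) * exp (b * k) \<le> J" unfolding J_def using Y by (intro mult_right_mono) auto
    then show "1 \<le> J" by (simp flip: exp_add)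
  qed
  have fib: "finite (fib v) \<and> real (card (fib v)) \<le> Nb" for v
  proof (rule fiber)
    show "fib v \<subseteq> \<Gamma>" by (auto simp: fib_def A_def orb_def)
    fix g h assume "g \<in> fib v" "h \<in> fib v"
    then have eq: "i g = i h" "j g = j h" and k: "\<lfloor>fst (F g)\<rfloor> = k" "\<lfloor>fst (F h)\<rfloor> = k" by (auto simp: fib_def A_def)
    have kz: "of_int k \<le> fst (F g)" "fst (F g) \<le> of_int k + 1" "of_int k \<le> fst (F h)" "fst (F h) \<le> of_int k + 1" using k by linarith+
    have "\<bar>fst (snd (F g)) * exp (- a * k) - fst (snd (F h)) * exp (- a * k)\<bar> \<le> 1"
      by (rule floor_eq_close) (use eq in \<open>simp add: i_def\<close>)
    then have "\<bar>fst (snd (F g)) - fst (snd (F h))\<bar> * exp (- a * k) \<le> 1" by (simp add: abs_mult flip: left_diff_distrib)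
    then have "\<bar>fst (snd (F g)) - fst (snd (F h))\<bar> \<le> exp (a * k)" by (simp add: exp_minus field_simps)
    also have "\<dots> \<le> exp (a * (of_int k + 1))" using a by simp
    finally have "Mr a (F g) (F h) \<le> of_int k + 1" unfolding Mr_le_iff[OF a] using kz by auto
    moreover have "\<bar>snd (snd (F g)) * exp (b * k) - snd (snd (F h)) * exp (b * k)\<bar> \<le> 1"
      by (rule floor_eq_close) (use eq in \<open>simp add: j_def\<close>)
    then have "\<bar>snd (snd (F g)) - snd (snd (F h))\<bar> * exp (b * k) \<le> 1" by (simp add: abs_mult flip: left_diff_distrib)
    then have "\<bar>snd (snd (F g)) - snd (snd (F h))\<bar> \<le> exp (- b * k)" by (simp add: exp_minus field_simps)
    then have "of_int k \<le> Nr b (F g) (F h)" unfolding Nr_ge_iff[OF b] using kz by auto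
    ultimately show "sol_dist a b (F g) (F h) \<le> 1" by (simp add: sol_dist_def)
  qed
  have sub: "A \<subseteq> (\<Union>v\<in>cells. fib v)"
  proof
    fix g assume g: "g \<in> A"
    then have xy: "\<bar>fst (snd (F g))\<bar> \<le> X" "\<bar>snd (snd (F g))\<bar> \<le> Y" by (auto simp: A_def orb_def sbox_def)
    have "\<bar>fst (snd (F g)) * exp (- a * k)\<bar> \<le> I" "\<bar>snd (snd (F g)) * exp (b * k)\<bar> \<le> J"
      using xy by (auto simp: I_def J_def abs_mult)
    then have "\<lfloor>- I\<rfloor> \<le> i g" "i g \<le> \<lfloor>I\<rfloor>" "\<lfloor>- J\<rfloor> \<le> j g" "j g \<le> \<lfloor>J\<rfloor>"
      unfolding i_def j_def by (auto intro!: floor_mono)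
    then show "g \<in> (\<Union>v\<in>cells. fib v)" using g by (auto simp: cells_def fib_def)
  qed
  have finc: "finite cells" by (simp add: cells_def)
  then show "finite A" using sub fib by (meson finite_UN_I finite_subset)
  have "real (card A) \<le> real (card (\<Union>v\<in>cells. fib v))" using sub finc fib by (simp add: card_mono)
  also have "\<dots> \<le> real (\<Sum>v\<in>cells. card (fib v))" using card_UN_le[OF finc, of fib] by (simp only: of_nat_le_iff)
  also have "\<dots> \<le> real (card cells) * Nb" using fib sum_bounded_above[of cells "\<lambda>v. real (card (fib v))" Nb] by simp
  also have "\<dots> \<le> ((4 * I) * (4 * J)) * Nb"
  proof (rule mult_right_mono[OF _ Nb0])
    have "real (card {\<lfloor>- I\<rfloor>..\<lfloor>I\<rfloor>}) \<le> 4 * I" "real (card {\<lfloor>- J\<rfloor>..\<lfloor>J\<rfloor>}) \<le> 4 * J"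
      using card_floor_interval[of "- I" I] card_floor_interval[of "- J" J] IJ by linarith+
    then show "real (card cells) \<le> 4 * I * (4 * J)"
      unfolding cells_def card_cartesian_product of_nat_mult using IJ by (intro mult_mono) auto
  qed
  also have "\<dots> = Nb * (16 * (X * Y) * exp ((b - a) * k))"
    by (simp add: I_def J_def algebra_simps flip: exp_add)
  finally show "real (card A) \<le> Nb * (16 * (X * Y) * exp ((b - a) * k))" .
qed

text \<open>On level \<open>k\<close> the weight is at most \<open>exp ((a - b) * (k + 1))\<close>,
  which cancels \<open>exp ((b - a) * k)\<close> in the count. All levels get the same bound, so the
  total is linear in \<open>L\<close>.\<close>

lemma weight_upper:
  assumes L: "0 \<le> L" and X: "exp (a * (L + 1)) \<le> X" and Y: "exp (b * (L + 1)) \<le> Y"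
  shows "finite (orb L X Y)" "sum W (orb L X Y) \<le> 16 * Nb * exp (a - b) * (2 * L + 2) * (X * Y)"
proof -
  define A where "A k = {g \<in> orb L X Y. \<lfloor>fst (F g)\<rfloor> = k}" for k
  define Z where "Z = {\<lfloor>- L\<rfloor>..\<lfloor>L\<rfloor>}"
  have kL: "of_int k \<le> L" "- of_int k \<le> L + 1" if "k \<in> Z" for k
    using that unfolding Z_def by (simp_all add: le_floor_iff) linarith
  have lev: "finite (A k)" "real (card (A k)) \<le> Nb * (16 * (X * Y) * exp ((b - a) * k))" if "k \<in> Z" for k
  proof -
    have "a * of_int k \<le> a * (L + 1)" "b * (- of_int k) \<le> b * (L + 1)"
      using kL[OF that] a b by - (rule mult_left_mono; linarith)+
    then have "exp (a * of_int k) \<le> exp (a * (L + 1))" "exp (- b * of_int k) \<le> exp (b * (L + 1))" by simp_all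
    then have "exp (a * of_int k) \<le> X" "exp (- b * of_int k) \<le> Y" using X Y by linarith+
    from level_count[OF this] show "finite (A k)" "real (card (A k)) \<le> Nb * (16 * (X * Y) * exp ((b - a) * k))" by (auto simp: A_def)
  qed
  have U: "orb L X Y = (\<Union>k\<in>Z. A k)"
  proof -
    have "\<lfloor>fst (F g)\<rfloor> \<in> Z" if "g \<in> orb L X Y" for g
    proof -
      have "- L \<le> fst (F g)" "fst (F g) \<le> L" using that by (auto simp: orb_def sbox_def)
      then show ?thesis by (auto simp: Z_def intro: floor_mono)
    qed
    then show ?thesis by (auto simp: A_def)
  qed
  show "finite (orb L X Y)" unfolding U using lev by (intro finite_UN_I) (auto simp: Z_def)
  have "sum W (orb L X Y) = (\<Sum>k\<in>Z. sum W (A k))"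
    unfolding U using lev by (intro sum.UNION_disjoint) (auto simp: Z_def A_def)
  also have "\<dots> \<le> (\<Sum>k\<in>Z. 16 * Nb * exp (a - b) * (X * Y))"
  proof (rule sum_mono)
    fix k assume k: "k \<in> Z"
    have "sum W (A k) \<le> real (card (A k)) * exp ((a - b) * (of_int k + 1))"
    proof (rule sum_bounded_above)
      fix g assume "g \<in> A k"
      then have "fst (F g) \<le> of_int k + 1" unfolding A_def by auto
      then show "W g \<le> exp ((a - b) * (of_int k + 1))" using ba by (simp add: W_def)
    qed
    also have "\<dots> \<le> Nb * (16 * (X * Y) * exp ((b - a) * k)) * exp ((a - b) * (of_int k + 1))"
      using lev(2)[OF k] by (intro mult_right_mono) auto
    also have "\<dots> = Nb * (16 * (X * Y)) * (exp ((b - a) * k) * exp ((a - b) * (of_int k + 1)))" by simp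
    also have "exp ((b - a) * k) * exp ((a - b) * (of_int k + 1)) = exp (a - b)"
      by (simp add: algebra_simps flip: exp_add)
    finally show "sum W (A k) \<le> 16 * Nb * exp (a - b) * (X * Y)" by (simp add: mult_ac)
  qed
  also have "\<dots> = real (card Z) * (16 * Nb * exp (a - b) * (X * Y))" by simp
  also have "\<dots> \<le> (2 * L + 2) * (16 * Nb * exp (a - b) * (X * Y))"
  proof (rule mult_right_mono)
    show "real (card Z) \<le> 2 * L + 2" using card_floor_interval[of "- L" L] L by (simp add: Z_def)
    have "0 \<le> X" "0 \<le> Y" using X Y by (meson exp_ge_zero order_trans)+
    then show "0 \<le> 16 * Nb * exp (a - b) * (X * Y)" using Nb0 by simp
  qed
  finally show "sum W (orb L X Y) \<le> 16 * Nb * exp (a - b) * (2 * L + 2) * (X * Y)" by (simp add: mult_ac)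
qed

text \<open>The plane of height 0 suffices, with a grid of spacing \<open>l\<close>. Grid points
  assigned to the same element are within \<open>E = 2 * C + ln 2 / a + ln 2 / b\<close>, and
  \<open>l\<close> exceeds both \<open>exp (a * E)\<close> and \<open>exp (b * E)\<close>; so
  different grid points get different elements. Their heights are at least \<open>- C\<close>, which
  bounds \<open>W\<close> from below.\<close>

lemma weight_lower:
  assumes l: "l = exp ((a + b) * (2 * C + (ln 2 / a + ln 2 / b) + 1))" and X: "0 \<le> X" and Y: "0 \<le> Y" and L: "0 \<le> L"
    and near: "\<And>p q. p \<in> sbox L X Y \<Longrightarrow> sol_dist a b p q \<le> C \<Longrightarrow> q \<in> sbox L' X' Y'" and fin: "finite (orb L' X' Y')"
  shows "exp (- (a - b) * C) * (X * Y) / l^2 \<le> sum W (orb L' X' Y')"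
proof -
  define T where "T = {..nat \<lfloor>X / l\<rfloor>} \<times> {..nat \<lfloor>Y / l\<rfloor>}"
  have lp: "0 < l" by (simp add: l)
  define P where "P = (\<lambda>(i::nat, j::nat). (0::real, l * real i, l * real j))"
  define s where "s p = (SOME g. g \<in> \<Gamma> \<and> sol_dist a b p (F g) \<le> C)" for p
  have s: "s p \<in> \<Gamma>" "sol_dist a b p (F (s p)) \<le> C" for p
    using someI_ex[of "\<lambda>g. g \<in> \<Gamma> \<and> sol_dist a b p (F g) \<le> C"] onto[of p] unfolding s_def by blast+
  have box: "P v \<in> sbox L X Y" if "v \<in> T" for v
  proof -
    obtain i j where v: "v = (i, j)" by (cases v)
    have "0 \<le> \<lfloor>X / l\<rfloor>" "0 \<le> \<lfloor>Y / l\<rfloor>" using X Y lp by simp_all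
    then have "real i \<le> X / l" "real j \<le> Y / l" using that by (simp_all add: T_def v le_nat_iff le_floor_iff)
    then have "l * real i \<le> X" "l * real j \<le> Y" using lp by (simp_all add: le_divide_eq mult.commute)
    then show ?thesis using L lp by (simp add: sbox_def P_def v)
  qed
  have inj: "inj_on (\<lambda>v. s (P v)) T"
  proof (rule inj_onI)
    fix v w assume eq: "s (P v) = s (P w)"
    define E where "E = 2 * C + (ln 2 / a + ln 2 / b)"
    have sol_dist: "sol_dist a b (P v) (P w) \<le> E"
      using sol_dist_tri[OF a b, of "P v" "P w" "F (s (P v))"] s(2)[of "P v"] s(2)[of "P w"] eq
      by (simp add: E_def sol_dist_sym[of a b "F (s (P w))"])
    have E0: "0 \<le> E" using C a b by (simp add: E_def)
    obtain i j i' j' where v: "v = (i, j)" "w = (i', j')" by (cases v, cases w)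
    have lE: "exp (a * E) < l" "exp (b * E) < l"
    proof -
      have "a * E \<le> (a + b) * E" "b * E \<le> (a + b) * E" using E0 a b by (auto intro: mult_right_mono)
      moreover have "(a + b) * E < (a + b) * (E + 1)" using a b by (intro mult_strict_left_mono) auto
      ultimately show "exp (a * E) < l" "exp (b * E) < l" by (auto simp: l E_def[symmetric])
    qed
    have "Nr b (P v) (P w) \<le> 0" using Nr_le[OF b, of "P v" "P w"] by (simp add: P_def v)
    then have "Mr a (P v) (P w) \<le> E" using sol_dist by (simp add: sol_dist_def)
    then have "\<bar>l * real i - l * real i'\<bar> \<le> exp (a * E)" unfolding Mr_le_iff[OF a] by (simp add: P_def v)
    then have "l * \<bar>real i - real i'\<bar> \<le> exp (a * E)" using lp by (simp add: abs_mult flip: right_diff_distrib)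
    then have "l * \<bar>real i - real i'\<bar> < l * 1" using lE by linarith
    then have "\<bar>real i - real i'\<bar> < 1" using lp by (simp only: mult_less_cancel_left_pos)
    then have ii: "i = i'" by linarith
    have "0 \<le> Mr a (P v) (P w)" using Mr_ge[OF a, of "P v" "P w"] by (simp add: P_def v)
    then have "- E \<le> Nr b (P v) (P w)" using sol_dist by (simp add: sol_dist_def)
    then have "\<bar>l * real j - l * real j'\<bar> \<le> exp (b * E)" unfolding Nr_ge_iff[OF b] by (simp add: P_def v)
    then have "l * \<bar>real j - real j'\<bar> \<le> exp (b * E)" using lp by (simp add: abs_mult flip: right_diff_distrib)
    then have "l * \<bar>real j - real j'\<bar> < l * 1" using lE by linarith
    then have "\<bar>real j - real j'\<bar> < 1" using lp by (simp only: mult_less_cancel_left_pos)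
    then have "j = j'" by linarith
    with ii show "v = w" by (simp add: v)
  qed
  have sub: "(\<lambda>v. s (P v)) ` T \<subseteq> orb L' X' Y'"
  proof
    fix g assume "g \<in> (\<lambda>v. s (P v)) ` T"
    then obtain v where "v \<in> T" "g = s (P v)" by blast
    then show "g \<in> orb L' X' Y'" using near[OF box s(2)] s(1) by (simp add: orb_def)
  qed
  have cT: "X * Y / l^2 \<le> real (card T)"
  proof -
    have "X / l \<le> real (nat \<lfloor>X / l\<rfloor>) + 1" "Y / l \<le> real (nat \<lfloor>Y / l\<rfloor>) + 1" by linarith+
    then have "(X / l) * (Y / l) \<le> (real (nat \<lfloor>X / l\<rfloor>) + 1) * (real (nat \<lfloor>Y / l\<rfloor>) + 1)" using X Y lp by (intro mult_mono) auto
    also have "\<dots> = real (card T)" by (simp add: T_def card_cartesian_product algebra_simps)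
    finally show ?thesis by (simp add: power2_eq_square)
  qed
  have "exp (- (a - b) * C) * (X * Y) / l^2 = exp (- (a - b) * C) * (X * Y / l^2)" by simp
  also have "\<dots> \<le> exp (- (a - b) * C) * real (card T)" using cT by (intro mult_left_mono) auto
  also have "\<dots> = real (card ((\<lambda>v. s (P v)) ` T)) * exp (- (a - b) * C)" by (simp add: card_image[OF inj])
  also have "\<dots> \<le> sum W ((\<lambda>v. s (P v)) ` T)"
  proof (rule sum_bounded_below)
    fix g assume "g \<in> (\<lambda>v. s (P v)) ` T"
    then obtain v where v: "g = s (P v)" by auto
    have "0 \<le> Mr a (P v) (F g)" using Mr_ge[OF a, of "P v" "F g"] by (simp add: P_def case_prod_beta)
    moreover have "Nr b (P v) (F g) \<le> fst (F g)" by (rule Nr_le'[OF b])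
    ultimately have "- C \<le> fst (F g)" using s(2)[of "P v"] by (simp add: sol_dist_def v)
    then have "(a - b) * (- C) \<le> (a - b) * fst (F g)" using ba by (intro mult_left_mono) auto
    then show "exp (- (a - b) * C) \<le> W g" by (simp add: W_def algebra_simps)
  qed
  also have "\<dots> \<le> sum W (orb L' X' Y')" using fin sub by (intro sum_mono2) (auto simp: W_def)
  finally show ?thesis .
qed

text \<open>Over \<open>n\<close> steps the weight would gain the factor \<open>4 ^ n\<close>, but
  for boxes whose widths at most double and whose heights are at most \<open>2 * n * \<rho>\<close>
  the upper and lower bounds differ by a factor of order \<open>n\<close>.\<close>

lemma no_growth:
  assumes \<rho>: "C \<le> \<rho>" "1 \<le> \<rho>"
    and grow: "\<And>A A'. finite A' \<Longrightarrow> A \<subseteq> A' \<Longrightarrow> A' \<subseteq> \<Gamma> \<Longrightarrow>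
        (\<And>g h. g \<in> A \<Longrightarrow> h \<in> \<Gamma> \<Longrightarrow> sol_dist a b (F g) (F h) \<le> \<rho> \<Longrightarrow> h \<in> A') \<Longrightarrow> 4 * sum W A \<le> sum W A'"
  shows False
proof -
  define l where "l = exp ((a + b) * (2 * C + (ln 2 / a + ln 2 / b) + 1))"
  have lp: "0 < l" by (simp add: l_def)
  define Q where "Q = 4 * (16 * Nb * exp (a - b) * (4 * \<rho> + 2)) * l^2 * exp ((a - b) * C)"
  obtain n :: nat where n: "Q < real n" "1 \<le> n"
    using reals_Archimedean2[of "max Q 1"] by (metis less_imp_le max_less_iff_conj of_nat_1 of_nat_le_iff)
  \<comment> \<open>By \<open>sbox_near\<close> a step widens the box by
    \<open>exp (a * (L + \<rho>))\<close>, at most the fixed increment used here as long as the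
    height stays below \<open>2 * n * \<rho>\<close>. Starting with \<open>2 * n\<close> increments
    makes the later ones harmless.\<close>
  define X where "X k = (2 * real n + real k) * exp (a * (2 * real n * \<rho> + 1))" for k :: nat
  define Y where "Y k = (2 * real n + real k) * exp (b * (2 * real n * \<rho> + 1))" for k :: nat
  define A where "A k = orb (real k * \<rho>) (X k) (Y k)" for k
  have near: "q \<in> sbox (real (Suc k) * \<rho>) (X (Suc k)) (Y (Suc k))"
    if "p \<in> sbox (real k * \<rho>) (X k) (Y k)" "sol_dist a b p q \<le> \<rho>" "k < 2 * n" for p q k
  proof -
    have "real (Suc k) * \<rho> \<le> 2 * real n * \<rho>" using that(3) \<rho> by (intro mult_right_mono) auto
    then have "real k * \<rho> + \<rho> \<le> 2 * real n * \<rho> + 1" by (simp add: algebra_simps)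
    then have "exp (a * (real k * \<rho> + \<rho>)) \<le> exp (a * (2 * real n * \<rho> + 1))" "exp (b * (real k * \<rho> + \<rho>)) \<le> exp (b * (2 * real n * \<rho> + 1))"
      using a b by auto
    then have "X k + exp (a * (real k * \<rho> + \<rho>)) \<le> X (Suc k)" "Y k + exp (b * (real k * \<rho> + \<rho>)) \<le> Y (Suc k)"
      by (simp_all add: X_def Y_def algebra_simps)
    moreover have "real k * \<rho> + \<rho> = real (Suc k) * \<rho>" by (simp add: algebra_simps)
    ultimately show ?thesis using sbox_near[OF a b that(1,2)] unfolding sbox_def by auto
  qed
  have big: "exp (a * (real k * \<rho> + 1)) \<le> X k" "exp (b * (real k * \<rho> + 1)) \<le> Y k" if "k \<le> 2 * n" for k
  proof -
    have "real k * \<rho> \<le> 2 * real n * \<rho>" using that \<rho> by (intro mult_right_mono) auto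
    then have e: "exp (a * (real k * \<rho> + 1)) \<le> 1 * exp (a * (2 * real n * \<rho> + 1))" "exp (b * (real k * \<rho> + 1)) \<le> 1 * exp (b * (2 * real n * \<rho> + 1))"
      using a b by auto
    moreover have "1 * exp (a * (2 * real n * \<rho> + 1)) \<le> X k" "1 * exp (b * (2 * real n * \<rho> + 1)) \<le> Y k"
      unfolding X_def Y_def using n by (intro mult_right_mono; simp)+
    ultimately show "exp (a * (real k * \<rho> + 1)) \<le> X k" "exp (b * (real k * \<rho> + 1)) \<le> Y k" by linarith+
  qed
  have fin: "finite (A k)" if "k \<le> 2 * n" for k
    unfolding A_def using weight_upper(1)[OF _ big[OF that]] \<rho> by simp
  have step: "4 * sum W (A k) \<le> sum W (A (Suc k))" if k: "k < 2 * n" for k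
  proof (rule grow)
    show "finite (A (Suc k))" using fin k by simp
    show "A k \<subseteq> A (Suc k)"
    proof
      fix g assume "g \<in> A k"
      moreover have "sol_dist a b (F g) (F g) \<le> \<rho>" using \<rho> Mr_self[OF a] Nr_self[OF b] by (simp add: sol_dist_def)
      ultimately show "g \<in> A (Suc k)" using near[of "F g" k "F g", OF _ _ k] by (simp add: A_def orb_def)
    qed
    show "A (Suc k) \<subseteq> \<Gamma>" by (auto simp: A_def orb_def)
    fix g h assume "g \<in> A k" "h \<in> \<Gamma>" "sol_dist a b (F g) (F h) \<le> \<rho>"
    then show "h \<in> A (Suc k)" using near[of "F g" k "F h", OF _ _ k] by (simp add: A_def orb_def)
  qed
  have pow: "4 ^ i * sum W (A n) \<le> sum W (A (n + i))" if "i \<le> n" for i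
    using that
  proof (induction i)
    case (Suc i)
    then have "4 * (4 ^ i * sum W (A n)) \<le> 4 * sum W (A (n + i))" by simp
    also have "\<dots> \<le> sum W (A (Suc (n + i)))" using Suc by (intro step) simp
    finally show ?case by simp
  qed simp
  have up: "sum W (A (2 * n)) \<le> 16 * Nb * exp (a - b) * (2 * (real (2 * n) * \<rho>) + 2) * (X (2 * n) * Y (2 * n))"
    unfolding A_def by (rule weight_upper(2)[OF _ big]) (use \<rho> in auto)
  have XY0: "0 \<le> X k" "0 \<le> Y k" for k by (auto simp: X_def Y_def)
  have low: "exp (- (a - b) * C) * (X (n - 1) * Y (n - 1)) / l^2 \<le> sum W (A n)"
    unfolding A_def
  proof (rule weight_lower[OF l_def XY0 _ _ fin[unfolded A_def]])
    show "0 \<le> real (n - 1) * \<rho>" using \<rho> by simp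
    fix p q assume "p \<in> sbox (real (n - 1) * \<rho>) (X (n - 1)) (Y (n - 1))" "sol_dist a b p q \<le> C"
    then show "q \<in> sbox (real n * \<rho>) (X n) (Y n)" using near[of p "n - 1" q] n \<rho> by auto
  qed (use n in auto)
  have X2: "X (2 * n) \<le> 2 * X (n - 1)" "Y (2 * n) \<le> 2 * Y (n - 1)"
    using n unfolding X_def Y_def mult.assoc[symmetric] by (auto simp: of_nat_diff intro!: mult_right_mono)
  define Z where "Z = X (n - 1) * Y (n - 1)"
  have Zp: "0 < Z" using n by (auto simp: Z_def X_def Y_def intro!: mult_pos_pos add_pos_nonneg)
  have XY4: "X (2 * n) * Y (2 * n) \<le> 4 * Z"
    using mult_mono[OF X2] XY0 by (simp add: Z_def mult_ac)
  define D where "D = 16 * Nb * exp (a - b) * (4 * \<rho> + 2)"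
  have D0: "0 \<le> D" using Nb0 \<rho> by (simp add: D_def)
  have "16 * Nb * exp (a - b) * (2 * (real (2 * n) * \<rho>) + 2) \<le> D * real n"
  proof -
    have "2 * (real (2 * n) * \<rho>) + 2 \<le> (4 * \<rho> + 2) * real n" using n by (simp add: algebra_simps)
    then have "16 * Nb * exp (a - b) * (2 * (real (2 * n) * \<rho>) + 2) \<le> 16 * Nb * exp (a - b) * ((4 * \<rho> + 2) * real n)"
      using Nb0 by (intro mult_left_mono) auto
    then show ?thesis by (simp add: D_def)
  qed
  then have "sum W (A (2 * n)) \<le> D * real n * (4 * Z)"
    using up XY4 D0 XY0 by (meson mult_mono mult_nonneg_nonneg of_nat_0_le_iff order_trans)
  moreover have "4 ^ n * (exp (- (a - b) * C) * Z / l^2) \<le> sum W (A (2 * n))"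
  proof -
    have "4 ^ n * (exp (- (a - b) * C) * Z / l^2) \<le> 4 ^ n * sum W (A n)" unfolding Z_def by (intro mult_left_mono low) simp
    also have "\<dots> \<le> sum W (A (n + n))" by (rule pow) simp
    finally show ?thesis by (simp add: mult_2)
  qed
  ultimately have "4 ^ n * (exp (- (a - b) * C) * Z / l^2) \<le> D * real n * (4 * Z)" by linarith
  then have "(4 ^ n * (exp (- (a - b) * C) / l^2)) * Z \<le> (D * real n * 4) * Z" by (simp add: mult_ac)
  then have "4 ^ n * (exp (- (a - b) * C) / l^2) \<le> D * real n * 4" using Zp by (simp only: mult_le_cancel_right_pos)
  then have "4 ^ n * exp (- (a - b) * C) \<le> D * real n * 4 * l^2" using lp by (simp add: divide_le_eq)
  then have "4 ^ n * exp (- (a - b) * C) * exp ((a - b) * C) \<le> D * real n * 4 * l^2 * exp ((a - b) * C)" by (rule mult_right_mono) simp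
  also have "4 ^ n * exp (- (a - b) * C) * exp ((a - b) * C) = 4 ^ n" by (simp add: mult.assoc left_diff_distrib flip: exp_add)
  also have "D * real n * 4 * l^2 * exp ((a - b) * C) = Q * real n" by (simp add: Q_def D_def)
  finally have "4 ^ n \<le> Q * real n" .
  moreover have "real n * real n \<le> 4 ^ n"
  proof -
    have "real n \<le> 2 ^ n" using less_exp[of n] by (metis less_imp_le of_nat_le_iff of_nat_numeral of_nat_power)
    then have "real n * real n \<le> 2 ^ n * 2 ^ n" by (intro mult_mono) auto
    then show ?thesis by (simp flip: power_mult_distrib)
  qed
  moreover have "Q * real n < real n * real n" using n by (intro mult_strict_right_mono) auto
  ultimately show False by linarith
qed

end

text \<open>Stated for a map into the coarse model, so that \<open>flip\<close> can put the larger
  exponent first.\<close>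

theorem no_cayley_embedding:
  fixes \<Gamma> :: "('g, 'm) monoid_scheme"
  assumes b: "0 < b" and ba: "b < a" and G: "group \<Gamma>" and S: "finite S" "S \<subseteq> carrier \<Gamma>" "generate \<Gamma> S = carrier \<Gamma>"
    and K: "1 \<le> K" and C: "0 \<le> C"
    and lo: "\<And>g h. g \<in> carrier \<Gamma> \<Longrightarrow> h \<in> carrier \<Gamma> \<Longrightarrow> word_dist \<Gamma> S g h / K - C \<le> sol_dist a b (F g) (F h)"
    and hi: "\<And>g h. g \<in> carrier \<Gamma> \<Longrightarrow> h \<in> carrier \<Gamma> \<Longrightarrow> sol_dist a b (F g) (F h) \<le> K * word_dist \<Gamma> S g h + C"
    and onto: "\<And>p. \<exists>g\<in>carrier \<Gamma>. sol_dist a b p (F g) \<le> C"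
  shows False
proof -
  interpret group \<Gamma> by (rule G)
  have a: "0 < a" using b ba by simp
  define \<kappa> where "\<kappa> = ln 2 / a + ln 2 / b"
  have kap: "0 \<le> \<kappa>" using a b by (simp add: \<kappa>_def)
  obtain j where j: "\<And>p. j p \<in> carrier \<Gamma>" "\<And>p. sol_dist a b p (F (j p)) \<le> C" using onto by metis
  have jj: "\<bar>sol_dist a b (F (j p)) (F (j q)) - sol_dist a b p q\<bar> \<le> 2 * C + 2 * \<kappa>" for p q
  proof -
    have "sol_dist a b (F (j p)) (F (j q)) \<le> sol_dist a b (F (j p)) p + sol_dist a b p q + sol_dist a b q (F (j q)) + 2 * \<kappa>"
      using sol_dist_tri[OF a b, of "F (j p)" "F (j q)" p] sol_dist_tri[OF a b, of p "F (j q)" q] by (simp add: \<kappa>_def)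
    moreover have "sol_dist a b p q \<le> sol_dist a b p (F (j p)) + sol_dist a b (F (j p)) (F (j q)) + sol_dist a b (F (j q)) q + 2 * \<kappa>"
      using sol_dist_tri[OF a b, of p q "F (j p)"] sol_dist_tri[OF a b, of "F (j p)" q "F (j q)"] by (simp add: \<kappa>_def)
    ultimately show ?thesis using j(2)[of p] j(2)[of q] sol_dist_sym[of a b "F (j p)" p] sol_dist_sym[of a b "F (j q)" q] by linarith
  qed
  define E where "E = 3 * C + 2 * \<kappa>"
  define K0 where "K0 = K * K"
  define C0 where "C0 = K0 * E + C"
  have K0: "1 \<le> K0" using K mult_mono[of 1 K 1 K] by (simp add: K0_def)
  have E0: "0 \<le> E" using C kap by (simp add: E_def)
  have C0: "0 \<le> C0" using K0 E0 C by (simp add: C0_def)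
  \<comment> \<open>Left multiplication by \<open>k\<close> preserves the word metric, so the
    constants are the same for all \<open>k\<close>, and one finite set \<open>I\<close> serves
    every group element.\<close>
  have qi: "coarse_embedding a b a b K0 C0 (\<lambda>p. F (k \<otimes>\<^bsub>\<Gamma>\<^esub> j p))" if k: "k \<in> carrier \<Gamma>" for k
    unfolding coarse_embedding_def
  proof (intro allI)
    fix p q
    define w where "w = word_dist \<Gamma> S (j p) (j q)"
    have w: "word_dist \<Gamma> S (k \<otimes>\<^bsub>\<Gamma>\<^esub> j p) (k \<otimes>\<^bsub>\<Gamma>\<^esub> j q) = w" using word_dist_left[OF k j(1) j(1)] by (simp add: w_def)
    define s where "s = sol_dist a b p q"
    have kp: "k \<otimes>\<^bsub>\<Gamma>\<^esub> j p \<in> carrier \<Gamma>" "k \<otimes>\<^bsub>\<Gamma>\<^esub> j q \<in> carrier \<Gamma>" using k j by auto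
    have "w / K \<le> s + E" using lo[OF j(1) j(1), of p q] jj[of p q] by (simp add: w_def s_def E_def)
    then have w1: "w \<le> K * (s + E)" using K by (simp add: divide_le_eq mult.commute)
    have w2: "s - E \<le> K * w" using hi[OF j(1) j(1), of p q] jj[of p q] by (simp add: w_def s_def E_def)
    have "sol_dist a b (F (k \<otimes>\<^bsub>\<Gamma>\<^esub> j p)) (F (k \<otimes>\<^bsub>\<Gamma>\<^esub> j q)) \<le> K * w + C" using hi[OF kp] by (simp add: w)
    also have "K * w \<le> K * (K * (s + E))" using w1 K by (intro mult_left_mono) auto
    finally have up: "sol_dist a b (F (k \<otimes>\<^bsub>\<Gamma>\<^esub> j p)) (F (k \<otimes>\<^bsub>\<Gamma>\<^esub> j q)) \<le> K0 * s + C0" by (simp add: K0_def C0_def algebra_simps)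
    have "(s - E) / K0 \<le> w / K" using w2 K by (simp add: K0_def divide_le_eq mult.commute mult.left_commute)
    moreover have "E / K0 \<le> K0 * E"
    proof -
      have "E / K0 \<le> E / 1" using K0 E0 by (intro divide_left_mono) auto
      also have "E / 1 \<le> K0 * E" using mult_right_mono[OF K0 E0] by simp
      finally show ?thesis .
    qed
    ultimately have "s / K0 - C0 \<le> w / K - C" by (simp add: C0_def diff_divide_distrib)
    also have "\<dots> \<le> sol_dist a b (F (k \<otimes>\<^bsub>\<Gamma>\<^esub> j p)) (F (k \<otimes>\<^bsub>\<Gamma>\<^esub> j q))" using lo[OF kp] by (simp add: w)
    finally show "sol_dist a b p q / K0 - C0 \<le> sol_dist a b (F (k \<otimes>\<^bsub>\<Gamma>\<^esub> j p)) (F (k \<otimes>\<^bsub>\<Gamma>\<^esub> j q)) \<and>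
      sol_dist a b (F (k \<otimes>\<^bsub>\<Gamma>\<^esub> j p)) (F (k \<otimes>\<^bsub>\<Gamma>\<^esub> j q)) \<le> K0 * sol_dist a b p q + C0" using up by (simp add: s_def)
  qed
  \<comment> \<open>A rise by \<open>s0\<close> multiplies \<open>W\<close> by 8; at least half of
    the points rise this much, hence the factor 4.\<close>
  define s0 where "s0 = ln 8 / (a - b)"
  obtain I :: "nat list set" and q where I: "finite I" "I \<noteq> {}"
    and Iq: "\<And>\<phi>. coarse_embedding a b a b K0 C0 \<phi> \<Longrightarrow> card I \<le> 2 * card {i \<in> I. fst (\<phi> (0, 0, 0)) + s0 \<le> fst (\<phi> (q i))}"
    using mostly_rising[OF b ba K0 C0, of s0] by blast
  \<comment> \<open>Left multiplication by \<open>k = g \<otimes> inv (j 0)\<close> takes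
    \<open>j 0\<close> to \<open>g\<close> and \<open>j (q i)\<close> to
    \<open>g \<otimes> \<sigma> i\<close>. So the displacement of \<open>g\<close> does not depend
    on \<open>g\<close>: it is right multiplication by one of finitely many elements.\<close>
  define \<sigma> where "\<sigma> i = inv\<^bsub>\<Gamma>\<^esub> (j (0, 0, 0)) \<otimes>\<^bsub>\<Gamma>\<^esub> j (q i)" for i
  have sc: "\<sigma> i \<in> carrier \<Gamma>" for i using j by (simp add: \<sigma>_def)
  define \<rho> where "\<rho> = max (max 1 C) (Max ((\<lambda>i. K * real (word_length \<Gamma> S (\<sigma> i)) + C) ` I))"
  have rho: "sol_dist a b (F g) (F (g \<otimes>\<^bsub>\<Gamma>\<^esub> \<sigma> i)) \<le> \<rho>" if "g \<in> carrier \<Gamma>" "i \<in> I" for g i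
  proof -
    have "inv\<^bsub>\<Gamma>\<^esub> g \<otimes>\<^bsub>\<Gamma>\<^esub> (g \<otimes>\<^bsub>\<Gamma>\<^esub> \<sigma> i) = \<sigma> i" using that sc by (simp add: m_assoc[symmetric])
    then have "sol_dist a b (F g) (F (g \<otimes>\<^bsub>\<Gamma>\<^esub> \<sigma> i)) \<le> K * real (word_length \<Gamma> S (\<sigma> i)) + C"
      using hi[of g "g \<otimes>\<^bsub>\<Gamma>\<^esub> \<sigma> i"] that sc by (simp add: word_dist_def)
    also have "\<dots> \<le> Max ((\<lambda>i. K * real (word_length \<Gamma> S (\<sigma> i)) + C) ` I)" using I that by (intro Max_ge) auto
    finally show ?thesis by (simp add: \<rho>_def)
  qed
  \<comment> \<open>Images at distance at most one belong to elements at word distance at most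
    \<open>K * (1 + C)\<close>, that is, in one translate of a ball.\<close>
  define nb where "nb = nat \<lfloor>K * (1 + C)\<rfloor>"
  define Nb where "Nb = real (card {g \<in> carrier \<Gamma>. word_length \<Gamma> S g \<le> nb})"
  interpret sol_orbit a b C Nb "carrier \<Gamma>" F
  proof
    fix A assume A: "A \<subseteq> carrier \<Gamma>" and d: "\<And>g h. g \<in> A \<Longrightarrow> h \<in> A \<Longrightarrow> sol_dist a b (F g) (F h) \<le> 1"
    have fb: "finite {g \<in> carrier \<Gamma>. word_length \<Gamma> S g \<le> nb}" by (rule finite_word_ball[OF S])
    show "finite A \<and> real (card A) \<le> Nb"
    proof (cases "A = {}")
      case False
      then obtain g0 where g0: "g0 \<in> A" by blast
      have "A \<subseteq> (\<lambda>h. g0 \<otimes>\<^bsub>\<Gamma>\<^esub> h) ` {g \<in> carrier \<Gamma>. word_length \<Gamma> S g \<le> nb}"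
      proof
        fix g assume g: "g \<in> A"
        have gc: "g \<in> carrier \<Gamma>" "g0 \<in> carrier \<Gamma>" using g g0 A by auto
        have "word_dist \<Gamma> S g0 g / K \<le> 1 + C" using lo[OF gc(2,1)] d[OF g0 g] by simp
        then have "word_dist \<Gamma> S g0 g \<le> K * (1 + C)" using K by (simp add: divide_le_eq mult.commute)
        then have "word_length \<Gamma> S (inv\<^bsub>\<Gamma>\<^esub> g0 \<otimes>\<^bsub>\<Gamma>\<^esub> g) \<le> nb" by (simp add: word_dist_def nb_def le_nat_floor)
        moreover have "g = g0 \<otimes>\<^bsub>\<Gamma>\<^esub> (inv\<^bsub>\<Gamma>\<^esub> g0 \<otimes>\<^bsub>\<Gamma>\<^esub> g)" using gc by (simp add: m_assoc[symmetric])
        ultimately show "g \<in> (\<lambda>h. g0 \<otimes>\<^bsub>\<Gamma>\<^esub> h) ` {g \<in> carrier \<Gamma>. word_length \<Gamma> S g \<le> nb}" using gc by blast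
      qed
      then show ?thesis using fb surj_card_le[OF fb] finite_surj[OF fb] by (auto simp: Nb_def)
    qed (simp add: Nb_def)
  qed (use a b ba C onto in auto)
  show False
  proof (rule no_growth[of \<rho>])
    show "C \<le> \<rho>" "1 \<le> \<rho>" by (auto simp: \<rho>_def)
    fix A A' assume fin: "finite A'" and sub: "A \<subseteq> A'" "A' \<subseteq> carrier \<Gamma>"
      and near: "\<And>g h. g \<in> A \<Longrightarrow> h \<in> carrier \<Gamma> \<Longrightarrow> sol_dist a b (F g) (F h) \<le> \<rho> \<Longrightarrow> h \<in> A'"
    have Wp: "0 \<le> W g" for g by (simp add: W_def)
    have each: "4 * real (card I) * W g \<le> (\<Sum>i\<in>I. W (g \<otimes>\<^bsub>\<Gamma>\<^esub> \<sigma> i))" if g: "g \<in> A" for g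
    proof -
      have gc: "g \<in> carrier \<Gamma>" using g sub by auto
      define k where "k = g \<otimes>\<^bsub>\<Gamma>\<^esub> inv\<^bsub>\<Gamma>\<^esub> (j (0, 0, 0))"
      have kc: "k \<in> carrier \<Gamma>" using gc j by (simp add: k_def)
      have e: "k \<otimes>\<^bsub>\<Gamma>\<^esub> j (0, 0, 0) = g" "k \<otimes>\<^bsub>\<Gamma>\<^esub> j (q i) = g \<otimes>\<^bsub>\<Gamma>\<^esub> \<sigma> i" for i
        using gc j by (simp_all add: k_def \<sigma>_def m_assoc)
      define H where "H = {i \<in> I. fst (F g) + s0 \<le> fst (F (g \<otimes>\<^bsub>\<Gamma>\<^esub> \<sigma> i))}"
      have cH: "card I \<le> 2 * card H" using Iq[OF qi[OF kc]] by (simp add: e H_def)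
      have "real (card H) * (8 * W g) \<le> (\<Sum>i\<in>H. W (g \<otimes>\<^bsub>\<Gamma>\<^esub> \<sigma> i))"
      proof (rule sum_bounded_below)
        fix i assume "i \<in> H"
        then have "(a - b) * (fst (F g) + s0) \<le> (a - b) * fst (F (g \<otimes>\<^bsub>\<Gamma>\<^esub> \<sigma> i))" using ba by (intro mult_left_mono) (auto simp: H_def)
        moreover have "(a - b) * (fst (F g) + s0) = (a - b) * fst (F g) + ln 8" using ba by (simp add: s0_def distrib_left)
        ultimately have "exp ((a - b) * fst (F g) + ln 8) \<le> W (g \<otimes>\<^bsub>\<Gamma>\<^esub> \<sigma> i)" by (simp add: W_def)
        then show "8 * W g \<le> W (g \<otimes>\<^bsub>\<Gamma>\<^esub> \<sigma> i)" by (simp add: W_def exp_add mult.commute)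
      qed
      also have "\<dots> \<le> (\<Sum>i\<in>I. W (g \<otimes>\<^bsub>\<Gamma>\<^esub> \<sigma> i))" using I Wp by (intro sum_mono2) (auto simp: H_def)
      finally have 1: "real (card H) * (8 * W g) \<le> (\<Sum>i\<in>I. W (g \<otimes>\<^bsub>\<Gamma>\<^esub> \<sigma> i))" .
      have "real (card I) * (4 * W g) \<le> (2 * real (card H)) * (4 * W g)" using cH Wp by (intro mult_right_mono) auto
      then show ?thesis using 1 by simp
    qed
    have "real (card I) * (4 * sum W A) = (\<Sum>g\<in>A. 4 * real (card I) * W g)" by (simp add: sum_distrib_left mult_ac)
    also have "\<dots> \<le> (\<Sum>g\<in>A. \<Sum>i\<in>I. W (g \<otimes>\<^bsub>\<Gamma>\<^esub> \<sigma> i))" by (intro sum_mono each)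
    \<comment> \<open>With the sums exchanged, each \<open>i\<close> contributes the weight of a
      right translate of \<open>A\<close>; it lies in \<open>A'\<close> because
      \<open>\<sigma> i\<close> moves images by at most \<open>\<rho>\<close>.\<close>
    also have "\<dots> = (\<Sum>i\<in>I. \<Sum>g\<in>A. W (g \<otimes>\<^bsub>\<Gamma>\<^esub> \<sigma> i))" by (rule sum.swap)
    also have "\<dots> \<le> (\<Sum>i\<in>I. sum W A')"
    proof (rule sum_mono)
      fix i assume i: "i \<in> I"
      have inj: "inj_on (\<lambda>g. g \<otimes>\<^bsub>\<Gamma>\<^esub> \<sigma> i) A" using sub sc by (intro inj_onI) (metis right_cancel subsetD)
      have "(\<Sum>g\<in>A. W (g \<otimes>\<^bsub>\<Gamma>\<^esub> \<sigma> i)) = sum W ((\<lambda>g. g \<otimes>\<^bsub>\<Gamma>\<^esub> \<sigma> i) ` A)" by (simp add: sum.reindex[OF inj])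
      also have "\<dots> \<le> sum W A'"
      proof (intro sum_mono2 fin Wp)
        show "(\<lambda>g. g \<otimes>\<^bsub>\<Gamma>\<^esub> \<sigma> i) ` A \<subseteq> A'"
        proof clarify
          fix g assume g: "g \<in> A"
          then have "g \<in> carrier \<Gamma>" using sub by auto
          then show "g \<otimes>\<^bsub>\<Gamma>\<^esub> \<sigma> i \<in> A'" using near[OF g _ rho[OF _ i]] sc by simp
        qed
      qed
      finally show "(\<Sum>g\<in>A. W (g \<otimes>\<^bsub>\<Gamma>\<^esub> \<sigma> i)) \<le> sum W A'" .
    qed
    also have "\<dots> = real (card I) * sum W A'" by simp
    finally have "real (card I) * (4 * sum W A) \<le> real (card I) * sum W A'" .
    moreover have "0 < real (card I)" using I by (simp add: card_gt_0_iff)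
    ultimately show "4 * sum W A \<le> sum W A'" by (simp only: mult_le_cancel_left_pos)
  qed
qed

subsection \<open>The Riemannian distance\<close>

lemma bilinear_form_bounds:
  fixes B :: "'a::{euclidean_space, perfect_space} \<Rightarrow> 'a \<Rightarrow> real"
  assumes B: "bilinear B" and pos: "\<And>v. v \<noteq> 0 \<Longrightarrow> 0 < B v v"
  obtains c1 c2 where "0 < c1" "0 < c2" "\<And>v. (c1 * norm v)^2 \<le> B v v" "\<And>v. B v v \<le> (c2 * norm v)^2"
proof -
  interpret B: bounded_bilinear B using B by (simp add: bilinear_conv_bounded_bilinear)
  have cont: "continuous_on (sphere 0 1) (\<lambda>v. B v v)" by (intro B.continuous_on continuous_on_id)
  have ne: "sphere (0::'a) 1 \<noteq> {}" by simp
  obtain u where u: "u \<in> sphere 0 1" "\<And>v. v \<in> sphere 0 1 \<Longrightarrow> B u u \<le> B v v"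
    using continuous_attains_inf[OF compact_sphere ne cont] by blast
  obtain w where w: "w \<in> sphere 0 1" "\<And>v. v \<in> sphere 0 1 \<Longrightarrow> B v v \<le> B w w"
    using continuous_attains_sup[OF compact_sphere ne cont] by blast
  have uw: "0 < B u u" "0 < B w w" using u(1) w(1) by (intro pos; force)+
  have scale: "B v v = (norm v)^2 * B (v /\<^sub>R norm v) (v /\<^sub>R norm v)" if "v \<noteq> 0" for v
    using that by (simp add: B.scaleR_left B.scaleR_right power2_eq_square field_simps)
  have "(sqrt (B u u) * norm v)^2 \<le> B v v \<and> B v v \<le> (sqrt (B w w) * norm v)^2" for v
  proof (cases "v = 0")
    case False
    then have s: "v /\<^sub>R norm v \<in> sphere 0 1" by simp
    then show ?thesis unfolding scale[OF False] using u(2)[OF s] w(2)[OF s] uw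
      by (simp add: power_mult_distrib mult.commute[of "(norm v)^2"] mult_right_mono)
  qed (simp add: B.zero_left)
  then show thesis using that[of "sqrt (B u u)" "sqrt (B w w)"] uw by simp
qed

lemma speed_join:
  assumes m: "\<And>p. bilinear (m p)" and v: "valid_path g1" "valid_path g2"
    and i: "(speed m g1 has_integral i1) {0..1}" "(speed m g2 has_integral i2) {0..1}"
  shows "(speed m (g1 +++ g2) has_integral (i1 + i2)) {0..1}"
proof -
  have quad: "sqrt (m p (2 *\<^sub>R u) (2 *\<^sub>R u)) = 2 * sqrt (m p u u)" for p u
    using m[of p] by (simp add: bilinear_lmul bilinear_rmul real_sqrt_mult)
  obtain s1 s2 where s1: "finite s1" "\<forall>x\<in>{0..1} - s1. g1 differentiable at x"
    and s2: "finite s2" "\<forall>x\<in>{0..1} - s2. g2 differentiable at x"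
    using v by (auto simp: valid_path_def piecewise_C1_differentiable_on_def C1_differentiable_on_eq)
  have J1: "((\<lambda>t. 2 * speed m g1 (2 * t)) has_integral i1) {0..1/2}"
    using has_integral_mult_right[OF has_integral_affinity'[of "speed m g1" i1 0 1 2 0], of 2] i(1) by simp
  have J2: "((\<lambda>t. 2 * speed m g2 (2 * t - 1)) has_integral i2) {1/2..1}"
    using has_integral_mult_right[OF has_integral_affinity'[of "speed m g2" i2 0 1 2 "-1"], of 2] i(2) by simp
  have d1: "vector_derivative (g1 +++ g2) (at t) = 2 *\<^sub>R vector_derivative g1 (at (2 * t))"
    if t: "t \<in> {0..1/2} - insert (1/2) ((*) 2 -` s1)" for t
  proof (rule vector_derivative_at [OF has_vector_derivative_transform_within])
    show "0 < \<bar>t - 1/2\<bar>" using t by auto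
    have "((*) 2 has_vector_derivative 2) (at t)"
      by (simp add: has_vector_derivative_def has_derivative_def bounded_linear_mult_left)
    moreover have "(g1 has_vector_derivative vector_derivative g1 (at (2 * t))) (at (2 * t))"
      using s1 t by (auto simp: vector_derivative_works)
    ultimately show "((\<lambda>x. g1 (2 * x)) has_vector_derivative 2 *\<^sub>R vector_derivative g1 (at (2 * t))) (at t)"
      by (intro vector_diff_chain_at [simplified o_def])
  qed (use t in \<open>simp_all add: joinpaths_def dist_real_def abs_if split: if_split_asm\<close>)
  have d2: "vector_derivative (g1 +++ g2) (at t) = 2 *\<^sub>R vector_derivative g2 (at (2 * t - 1))"
    if t: "t \<in> {1/2..1} - insert (1/2) ((\<lambda>x. 2 * x - 1) -` s2)" for t
  proof (rule vector_derivative_at [OF has_vector_derivative_transform_within])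
    show "0 < \<bar>t - 1/2\<bar>" using t by auto
    have "((\<lambda>x. 2 * x - 1) has_vector_derivative 2) (at t)"
      by (simp add: has_vector_derivative_def has_derivative_def bounded_linear_mult_left)
    moreover have "(g2 has_vector_derivative vector_derivative g2 (at (2 * t - 1))) (at (2 * t - 1))"
      using s2 t by (auto simp: vector_derivative_works)
    ultimately show "((\<lambda>x. g2 (2 * x - 1)) has_vector_derivative 2 *\<^sub>R vector_derivative g2 (at (2 * t - 1))) (at t)"
      by (intro vector_diff_chain_at [simplified o_def])
  qed (use t in \<open>simp_all add: joinpaths_def dist_real_def abs_if split: if_split_asm\<close>)
  have "(speed m (g1 +++ g2) has_integral i1) {0..1/2}"
  proof (rule has_integral_spike_finite[OF _ _ J1])
    show "finite (insert (1/2) ((*) 2 -` s1))"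
      using s1 by (force intro: finite_vimageI inj_onI)
    fix t assume "t \<in> {0..1/2} - insert (1/2) ((*) 2 -` s1)"
    from d1[OF this] this show "speed m (g1 +++ g2) t = 2 * speed m g1 (2 * t)"
      unfolding speed_def by (simp add: quad) (simp add: joinpaths_def)
  qed
  moreover have "(speed m (g1 +++ g2) has_integral i2) {1/2..1}"
  proof (rule has_integral_spike_finite[OF _ _ J2])
    show "finite (insert (1/2) ((\<lambda>x. 2 * x - 1) -` s2))"
      using s2 by (force intro: finite_vimageI inj_onI)
    fix t assume "t \<in> {1/2..1} - insert (1/2) ((\<lambda>x. 2 * x - 1) -` s2)"
    from d2[OF this] this show "speed m (g1 +++ g2) t = 2 * speed m g2 (2 * t - 1)"
      unfolding speed_def by (simp add: quad) (simp add: joinpaths_def)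
  qed
  ultimately show ?thesis by (intro has_integral_combine[of 0 "1/2" 1]) auto
qed

lemma functional_increment_le:
  fixes f :: "'a::euclidean_space \<Rightarrow> real"
  assumes f: "bounded_linear f" and v: "valid_path \<gamma>" and s: "0 \<le> s" "s \<le> 1" and \<kappa>: "0 \<le> \<kappa>"
    and int: "\<sigma> integrable_on {0..1}" and nn: "\<And>t. 0 \<le> \<sigma> t"
    and le: "\<And>t. 0 \<le> t \<Longrightarrow> t \<le> 1 \<Longrightarrow> \<bar>f (vector_derivative \<gamma> (at t))\<bar> \<le> \<kappa> * \<sigma> t"
  shows "\<bar>f (\<gamma> s) - f (\<gamma> 0)\<bar> \<le> \<kappa> * integral {0..1} \<sigma>"
proof -
  obtain S where S: "finite S" "\<forall>x\<in>{0..1} - S. \<gamma> differentiable at x" and cont: "continuous_on {0..1} \<gamma>"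
    using v by (auto simp: valid_path_def piecewise_C1_differentiable_on_def C1_differentiable_on_eq)
  have sub: "{0..s} \<subseteq> {0..1}" using s by auto
  have I: "((\<lambda>t. f (vector_derivative \<gamma> (at t))) has_integral (f (\<gamma> s) - f (\<gamma> 0))) {0..s}"
  proof (rule fundamental_theorem_of_calculus_strong[OF S(1) s(1)])
    show "continuous_on {0..s} (\<lambda>t. f (\<gamma> t))"
      by (intro bounded_linear.continuous_on[OF f] continuous_on_subset[OF cont sub])
    fix x assume "x \<in> {0..s} - S"
    then have "(\<gamma> has_vector_derivative vector_derivative \<gamma> (at x)) (at x)"
      using S(2) sub by (auto simp: vector_derivative_works[symmetric])
    then show "((\<lambda>t. f (\<gamma> t)) has_vector_derivative f (vector_derivative \<gamma> (at x))) (at x)"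
      by (rule bounded_linear.has_vector_derivative[OF f])
  qed
  have int': "\<sigma> integrable_on {0..s}" using integrable_subinterval_real[OF int sub] .
  have "\<bar>f (\<gamma> s) - f (\<gamma> 0)\<bar> = norm (integral {0..s} (\<lambda>t. f (vector_derivative \<gamma> (at t))))"
    using integral_unique[OF I] by simp
  also have "\<dots> \<le> integral {0..s} (\<lambda>t. \<kappa> * \<sigma> t)"
    using I integrable_on_cmult_left[OF int'] le s by (intro integral_norm_bound_integral) auto
  also have "\<dots> = \<kappa> * integral {0..s} \<sigma>" by simp
  also have "\<dots> \<le> \<kappa> * integral {0..1} \<sigma>"
    using \<kappa> integral_subset_le[OF sub int' int] nn by (intro mult_left_mono) auto
  finally show ?thesis .
qed

text \<open>Replaces the infimum in \<open>riemannian_dist\<close> by a relation that composes along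
  paths.\<close>

definition joined :: "('a::euclidean_space \<Rightarrow> 'a \<Rightarrow> 'a \<Rightarrow> real) \<Rightarrow> 'a \<Rightarrow> 'a \<Rightarrow> real \<Rightarrow> bool" where
  "joined m p q L \<longleftrightarrow> (\<exists>\<gamma> l. valid_path \<gamma> \<and> pathstart \<gamma> = p \<and> pathfinish \<gamma> = q \<and> (speed m \<gamma> has_integral l) {0..1} \<and> l \<le> L)"

lemma joined_mono: "joined m p q L \<Longrightarrow> L \<le> L' \<Longrightarrow> joined m p q L'"
  unfolding joined_def using order_trans by blast

lemma joined_trans:
  assumes m: "\<And>p. bilinear (m p)" and "joined m p q L" "joined m q r L'"
  shows "joined m p r (L + L')"
proof -
  from assms(2,3) obtain g1 i1 g2 i2 where g: "valid_path g1" "valid_path g2" "pathstart g1 = p" "pathfinish g1 = q"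
    "pathstart g2 = q" "pathfinish g2 = r" and i: "(speed m g1 has_integral i1) {0..1}" "(speed m g2 has_integral i2) {0..1}"
    and le: "i1 \<le> L" "i2 \<le> L'"
    unfolding joined_def by blast
  show ?thesis unfolding joined_def
    using g le speed_join[OF m g(1,2) i] by (intro exI[of _ "g1 +++ g2"] exI[of _ "i1 + i2"]) (simp add: valid_path_join)
qed

lemma riemannian_dist_le:
  assumes c: "joined m p q L" and pos: "\<And>p v. 0 \<le> m p v v"
  shows "riemannian_dist m p q \<le> L"
proof -
  from c obtain \<gamma> l where g: "valid_path \<gamma>" "pathstart \<gamma> = p" "pathfinish \<gamma> = q" "(speed m \<gamma> has_integral l) {0..1}" "l \<le> L"
    unfolding joined_def by blast
  have "riemannian_dist m p q \<le> integral {0..1} (speed m \<gamma>)"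
    unfolding riemannian_dist_def
  proof (rule cInf_lower)
    show "bdd_below {integral {0..1} (speed m \<gamma>) |\<gamma>. valid_path \<gamma> \<and> pathstart \<gamma> = p \<and> pathfinish \<gamma> = q \<and> speed m \<gamma> integrable_on {0..1}}"
      using pos by (intro bdd_belowI[of _ 0]) (auto intro!: integral_nonneg simp: speed_def)
  qed (use g in blast)
  then show ?thesis using g(4,5) by (simp add: integral_unique)
qed

section \<open>Comparison of the left invariant metric with the coarse one\<close>

locale sol_metric =
  fixes a b :: real and m :: "pt \<Rightarrow> pt \<Rightarrow> pt \<Rightarrow> real"
  assumes a: "0 < a" and b: "0 < b" and rm: "riemannian_metric m" and inv: "left_invariant (sol_group a b) m"
begin

lemma bil: "bilinear (m p)" using rm unfolding riemannian_metric_def by blast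

lemma m_pos: "v \<noteq> 0 \<Longrightarrow> 0 < m p v v" using rm unfolding riemannian_metric_def by blast

lemma m_nonneg: "0 \<le> m p v v"
  using m_pos[of v p] bilinear_lzero[OF bil] by (cases "v = 0") (auto simp: less_imp_le)

text \<open>Left invariance for the translation that takes the identity to the base point. From here
  on only the inner product at the identity matters.\<close>

lemma m_translate: "m (z, x, y) (u, v, w) (u, v, w) = m 0 (u, exp (- a * z) * v, exp (b * z) * w) (u, exp (- a * z) * v, exp (b * z) * w)"
proof -
  define T where "T q = (z, x, y) \<otimes>\<^bsub>sol_group a b\<^esub> q" for q
  define D where "D q = (fst q, exp (a * z) * fst (snd q), exp (- b * z) * snd (snd q))" for q :: pt
  have T: "T = (\<lambda>q. (z, x, y) + D q)" by (rule ext) (auto simp: T_def D_def sol_group_def split: prod.split)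
  have "bounded_linear D" unfolding D_def
    by (intro bounded_linear_Pair bounded_linear_fst bounded_linear_const_mult
        bounded_linear_compose[OF bounded_linear_fst bounded_linear_snd] bounded_linear_compose[OF bounded_linear_snd bounded_linear_snd])
  then have "(T has_derivative D) (at 0)" unfolding T
    using has_derivative_add[OF has_derivative_const bounded_linear_imp_has_derivative] by force
  then have fd: "frechet_derivative T (at 0) = D" by (rule frechet_derivative_at[symmetric])
  have "m (T 0) (frechet_derivative T (at 0) s) (frechet_derivative T (at 0) s) = m 0 s s" for s
    using inv unfolding left_invariant_def T_def by blast
  from this[of "(u, exp (- a * z) * v, exp (b * z) * w)"] show ?thesis
    unfolding fd by (simp add: T D_def zero_prod_def mult.assoc[symmetric] flip: exp_add)
qed


text \<open>In \<open>m_translate\<close> the factors depend on \<open>z\<close> only, and each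
  segment is vertical or has constant \<open>z\<close>; so its speed is constant.\<close>

lemma joined_segment:
  assumes c2: "\<And>v. m 0 v v \<le> (c2 * norm v)^2" and c20: "0 \<le> c2"
  shows "joined m (z, x, y) (z', x, y) (c2 * \<bar>z' - z\<bar>)"
    and "joined m (z, x, y) (z, x', y) (c2 * (exp (- a * z) * \<bar>x' - x\<bar>))"
    and "joined m (z, x, y) (z, x, y') (c2 * (exp (b * z) * \<bar>y' - y\<bar>))"
proof -
  have seg: "joined m p q L"
    if "\<And>t. m (linepath p q t) (q - p) (q - p) = m 0 v v" and "c2 * norm v \<le> L" for p q v L
  proof -
    have "((\<lambda>t. sqrt (m 0 v v)) has_integral sqrt (m 0 v v)) {0..1::real}"
      using has_integral_const_real[of "sqrt (m 0 v v)" 0 1] by simp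
    then have "(speed m (linepath p q) has_integral sqrt (m 0 v v)) {0..1}" by (simp add: speed_def[abs_def] that(1))
    moreover have "sqrt (m 0 v v) \<le> L"
      using real_sqrt_le_mono[OF c2[of v]] c20 that(2) by simp
    ultimately show ?thesis unfolding joined_def by (intro exI[of _ "linepath p q"]) auto
  qed
  have vert: "m (s, x, y) (d, 0) (d, 0) = m 0 (d, 0, 0) (d, 0, 0)" for s d
    using m_translate[of s x y d 0 0] by (simp add: zero_prod_def)
  show "joined m (z, x, y) (z', x, y) (c2 * \<bar>z' - z\<bar>)"
    by (rule seg[of _ _ "(z' - z, 0, 0)"])
      (auto simp: linepath_def vert norm_Pair simp flip: distrib_right)
  show "joined m (z, x, y) (z, x', y) (c2 * (exp (- a * z) * \<bar>x' - x\<bar>))"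
    by (rule seg[of _ _ "(0, exp (- a * z) * (x' - x), 0)"])
      (auto simp: linepath_def m_translate norm_Pair abs_mult simp flip: distrib_right)
  show "joined m (z, x, y) (z, x, y') (c2 * (exp (b * z) * \<bar>y' - y\<bar>))"
    by (rule seg[of _ _ "(0, 0, exp (b * z) * (y' - y))"])
      (auto simp: linepath_def m_translate norm_Pair abs_mult simp flip: distrib_right)
qed

text \<open>Three vertical legs of length at most \<open>M - N\<close> and two horizontal ones of
  length at most one, all times \<open>c2\<close>.\<close>

lemma joined_sol_dist:
  assumes c2: "\<And>v. m 0 v v \<le> (c2 * norm v)^2" and c20: "0 \<le> c2"
  shows "joined m p q (3 * c2 * sol_dist a b p q + 2 * c2)"
proof -
  obtain z x y where p: "p = (z, x, y)" by (cases p)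
  obtain z' x' y' where q: "q = (z', x', y')" by (cases q)
  define M where "M = Mr a p q"
  define N where "N = Nr b p q"
  have M: "z \<le> M" "z' \<le> M" "\<bar>x - x'\<bar> \<le> exp (a * M)" using Mr_le_iff[OF a, of p q M] by (simp_all add: M_def p q)
  have N: "N \<le> z" "N \<le> z'" "\<bar>y - y'\<bar> \<le> exp (- b * N)" using Nr_ge_iff[OF b, of N p q] by (simp_all add: N_def p q)
  have x1: "exp (- a * M) * \<bar>x' - x\<bar> \<le> 1"
  proof -
    have "exp (- a * M) * \<bar>x' - x\<bar> \<le> exp (- a * M) * exp (a * M)" using M by (intro mult_left_mono) auto
    then show ?thesis by (simp flip: exp_add)
  qed
  have y1: "exp (b * N) * \<bar>y' - y\<bar> \<le> 1"
  proof -
    have "exp (b * N) * \<bar>y' - y\<bar> \<le> exp (b * N) * exp (- b * N)" using N by (intro mult_left_mono) auto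
    then show ?thesis by (simp flip: exp_add)
  qed
  note S = joined_segment[OF c2 c20] and T = joined_trans[OF bil]
  have c: "joined m p q (c2 * \<bar>N - z\<bar> + c2 * (exp (b * N) * \<bar>y' - y\<bar>) + c2 * \<bar>M - N\<bar> + c2 * (exp (- a * M) * \<bar>x' - x\<bar>) + c2 * \<bar>z' - M\<bar>)"
    unfolding p q by (rule T[OF T[OF T[OF T[OF S(1) S(3)] S(1)] S(2)] S(1)])
  have "c2 * \<bar>N - z\<bar> \<le> c2 * (M - N)" "c2 * \<bar>M - N\<bar> \<le> c2 * (M - N)" "c2 * \<bar>z' - M\<bar> \<le> c2 * (M - N)"
    using M N c20 by (auto intro!: mult_left_mono)
  moreover have "c2 * (exp (b * N) * \<bar>y' - y\<bar>) \<le> c2 * 1" "c2 * (exp (- a * M) * \<bar>x' - x\<bar>) \<le> c2 * 1"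
    by (intro mult_left_mono x1 y1 c20)+
  moreover have "3 * c2 * sol_dist a b p q + 2 * c2 = 3 * (c2 * (M - N)) + 2 * c2" by (simp add: sol_dist_def M_def N_def)
  ultimately have "c2 * \<bar>N - z\<bar> + c2 * (exp (b * N) * \<bar>y' - y\<bar>) + c2 * \<bar>M - N\<bar> + c2 * (exp (- a * M) * \<bar>x' - x\<bar>) + c2 * \<bar>z' - M\<bar>
      \<le> 3 * c2 * sol_dist a b p q + 2 * c2" by linarith
  then show ?thesis by (rule joined_mono[OF c])
qed

text \<open>A path stays within \<open>l\<close> of its initial height \<open>Z 0\<close>, where
  \<open>x\<close> changes by at most \<open>exp (a * (Z 0 + l)) * l\<close> in total. Since
  \<open>l \<le> exp l\<close>, the last factor costs \<open>l / a\<close> in height, and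
  \<open>M\<close> is at most \<open>Z 0 + l + l / a\<close>; likewise for \<open>N\<close>.\<close>

lemma sol_dist_le_length:
  assumes c1: "0 < c1" "\<And>v. (c1 * norm v)^2 \<le> m 0 v v"
    and v: "valid_path \<gamma>" and int: "speed m \<gamma> integrable_on {0..1}"
  shows "sol_dist a b (pathstart \<gamma>) (pathfinish \<gamma>) \<le> (2 + 1 / a + 1 / b) / c1 * integral {0..1} (speed m \<gamma>)"
proof -
  define l where "l = 1 / c1 * integral {0..1} (speed m \<gamma>)"
  have nn: "0 \<le> speed m \<gamma> t" for t by (simp add: speed_def m_nonneg)
  have l0: "0 \<le> l" unfolding l_def using c1(1) integral_nonneg[OF int nn] by simp
  define d where "d t = vector_derivative \<gamma> (at t)" for t
  define Z where "Z t = fst (\<gamma> t)" for t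
  have sp: "\<bar>fst (d t)\<bar> \<le> 1 / c1 * speed m \<gamma> t" "exp (- a * Z t) * \<bar>fst (snd (d t))\<bar> \<le> 1 / c1 * speed m \<gamma> t"
    "exp (b * Z t) * \<bar>snd (snd (d t))\<bar> \<le> 1 / c1 * speed m \<gamma> t" for t
  proof -
    obtain z x y where p: "\<gamma> t = (z, x, y)" by (cases "\<gamma> t")
    obtain e1 e2 e3 where e: "d t = (e1, e2, e3)" by (cases "d t")
    define w where "w = (e1, exp (- a * z) * e2, exp (b * z) * e3)"
    have "speed m \<gamma> t = sqrt (m 0 w w)" by (simp add: speed_def p e d_def[symmetric] m_translate w_def)
    then have "c1 * norm w \<le> speed m \<gamma> t" using real_le_rsqrt[OF c1(2)[of w]] by simp
    then have "norm w \<le> 1 / c1 * speed m \<gamma> t" using c1 by (simp add: le_divide_eq mult.commute)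
    moreover have "\<bar>e1\<bar> \<le> norm w" "norm (snd w) \<le> norm w" "\<bar>exp (- a * z) * e2\<bar> \<le> norm (snd w)" "\<bar>exp (b * z) * e3\<bar> \<le> norm (snd w)"
      using norm_fst_le[of e1 "snd w"] norm_snd_le[of "snd w" e1] norm_fst_le[of "exp (- a * z) * e2" "exp (b * z) * e3"]
        norm_snd_le[of "exp (b * z) * e3" "exp (- a * z) * e2"] by (simp_all add: w_def)
    ultimately show "\<bar>fst (d t)\<bar> \<le> 1 / c1 * speed m \<gamma> t" "exp (- a * Z t) * \<bar>fst (snd (d t))\<bar> \<le> 1 / c1 * speed m \<gamma> t"
      "exp (b * Z t) * \<bar>snd (snd (d t))\<bar> \<le> 1 / c1 * speed m \<gamma> t"
      by - (simp only: e p Z_def fst_conv snd_conv abs_mult abs_exp_cancel; linarith)+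
  qed
  have Z: "\<bar>Z s - Z 0\<bar> \<le> l" if "0 \<le> s" "s \<le> 1" for s
    unfolding Z_def l_def
    by (rule functional_increment_le[OF bounded_linear_fst v that _ int nn]) (use c1 sp in \<open>auto simp: d_def\<close>)
  have X: "\<bar>fst (snd (\<gamma> 1)) - fst (snd (\<gamma> 0))\<bar> \<le> exp (a * (Z 0 + l)) * l"
  proof -
    have "\<bar>fst (snd (\<gamma> 1)) - fst (snd (\<gamma> 0))\<bar> \<le> exp (a * (Z 0 + l)) / c1 * integral {0..1} (speed m \<gamma>)"
    proof (rule functional_increment_le[where f = "\<lambda>p. fst (snd p)", OF _ v _ _ _ int nn])
      show "bounded_linear (\<lambda>p::pt. fst (snd p))" by (rule bounded_linear_compose[OF bounded_linear_fst bounded_linear_snd])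
      fix t :: real assume t: "0 \<le> t" "t \<le> 1"
      have "\<bar>fst (snd (d t))\<bar> = exp (a * Z t) * (exp (- a * Z t) * \<bar>fst (snd (d t))\<bar>)" by (simp add: mult.assoc[symmetric] flip: exp_add)
      also have "\<dots> \<le> exp (a * Z t) * (1 / c1 * speed m \<gamma> t)" using sp by (intro mult_left_mono) auto
      also have "\<dots> \<le> exp (a * (Z 0 + l)) * (1 / c1 * speed m \<gamma> t)" using Z[OF t] a c1 nn by (intro mult_right_mono) auto
      finally show "\<bar>fst (snd (vector_derivative \<gamma> (at t)))\<bar> \<le> exp (a * (Z 0 + l)) / c1 * speed m \<gamma> t" by (simp add: d_def)
    qed (use c1 in auto)
    then show ?thesis by (simp add: l_def)
  qed
  have Y: "\<bar>snd (snd (\<gamma> 1)) - snd (snd (\<gamma> 0))\<bar> \<le> exp (- b * (Z 0 - l)) * l"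
  proof -
    have "\<bar>snd (snd (\<gamma> 1)) - snd (snd (\<gamma> 0))\<bar> \<le> exp (- b * (Z 0 - l)) / c1 * integral {0..1} (speed m \<gamma>)"
    proof (rule functional_increment_le[where f = "\<lambda>p. snd (snd p)", OF _ v _ _ _ int nn])
      show "bounded_linear (\<lambda>p::pt. snd (snd p))" by (rule bounded_linear_compose[OF bounded_linear_snd bounded_linear_snd])
      fix t :: real assume t: "0 \<le> t" "t \<le> 1"
      have "\<bar>snd (snd (d t))\<bar> = exp (- b * Z t) * (exp (b * Z t) * \<bar>snd (snd (d t))\<bar>)" by (simp add: mult.assoc[symmetric] flip: exp_add)
      also have "\<dots> \<le> exp (- b * Z t) * (1 / c1 * speed m \<gamma> t)" using sp by (intro mult_left_mono) auto
      also have "\<dots> \<le> exp (- b * (Z 0 - l)) * (1 / c1 * speed m \<gamma> t)" using Z[OF t] b c1 nn by (intro mult_right_mono) auto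
      finally show "\<bar>snd (snd (vector_derivative \<gamma> (at t)))\<bar> \<le> exp (- b * (Z 0 - l)) / c1 * speed m \<gamma> t" by (simp add: d_def)
    qed (use c1 in auto)
    then show ?thesis by (simp add: l_def)
  qed
  have el: "l \<le> exp l" using exp_ge_add_one_self[of l] by linarith
  have Z1: "\<bar>Z 1 - Z 0\<bar> \<le> l" by (rule Z) auto
  have la: "0 \<le> l / a" "0 \<le> l / b" using l0 a b by auto
  have "Mr a (\<gamma> 0) (\<gamma> 1) \<le> Z 0 + l + l / a"
  proof -
    have "\<bar>fst (snd (\<gamma> 0)) - fst (snd (\<gamma> 1))\<bar> \<le> exp (a * (Z 0 + l)) * exp l" using order_trans[OF X mult_left_mono[OF el exp_ge_zero]] by (simp only: abs_minus_commute)
    also have "\<dots> = exp (a * (Z 0 + l + l / a))" using a by (simp add: distrib_left flip: exp_add)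
    finally show ?thesis unfolding Mr_le_iff[OF a] using Z1 la l0 by (auto simp: Z_def)
  qed
  moreover have "Z 0 - l - l / b \<le> Nr b (\<gamma> 0) (\<gamma> 1)"
  proof -
    have "\<bar>snd (snd (\<gamma> 0)) - snd (snd (\<gamma> 1))\<bar> \<le> exp (- b * (Z 0 - l)) * exp l" using order_trans[OF Y mult_left_mono[OF el exp_ge_zero]] by (simp only: abs_minus_commute)
    also have "\<dots> = exp (- b * (Z 0 - l - l / b))" using b by (simp add: right_diff_distrib distrib_left flip: exp_add)
    finally show ?thesis unfolding Nr_ge_iff[OF b] using Z1 la l0 by (auto simp: Z_def)
  qed
  ultimately have "sol_dist a b (\<gamma> 0) (\<gamma> 1) \<le> 2 * l + l / a + l / b" by (simp add: sol_dist_def)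
  also have "\<dots> = (2 + 1 / a + 1 / b) / c1 * integral {0..1} (speed m \<gamma>)" by (simp add: l_def add_divide_distrib distrib_left distrib_right mult.commute)
  finally show ?thesis by (simp add: pathstart_def pathfinish_def)
qed

theorem sol_dist_quasi_isometric:
  obtains K C where "1 \<le> K" "0 \<le> C" "\<And>p q. sol_dist a b p q \<le> K * riemannian_dist m p q + C"
    "\<And>p q. riemannian_dist m p q \<le> K * sol_dist a b p q + C"
proof -
  obtain c1 c2 where c: "0 < c1" "0 < c2" "\<And>v. (c1 * norm v)^2 \<le> m 0 v v" "\<And>v. m 0 v v \<le> (c2 * norm v)^2"
    using bilinear_form_bounds[OF bil m_pos] by blast
  define k where "k = (2 + 1 / a + 1 / b) / c1"
  have k: "0 < k" unfolding k_def using a b c by (intro divide_pos_pos add_pos_pos) auto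
  have cn: "joined m p q (3 * c2 * sol_dist a b p q + 2 * c2)" for p q using joined_sol_dist c by simp
  have low: "sol_dist a b p q / k \<le> riemannian_dist m p q" for p q
    unfolding riemannian_dist_def
  proof (rule cInf_greatest)
    show "{integral {0..1} (speed m \<gamma>) |\<gamma>. valid_path \<gamma> \<and> pathstart \<gamma> = p \<and> pathfinish \<gamma> = q \<and> speed m \<gamma> integrable_on {0..1}} \<noteq> {}"
      using cn[of p q] unfolding joined_def by blast
    fix r assume "r \<in> {integral {0..1} (speed m \<gamma>) |\<gamma>. valid_path \<gamma> \<and> pathstart \<gamma> = p \<and> pathfinish \<gamma> = q \<and> speed m \<gamma> integrable_on {0..1}}"
    then obtain \<gamma> where "r = integral {0..1} (speed m \<gamma>)" "valid_path \<gamma>" "pathstart \<gamma> = p" "pathfinish \<gamma> = q" "speed m \<gamma> integrable_on {0..1}"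
      by blast
    then have "sol_dist a b p q \<le> k * r" using sol_dist_le_length[OF c(1,3), of \<gamma>] by (simp add: k_def)
    then show "sol_dist a b p q / k \<le> r" using k by (simp add: divide_le_eq mult.commute)
  qed
  have d0: "0 \<le> riemannian_dist m p q" for p q using low[of p q] sol_dist_nonneg[OF a b, of p q] k by (meson divide_nonneg_pos order_trans)
  show thesis
  proof (rule that[of "max 1 (max k (3 * c2))" "2 * c2"])
    fix p q
    have "sol_dist a b p q \<le> k * riemannian_dist m p q" using low[of p q] k by (simp add: divide_le_eq mult.commute)
    also have "\<dots> \<le> max 1 (max k (3 * c2)) * riemannian_dist m p q" using d0 by (intro mult_right_mono) auto
    finally show "sol_dist a b p q \<le> max 1 (max k (3 * c2)) * riemannian_dist m p q + 2 * c2" using c by simp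
    have "riemannian_dist m p q \<le> 3 * c2 * sol_dist a b p q + 2 * c2" by (rule riemannian_dist_le[OF cn m_nonneg])
    also have "3 * c2 * sol_dist a b p q \<le> max 1 (max k (3 * c2)) * sol_dist a b p q" using sol_dist_nonneg[OF a b] by (intro mult_right_mono) auto
    finally show "riemannian_dist m p q \<le> max 1 (max k (3 * c2)) * sol_dist a b p q + 2 * c2" by simp
  qed (use c in auto)
qed

end

theorem theorem1p6:
  fixes a b :: real
    and m :: "real \<times> (real \<times> real) \<Rightarrow> real \<times> (real \<times> real) \<Rightarrow> real \<times> (real \<times> real) \<Rightarrow> real"
    and \<Gamma> :: "('g, 'm) monoid_scheme"
    and S :: "'g set"
  assumes "a > 0" and "b > 0" and "a \<noteq> b"
    and "riemannian_metric m" and "left_invariant (sol_group a b) m"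
    and "group \<Gamma>"
    and "finite S" and "S \<subseteq> carrier \<Gamma>" and "generate \<Gamma> S = carrier \<Gamma>"
  shows "\<not> quasi_isometric (carrier \<Gamma>) (word_dist \<Gamma> S)
             (carrier (sol_group a b)) (riemannian_dist m)"
proof
  assume "quasi_isometric (carrier \<Gamma>) (word_dist \<Gamma> S) (carrier (sol_group a b)) (riemannian_dist m)"
  then obtain K C f where qi: "quasi_isometry K C (carrier \<Gamma>) (word_dist \<Gamma> S) UNIV (riemannian_dist m) f"
    by (auto simp: quasi_isometric_def sol_group_def)
  have K: "1 \<le> K" and C: "0 \<le> C" using qi by (simp_all add: quasi_isometry_def)
  have lo: "word_dist \<Gamma> S g h / K - C \<le> riemannian_dist m (f g) (f h)"
    and hi: "riemannian_dist m (f g) (f h) \<le> K * word_dist \<Gamma> S g h + C"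
    if "g \<in> carrier \<Gamma>" "h \<in> carrier \<Gamma>" for g h
    using qi that by (simp_all add: quasi_isometry_def)
  have onto: "\<exists>g\<in>carrier \<Gamma>. riemannian_dist m p (f g) \<le> C" for p
    using qi unfolding quasi_isometry_def by blast
  interpret sol_metric a b m by standard (use assms in auto)
  obtain K2 C2 where K2: "1 \<le> K2" and C2: "0 \<le> C2" and up: "\<And>p q. sol_dist a b p q \<le> K2 * riemannian_dist m p q + C2"
    and dn: "\<And>p q. riemannian_dist m p q \<le> K2 * sol_dist a b p q + C2"
    using sol_dist_quasi_isometric by blast
  define K' where "K' = K2 * K"
  define C' where "C' = K2 * C + C2 + C"
  have K': "1 \<le> K'" using mult_mono[OF K2 K] K2 by (simp add: K'_def)
  have KC: "0 \<le> K2 * C" using K2 C by simp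
  have C': "0 \<le> C'" using C C2 KC by (simp add: C'_def)
  have hi': "sol_dist a b (f g) (f h) \<le> K' * word_dist \<Gamma> S g h + C'" if "g \<in> carrier \<Gamma>" "h \<in> carrier \<Gamma>" for g h
  proof -
    have "K2 * riemannian_dist m (f g) (f h) \<le> K2 * (K * word_dist \<Gamma> S g h + C)" using hi[OF that] K2 by (intro mult_left_mono) auto
    then show ?thesis using up[of "f g" "f h"] C by (simp add: K'_def C'_def distrib_left mult.assoc)
  qed
  have lo': "word_dist \<Gamma> S g h / K' - C' \<le> sol_dist a b (f g) (f h)" if "g \<in> carrier \<Gamma>" "h \<in> carrier \<Gamma>" for g h
  proof -
    have "(word_dist \<Gamma> S g h / K) / K2 \<le> (K2 * sol_dist a b (f g) (f h) + C2 + C) / K2"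
      using lo[OF that] dn[of "f g" "f h"] K2 by (intro divide_right_mono) auto
    also have "\<dots> = sol_dist a b (f g) (f h) + (C2 + C) / K2" using K2 by (simp add: add_divide_distrib)
    also have "(C2 + C) / K2 \<le> (C2 + C) / 1" using K2 C C2 by (intro divide_left_mono) auto
    finally show ?thesis using KC by (simp add: K'_def C'_def mult.commute)
  qed
  have onto': "\<exists>g\<in>carrier \<Gamma>. sol_dist a b p (f g) \<le> C'" for p
  proof -
    obtain g where g: "g \<in> carrier \<Gamma>" "riemannian_dist m p (f g) \<le> C" using onto by blast
    then have "K2 * riemannian_dist m p (f g) \<le> K2 * C" using K2 by (intro mult_left_mono) auto
    then have "sol_dist a b p (f g) \<le> C'" using up[of p "f g"] C by (simp add: C'_def)
    then show ?thesis using g by blast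
  qed
  consider "b < a" | "a < b" using \<open>a \<noteq> b\<close> by linarith
  then show False
  proof cases
    case 1
    show False by (rule no_cayley_embedding[OF \<open>b > 0\<close> 1 assms(6-9) K' C' lo' hi' onto'])
  next
    case 2
    \<comment> \<open>\<open>flip\<close> on the target exchanges the exponents, so the larger one
      again belongs to the \<open>x\<close>-direction.\<close>
    have onto2: "\<exists>g\<in>carrier \<Gamma>. sol_dist b a p (flip (f g)) \<le> C'" for p
      using onto'[of "flip p"] sol_dist_flip[of b a "flip p"] by simp
    show False
      by (rule no_cayley_embedding[OF \<open>a > 0\<close> 2 assms(6-9) K' C' _ _ onto2]) (simp_all only: sol_dist_flip lo' hi')
  qed
qed

end
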